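(* Let $G,H$ be finitely generated groups, and let $C$ be a finite group that embeds in $G$ and in $H$ (with fixed embeddings). Then the acyclic graph word problem $\mathbf{AGWP}(G*_C H)$ for the amalgamated free product $G*_C H$ is $\mathbf{P}$-time Cook reducible to $\mathbf{AGWP}(G),\mathbf{AGWP}(H)$ (that is, there is an algorithm solving $\mathbf{AGWP}(G*_CH)$ which makes polynomially many calls to subroutines for $\mathbf{AGWP}(G)$ and $\mathbf{AGWP}(H)$ and uses polynomial time outside of those calls).
   Context: For a group $G$ with a finite generating set $X$, the acyclic graph word problem $\mathbf{AGWP}(G)$ is the following decision problem. Input: a finite acyclic directed graph $\Gamma$ with edges labeled by letters in $X\cup X^{-1}\cup\{\varepsilon\}$ ($\varepsilon$ the empty word), with two marked vertices $\alpha$ and $\omega$. Question: is there an oriented path in $\Gamma$ from $\alpha$ to $\omega$ labeled by a word $w$ such that $w=1$ in $G$? The size of an instance is the number of vertices plus the number of edges plus the total length of edge labels. Up to linear-time equivalence the problem does not depend on the finite generating set $X$, so $X$ is arbitrary and omitted from notation. A decision problem $A$ is $\mathbf{P}$-time Cook reducible to a problem $B$ if there is an algorithm that solves $A$ using a polynomial number of calls to a subroutine for $B$, and polynomial time outside of those calls. *)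

theory Defs
  imports
    "HOL-Algebra.Generated_Groups"
    "HOL-Computational_Algebra.Polynomial"
    "Graph_Theory.Arc_Walk"
begin

section \<open>Amalgamated free products\<close>

text \<open>
  \<open>G *\<^sub>C H\<close> is the group generated by the disjoint union of \<open>G\<close> and \<open>H\<close>, subject to the
  multiplication tables of \<open>G\<close> and \<open>H\<close> and the relations \<open>\<phi> c = \<psi> c\<close> for \<open>c \<in> C\<close>.
  Formal inverses of the generators are not needed, since the generating set is
  closed under inversion; so the group is a quotient of the monoid of words over
  \<open>carrier G <+> carrier H\<close>.
\<close>

definition amalg_words ::
    "('a, 'm) monoid_scheme \<Rightarrow> ('b, 'n) monoid_scheme \<Rightarrow> ('a + 'b) list set" where
  "amalg_words G H = lists (carrier G <+> carrier H)"

inductive_set amalg_rel ::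
    "('a, 'm) monoid_scheme \<Rightarrow> ('b, 'n) monoid_scheme \<Rightarrow> ('c, 'k) monoid_scheme \<Rightarrow>
     ('c \<Rightarrow> 'a) \<Rightarrow> ('c \<Rightarrow> 'b) \<Rightarrow> (('a + 'b) list \<times> ('a + 'b) list) set"
  for G :: "('a, 'm) monoid_scheme" and H :: "('b, 'n) monoid_scheme"
    and C :: "('c, 'k) monoid_scheme" and \<phi> :: "'c \<Rightarrow> 'a" and \<psi> :: "'c \<Rightarrow> 'b" where
  refl: "w \<in> amalg_words G H \<Longrightarrow> (w, w) \<in> amalg_rel G H C \<phi> \<psi>"
| sym: "(u, v) \<in> amalg_rel G H C \<phi> \<psi> \<Longrightarrow> (v, u) \<in> amalg_rel G H C \<phi> \<psi>"
| trans: "(u, v) \<in> amalg_rel G H C \<phi> \<psi> \<Longrightarrow> (v, w) \<in> amalg_rel G H C \<phi> \<psi> \<Longrightarrow>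
    (u, w) \<in> amalg_rel G H C \<phi> \<psi>"
| append: "(u, v) \<in> amalg_rel G H C \<phi> \<psi> \<Longrightarrow> (u', v') \<in> amalg_rel G H C \<phi> \<psi> \<Longrightarrow>
    (u @ u', v @ v') \<in> amalg_rel G H C \<phi> \<psi>"
| one_left: "([Inl \<one>\<^bsub>G\<^esub>], []) \<in> amalg_rel G H C \<phi> \<psi>"
| one_right: "([Inr \<one>\<^bsub>H\<^esub>], []) \<in> amalg_rel G H C \<phi> \<psi>"
| mult_left: "g \<in> carrier G \<Longrightarrow> g' \<in> carrier G \<Longrightarrow>
    ([Inl g, Inl g'], [Inl (g \<otimes>\<^bsub>G\<^esub> g')]) \<in> amalg_rel G H C \<phi> \<psi>"
| mult_right: "h \<in> carrier H \<Longrightarrow> h' \<in> carrier H \<Longrightarrow>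
    ([Inr h, Inr h'], [Inr (h \<otimes>\<^bsub>H\<^esub> h')]) \<in> amalg_rel G H C \<phi> \<psi>"
| amalgamate: "c \<in> carrier C \<Longrightarrow> ([Inl (\<phi> c)], [Inr (\<psi> c)]) \<in> amalg_rel G H C \<phi> \<psi>"

definition amalgamated_product ::
    "('a, 'm) monoid_scheme \<Rightarrow> ('b, 'n) monoid_scheme \<Rightarrow> ('c, 'k) monoid_scheme \<Rightarrow>
     ('c \<Rightarrow> 'a) \<Rightarrow> ('c \<Rightarrow> 'b) \<Rightarrow> ('a + 'b) list set monoid" where
  "amalgamated_product G H C \<phi> \<psi> =
     (let R = amalg_rel G H C \<phi> \<psi> in
      \<lparr>carrier = amalg_words G H // R,
       monoid.mult = (\<lambda>A B. \<Union>u\<in>A. \<Union>v\<in>B. R `` {u @ v}),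
       one = R `` {[]}\<rparr>)"

locale amalgam = G: group G + H: group H + C: group C
  for G :: "('a, 'm) monoid_scheme" and H :: "('b, 'n) monoid_scheme"
    and C :: "('c, 'k) monoid_scheme" +
  fixes \<phi> :: "'c \<Rightarrow> 'a" and \<psi> :: "'c \<Rightarrow> 'b"
  assumes \<phi>_hom: "\<phi> \<in> hom C G" and \<psi>_hom: "\<psi> \<in> hom C H"
begin

abbreviation "W \<equiv> amalg_words G H"
abbreviation "R \<equiv> amalg_rel G H C \<phi> \<psi>"
abbreviation "P \<equiv> amalgamated_product G H C \<phi> \<psi>"

lemma rel_words: "(u, v) \<in> R \<Longrightarrow> u \<in> W \<and> v \<in> W"
  by (induction rule: amalg_rel.induct)
    (auto simp: amalg_words_def intro: hom_in_carrier[OF \<phi>_hom] hom_in_carrier[OF \<psi>_hom])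

lemma equiv_rel: "equiv W R"
proof (rule equivI)
  show "R \<subseteq> W \<times> W" using rel_words by auto
  show "refl_on W R" by (rule refl_onI) (rule amalg_rel.refl)
  show "Relation.sym R" by (rule symI) (rule amalg_rel.sym)
  show "Relation.trans R" by (rule transI) (rule amalg_rel.trans)
qed

lemma words_append: "u \<in> W \<Longrightarrow> v \<in> W \<Longrightarrow> u @ v \<in> W"
  by (simp add: amalg_words_def)

lemma class_eq: "(u, v) \<in> R \<Longrightarrow> R `` {u} = R `` {v}"
  by (rule equiv_class_eq[OF equiv_rel])

lemma carrier_P: "carrier P = W // R"
  and one_P: "\<one>\<^bsub>P\<^esub> = R `` {[]}"
  by (simp_all add: amalgamated_product_def Let_def)

lemma mult_P:
  assumes "u \<in> W" "v \<in> W"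
  shows "R `` {u} \<otimes>\<^bsub>P\<^esub> R `` {v} = R `` {u @ v}"
proof -
  have "R `` {u' @ v'} = R `` {u @ v}" if "(u, u') \<in> R" "(v, v') \<in> R" for u' v'
    using amalg_rel.sym[OF amalg_rel.append[OF that]] by (rule class_eq)
  moreover have "(u, u) \<in> R" "(v, v) \<in> R" using assms by (auto intro: amalg_rel.refl)
  ultimately have "(\<Union>a\<in>R `` {u}. \<Union>b\<in>R `` {v}. R `` {a @ b}) = R `` {u @ v}" by blast
  then show ?thesis by (simp add: amalgamated_product_def Let_def)
qed

fun inv_gen where
  "inv_gen (Inl g) = Inl (inv\<^bsub>G\<^esub> g)"
| "inv_gen (Inr h) = Inr (inv\<^bsub>H\<^esub> h)"

lemma words_left_inverse: "w \<in> W \<Longrightarrow> \<exists>v\<in>W. (v @ w, []) \<in> R"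
proof (induction w)
  case Nil
  show ?case by (rule bexI[of _ "[]"]) (auto intro: amalg_rel.refl simp: amalg_words_def)
next
  case (Cons x w)
  then have w: "w \<in> W" and x: "x \<in> carrier G <+> carrier H" by (auto simp: amalg_words_def)
  from Cons.IH[OF w] obtain v where v: "v \<in> W" "(v @ w, []) \<in> R" by blast
  have i: "[inv_gen x] \<in> W" using x by (auto simp: amalg_words_def)
  have "([inv_gen x, x], []) \<in> R"
    using x
  proof
    fix g assume g: "x = Inl g" "g \<in> carrier G"
    with amalg_rel.mult_left[of "inv\<^bsub>G\<^esub> g" G g H C \<phi> \<psi>]
    have "([inv_gen x, x], [Inl \<one>\<^bsub>G\<^esub>]) \<in> R" by simp
    then show ?thesis by (rule amalg_rel.trans[OF _ amalg_rel.one_left])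
  next
    fix h assume h: "x = Inr h" "h \<in> carrier H"
    with amalg_rel.mult_right[of "inv\<^bsub>H\<^esub> h" H h G C \<phi> \<psi>]
    have "([inv_gen x, x], [Inr \<one>\<^bsub>H\<^esub>]) \<in> R" by simp
    then show ?thesis by (rule amalg_rel.trans[OF _ amalg_rel.one_right])
  qed
  from amalg_rel.append[OF amalg_rel.refl[OF v(1)] amalg_rel.append[OF this amalg_rel.refl[OF w]]]
  have "((v @ [inv_gen x]) @ x # w, v @ w) \<in> R" by simp
  from amalg_rel.trans[OF this v(2)] have "((v @ [inv_gen x]) @ x # w, []) \<in> R" .
  with words_append[OF v(1) i] show ?case by blast
qed

lemma nil_words: "[] \<in> W" by (simp add: amalg_words_def)

lemma group_P: "group P"
proof (rule groupI)
  fix x assume "x \<in> carrier P"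
  then obtain w where w: "w \<in> W" "x = R `` {w}" by (auto simp: carrier_P elim: quotientE)
  then show "\<one>\<^bsub>P\<^esub> \<otimes>\<^bsub>P\<^esub> x = x" by (simp add: one_P mult_P nil_words)
  from words_left_inverse[OF w(1)] obtain v where v: "v \<in> W" "(v @ w, []) \<in> R" by blast
  then show "\<exists>y\<in>carrier P. y \<otimes>\<^bsub>P\<^esub> x = \<one>\<^bsub>P\<^esub>"
    using w by (intro bexI[of _ "R `` {v}"])
      (auto simp: mult_P one_P carrier_P quotientI dest: class_eq)
qed (auto simp: carrier_P one_P mult_P words_append nil_words quotientI elim!: quotientE)

definition \<iota>G :: "'a \<Rightarrow> ('a + 'b) list set" where "\<iota>G g = R `` {[Inl g]}"
definition \<iota>H :: "'b \<Rightarrow> ('a + 'b) list set" where "\<iota>H h = R `` {[Inr h]}"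

lemma \<iota>G_hom: "\<iota>G \<in> hom G P"
proof (rule homI)
  fix x y assume x: "x \<in> carrier G" and y: "y \<in> carrier G"
  have w: "[Inl x] \<in> W" "[Inl y] \<in> W" using x y by (auto simp: amalg_words_def)
  show "\<iota>G x \<in> carrier P" unfolding \<iota>G_def carrier_P by (rule quotientI) (rule w)
  have "\<iota>G x \<otimes>\<^bsub>P\<^esub> \<iota>G y = R `` {[Inl x, Inl y]}"
    unfolding \<iota>G_def mult_P[OF w] by simp
  also have "\<dots> = \<iota>G (x \<otimes>\<^bsub>G\<^esub> y)"
    unfolding \<iota>G_def by (rule class_eq[OF amalg_rel.mult_left[OF x y]])
  finally show "\<iota>G (x \<otimes>\<^bsub>G\<^esub> y) = \<iota>G x \<otimes>\<^bsub>P\<^esub> \<iota>G y" by simp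
qed

lemma \<iota>H_hom: "\<iota>H \<in> hom H P"
proof (rule homI)
  fix x y assume x: "x \<in> carrier H" and y: "y \<in> carrier H"
  have w: "[Inr x] \<in> W" "[Inr y] \<in> W" using x y by (auto simp: amalg_words_def)
  show "\<iota>H x \<in> carrier P" unfolding \<iota>H_def carrier_P by (rule quotientI) (rule w)
  have "\<iota>H x \<otimes>\<^bsub>P\<^esub> \<iota>H y = R `` {[Inr x, Inr y]}"
    unfolding \<iota>H_def mult_P[OF w] by simp
  also have "\<dots> = \<iota>H (x \<otimes>\<^bsub>H\<^esub> y)"
    unfolding \<iota>H_def by (rule class_eq[OF amalg_rel.mult_right[OF x y]])
  finally show "\<iota>H (x \<otimes>\<^bsub>H\<^esub> y) = \<iota>H x \<otimes>\<^bsub>P\<^esub> \<iota>H y" by simp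
qed

lemma \<iota>_amalgamates: "c \<in> carrier C \<Longrightarrow> \<iota>G (\<phi> c) = \<iota>H (\<psi> c)"
  unfolding \<iota>G_def \<iota>H_def by (intro class_eq amalg_rel.amalgamate)

text \<open>The existence part of the universal property of the pushout.\<close>

lemma universal:
  fixes K :: "('d, 'l) monoid_scheme"
  assumes K: "group K" and f: "f \<in> hom G K" and f': "f' \<in> hom H K"
    and eq: "\<And>c. c \<in> carrier C \<Longrightarrow> f (\<phi> c) = f' (\<psi> c)"
  shows "\<exists>F\<in>hom P K. (\<forall>g\<in>carrier G. F (\<iota>G g) = f g) \<and> (\<forall>h\<in>carrier H. F (\<iota>H h) = f' h)"
proof -
  interpret K: group K by fact
  define e where "e = case_sum f f'"
  define ev where "ev = (\<lambda>w. foldr (\<lambda>x y. e x \<otimes>\<^bsub>K\<^esub> y) w \<one>\<^bsub>K\<^esub>)"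
  have e: "e x \<in> carrier K" if "x \<in> carrier G <+> carrier H" for x
    using that f f' by (auto simp: e_def hom_def)
  have ev_closed: "ev w \<in> carrier K" if "w \<in> W" for w
    using that by (induction w) (auto simp: ev_def amalg_words_def e)
  have ev_app: "ev (u @ v) = ev u \<otimes>\<^bsub>K\<^esub> ev v" if "u \<in> W" "v \<in> W" for u v
    using that
  proof (induction u)
    case Nil
    then show ?case using ev_closed[of v] by (simp add: ev_def)
  next
    case (Cons x u)
    then have "u \<in> W" "x \<in> carrier G <+> carrier H" by (auto simp: amalg_words_def)
    with Cons ev_closed e show ?case by (simp add: ev_def K.m_assoc)
  qed
  have f1: "f \<one>\<^bsub>G\<^esub> = \<one>\<^bsub>K\<^esub>" "f' \<one>\<^bsub>H\<^esub> = \<one>\<^bsub>K\<^esub>"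
    using hom_one[OF f G.group_axioms K] hom_one[OF f' H.group_axioms K] .
  have ev_rel: "ev u = ev v" if "(u, v) \<in> R" for u v
    using that
  proof (induction rule: amalg_rel.induct)
    case (append u v u' v')
    then show ?case using rel_words by (metis ev_app)
  qed (simp_all add: ev_def e_def f1 eq hom_mult[OF f] hom_mult[OF f']
      hom_in_carrier[OF f] hom_in_carrier[OF f'] hom_in_carrier[OF \<psi>_hom] K.m_assoc)
  define F where "F = (\<lambda>A. ev (SOME w. w \<in> A))"
  have F: "F (R `` {w}) = ev w" if "w \<in> W" for w
  proof -
    have "w \<in> R `` {w}" using that by (auto intro: amalg_rel.refl)
    then have "(SOME v. v \<in> R `` {w}) \<in> R `` {w}" by (rule someI)
    then show ?thesis unfolding F_def using ev_rel by auto
  qed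
  have "F \<in> hom P K"
  proof (rule homI)
    fix A B assume "A \<in> carrier P" "B \<in> carrier P"
    then obtain u v where u: "u \<in> W" "A = R `` {u}" and v: "v \<in> W" "B = R `` {v}"
      unfolding carrier_P by (metis quotientE)
    show "F A \<in> carrier K" using u by (simp add: F ev_closed)
    show "F (A \<otimes>\<^bsub>P\<^esub> B) = F A \<otimes>\<^bsub>K\<^esub> F B"
      using u v by (simp add: F mult_P ev_app words_append)
  qed
  moreover have "F (\<iota>G g) = f g" if "g \<in> carrier G" for g
    using that hom_in_carrier[OF f that] F[of "[Inl g]"]
    by (auto simp: \<iota>G_def amalg_words_def ev_def e_def)
  moreover have "F (\<iota>H h) = f' h" if "h \<in> carrier H" for h
    using that hom_in_carrier[OF f' that] F[of "[Inr h]"]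
    by (auto simp: \<iota>H_def amalg_words_def ev_def e_def)
  ultimately show ?thesis by blast
qed

end


section \<open>Polynomial-time Cook reducibility\<close>

text \<open>
  Algorithms are programs of Jones' WHILE language over binary trees (N. D. Jones,
  \<^emph>\<open>Computability and Complexity from a Programming Perspective\<close>), extended with
  oracle calls. Every evaluation of a variable is charged the full size of its
  value, so a running time bounds the sizes of all trees built, also those of oracle
  queries; hence polynomial time agrees with polynomial time on (oracle) Turing machines.
\<close>

datatype bintree = Leaf | Node bintree bintree

datatype expr = Var nat | Const_Leaf | Join expr expr | Hd expr | Tl expr | Eq expr expr

datatype com =
    Assign nat expr
  | Ask nat nat expr
  | Seq com com
  | Cond expr com com
  | Loop expr com

type_synonym store = "nat \<Rightarrow> bintree"

fun left :: "bintree \<Rightarrow> bintree" where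
  "left Leaf = Leaf" | "left (Node a b) = a"

fun right :: "bintree \<Rightarrow> bintree" where
  "right Leaf = Leaf" | "right (Node a b) = b"

text \<open>\<^term>\<open>Leaf\<close> represents false; any other tree represents true.\<close>

definition tree_of_bool :: "bool \<Rightarrow> bintree" where
  "tree_of_bool b = (if b then Node Leaf Leaf else Leaf)"

fun eval :: "expr \<Rightarrow> store \<Rightarrow> bintree" where
  "eval (Var x) s = s x"
| "eval Const_Leaf s = Leaf"
| "eval (Join e1 e2) s = Node (eval e1 s) (eval e2 s)"
| "eval (Hd e) s = left (eval e s)"
| "eval (Tl e) s = right (eval e s)"
| "eval (Eq e1 e2) s = tree_of_bool (eval e1 s = eval e2 s)"

fun cost :: "expr \<Rightarrow> store \<Rightarrow> nat" where
  "cost (Var x) s = 1 + size (s x)"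
| "cost Const_Leaf s = 1"
| "cost (Join e1 e2) s = 1 + cost e1 s + cost e2 s"
| "cost (Hd e) s = 1 + cost e s"
| "cost (Tl e) s = 1 + cost e s"
| "cost (Eq e1 e2) s = 1 + cost e1 s + cost e2 s"

lemma size_eval_le_cost: "size (eval e s) \<le> cost e s"
proof -
  have l: "size (left a) \<le> size a" and r: "size (right a) \<le> size a" for a
    by (cases a; simp)+
  show ?thesis
  proof (induction e)
    case (Hd e)
    with l[of "eval e s"] show ?case by simp
  next
    case (Tl e)
    with r[of "eval e s"] show ?case by simp
  qed (simp_all add: tree_of_bool_def)
qed

text \<open>
  \<open>exec Os p s t s'\<close>: started in store \<open>s\<close>, the program \<open>p\<close> halts in store \<open>s'\<close> after
  time \<open>t\<close>. The \<open>i\<close>-th oracle decides membership in \<open>Os ! i\<close>. A call takes time at least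
  one, beyond the time needed to write down the query, so \<open>t\<close> bounds both
  the number of calls and the time spent outside of the calls.
\<close>

inductive exec :: "bintree set list \<Rightarrow> com \<Rightarrow> store \<Rightarrow> nat \<Rightarrow> store \<Rightarrow> bool"
  for Os :: "bintree set list" where
  Assign: "exec Os (Assign x e) s (1 + cost e s) (s(x := eval e s))"
| Ask: "i < length Os \<Longrightarrow>
    exec Os (Ask i x e) s (1 + cost e s) (s(x := tree_of_bool (eval e s \<in> Os ! i)))"
| Seq: "exec Os p s t s' \<Longrightarrow> exec Os q s' t' s'' \<Longrightarrow> exec Os (Seq p q) s (1 + t + t') s''"
| Cond_True: "eval e s \<noteq> Leaf \<Longrightarrow> exec Os p s t s' \<Longrightarrow>
    exec Os (Cond e p q) s (1 + cost e s + t) s'"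
| Cond_False: "eval e s = Leaf \<Longrightarrow> exec Os q s t s' \<Longrightarrow>
    exec Os (Cond e p q) s (1 + cost e s + t) s'"
| Loop_False: "eval e s = Leaf \<Longrightarrow> exec Os (Loop e p) s (1 + cost e s) s"
| Loop_True: "eval e s \<noteq> Leaf \<Longrightarrow> exec Os p s t s' \<Longrightarrow> exec Os (Loop e p) s' t' s'' \<Longrightarrow>
    exec Os (Loop e p) s (1 + cost e s + t + t') s''"

lemma exec_deterministic:
  "exec Os p s t s' \<Longrightarrow> exec Os p s u s'' \<Longrightarrow> t = u \<and> s' = s''"
proof (induction arbitrary: u s'' rule: exec.induct)
  case (Seq p s t s' q t' s'')
  from Seq.prems show ?case by cases (use Seq.IH in blast)
next
  case (Cond_True e s p t s' q)
  from Cond_True.prems show ?case by cases (use Cond_True in blast)+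
next
  case (Cond_False e s q t s' p)
  from Cond_False.prems show ?case by cases (use Cond_False in blast)+
next
  case (Loop_False e s p)
  from Loop_False.prems show ?case by cases (use Loop_False in auto)
next
  case (Loop_True e s p t s' t' s'')
  from Loop_True.prems show ?case by cases (use Loop_True in blast)+
qed (auto elim: exec.cases)

text \<open>
  A decision problem is a set of binary trees: the encodings of the instances with
  answer yes. The input is passed in variable 0, where also the answer is returned.
\<close>

definition cook_reducible :: "bintree set \<Rightarrow> bintree set list \<Rightarrow> bool" where
  "cook_reducible A Bs \<longleftrightarrow>
     (\<exists>p. \<exists>q :: nat poly. \<forall>x. \<exists>t s.
        exec Bs p ((\<lambda>_. Leaf)(0 := x)) t s \<and>
        t \<le> poly q (size x) \<and> (s 0 \<noteq> Leaf \<longleftrightarrow> x \<in> A))"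


section \<open>The acyclic graph word problem\<close>

text \<open>
  A finite generating set is given by a list without repetitions; the letters \<open>Pos i\<close> and
  \<open>Neg i\<close> stand for the \<open>i\<close>-th generator and its formal inverse.
\<close>

definition generating_list :: "('a, 'm) monoid_scheme \<Rightarrow> 'a list \<Rightarrow> bool" where
  "generating_list G xs \<longleftrightarrow>
     distinct xs \<and> set xs \<subseteq> carrier G \<and> generate G (set xs) = carrier G"

datatype letter = Pos nat | Neg nat

fun letter_index :: "letter \<Rightarrow> nat" where
  "letter_index (Pos i) = i" | "letter_index (Neg i) = i"

fun letter_value :: "('a, 'm) monoid_scheme \<Rightarrow> 'a list \<Rightarrow> letter \<Rightarrow> 'a" where
  "letter_value G xs (Pos i) = xs ! i"
| "letter_value G xs (Neg i) = inv\<^bsub>G\<^esub> (xs ! i)"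

definition word_value :: "('a, 'm) monoid_scheme \<Rightarrow> 'a list \<Rightarrow> letter list \<Rightarrow> 'a" where
  "word_value G xs w = foldr (\<lambda>l a. letter_value G xs l \<otimes>\<^bsub>G\<^esub> a) w \<one>\<^bsub>G\<^esub>"

text \<open>
  The vertices are the numbers below \<open>vertex_count\<close>. An edge consists of its origin, its
  label (\<^const>\<open>None\<close> is the empty word) and its end. Edges are identified by their
  position in the list, so that parallel edges are allowed.
\<close>

record labeled_graph =
  vertex_count :: nat
  edges :: "(nat \<times> letter option \<times> nat) list"
  \<alpha> :: nat
  \<omega> :: nat

definition digraph_of :: "labeled_graph \<Rightarrow> (nat, nat) pre_digraph" where
  "digraph_of \<Gamma> =
     \<lparr>verts = {..<vertex_count \<Gamma>}, arcs = {..<length (edges \<Gamma>)},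
      tail = (\<lambda>i. fst (edges \<Gamma> ! i)), head = (\<lambda>i. snd (snd (edges \<Gamma> ! i)))\<rparr>"

definition edge_label :: "labeled_graph \<Rightarrow> nat \<Rightarrow> letter list" where
  "edge_label \<Gamma> i = (case fst (snd (edges \<Gamma> ! i)) of None \<Rightarrow> [] | Some l \<Rightarrow> [l])"

definition path_label :: "labeled_graph \<Rightarrow> nat list \<Rightarrow> letter list" where
  "path_label \<Gamma> p = concat (map (edge_label \<Gamma>) p)"

definition agwp_instance :: "'a list \<Rightarrow> labeled_graph \<Rightarrow> bool" where
  "agwp_instance xs \<Gamma> \<longleftrightarrow>
     fin_digraph (digraph_of \<Gamma>) \<and> acyclic (arcs_ends (digraph_of \<Gamma>)) \<and>
     (\<forall>i < length (edges \<Gamma>). \<forall>l \<in> set (edge_label \<Gamma> i). letter_index l < length xs) \<and>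
     \<alpha> \<Gamma> \<in> verts (digraph_of \<Gamma>) \<and> \<omega> \<Gamma> \<in> verts (digraph_of \<Gamma>)"

definition agwp_answer :: "('a, 'm) monoid_scheme \<Rightarrow> 'a list \<Rightarrow> labeled_graph \<Rightarrow> bool" where
  "agwp_answer G xs \<Gamma> \<longleftrightarrow>
     (\<exists>p. pre_digraph.awalk (digraph_of \<Gamma>) (\<alpha> \<Gamma>) p (\<omega> \<Gamma>) \<and>
          word_value G xs (path_label \<Gamma> p) = \<one>\<^bsub>G\<^esub>)"

text \<open>
  Numbers are encoded in unary. As vertices are numbered consecutively and the letters
  come from a fixed finite alphabet, the size of an encoding is polynomially related to
  the size of the graph; see \<open>encoding_size_le\<close> and \<open>graph_size_le\<close>.
\<close>

fun enc_nat :: "nat \<Rightarrow> bintree" where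
  "enc_nat 0 = Leaf"
| "enc_nat (Suc n) = Node Leaf (enc_nat n)"

fun enc_label :: "letter option \<Rightarrow> bintree" where
  "enc_label None = Leaf"
| "enc_label (Some (Pos i)) = Node Leaf (enc_nat i)"
| "enc_label (Some (Neg i)) = Node (Node Leaf Leaf) (enc_nat i)"

fun enc_edge :: "nat \<times> letter option \<times> nat \<Rightarrow> bintree" where
  "enc_edge (u, l, v) = Node (enc_nat u) (Node (enc_label l) (enc_nat v))"

fun enc_list :: "('a \<Rightarrow> bintree) \<Rightarrow> 'a list \<Rightarrow> bintree" where
  "enc_list f [] = Leaf"
| "enc_list f (x # xs) = Node (f x) (enc_list f xs)"

definition enc_graph :: "labeled_graph \<Rightarrow> bintree" where
  "enc_graph \<Gamma> = Node (enc_nat (vertex_count \<Gamma>))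
     (Node (enc_list enc_edge (edges \<Gamma>)) (Node (enc_nat (\<alpha> \<Gamma>)) (enc_nat (\<omega> \<Gamma>))))"

definition AGWP :: "('a, 'm) monoid_scheme \<Rightarrow> 'a list \<Rightarrow> bintree set" where
  "AGWP G xs = enc_graph ` {\<Gamma>. agwp_instance xs \<Gamma> \<and> agwp_answer G xs \<Gamma>}"

definition graph_size :: "labeled_graph \<Rightarrow> nat" where
  "graph_size \<Gamma> = vertex_count \<Gamma> + length (edges \<Gamma>) +
     (\<Sum>i<length (edges \<Gamma>). length (edge_label \<Gamma> i))"

lemma size_enc_nat [simp]: "size (enc_nat n) = n"
  by (induction n) auto

lemma enc_nat_inject [simp]: "enc_nat m = enc_nat n \<longleftrightarrow> m = n"
  by (metis size_enc_nat)

lemma enc_label_inject [simp]: "enc_label l = enc_label l' \<longleftrightarrow> l = l'"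
  by (cases l rule: enc_label.cases; cases l' rule: enc_label.cases) auto

lemma enc_list_inject: "inj f \<Longrightarrow> enc_list f xs = enc_list f ys \<longleftrightarrow> xs = ys"
proof (induction xs arbitrary: ys)
  case Nil
  then show ?case by (cases ys) auto
next
  case (Cons x xs)
  then show ?case by (cases ys) (auto dest: injD)
qed

lemma inj_enc_graph: "inj enc_graph"
proof (rule injI)
  have "inj enc_edge" by (rule injI) auto
  then show "enc_graph \<Gamma> = enc_graph \<Delta> \<Longrightarrow> \<Gamma> = \<Delta>" for \<Gamma> \<Delta>
    by (cases \<Gamma>; cases \<Delta>) (auto simp: enc_graph_def enc_list_inject)
qed

lemma size_enc_list: "size (enc_list f xs) = (\<Sum>i<length xs. size (f (xs ! i)) + 1)"
  by (induction xs) (auto simp: sum.lessThan_Suc_shift simp del: sum.lessThan_Suc)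

lemma encoding_size_le:
  assumes "agwp_instance xs \<Gamma>"
  shows "size (enc_graph \<Gamma>) \<le> (length xs + 5) * (graph_size \<Gamma> + 1) ^ 2"
proof -
  let ?n = "vertex_count \<Gamma>" and ?m = "length (edges \<Gamma>)" and ?k = "length xs + 5"
  interpret fin_digraph "digraph_of \<Gamma>" using assms by (simp add: agwp_instance_def)
  have e: "size (enc_edge (edges \<Gamma> ! i)) + 1 \<le> 2 * ?n + ?k" if i: "i < ?m" for i
  proof -
    obtain u l v where uv: "edges \<Gamma> ! i = (u, l, v)" by (cases "edges \<Gamma> ! i") auto
    have "u < ?n" "v < ?n"
      using tail_in_verts[of i] head_in_verts[of i] i by (auto simp: digraph_of_def uv)
    moreover have "size (enc_label l) \<le> length xs + 1"
      using assms i by (cases l rule: enc_label.cases)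
        (auto simp: agwp_instance_def edge_label_def uv dest!: spec[of _ i])
    ultimately show ?thesis by (simp add: uv)
  qed
  have "(\<Sum>i<?m. size (enc_edge (edges \<Gamma> ! i)) + 1) \<le> ?m * (2 * ?n + ?k)"
    using sum_bounded_above[of "{..<?m}" "\<lambda>i. size (enc_edge (edges \<Gamma> ! i)) + 1" "2 * ?n + ?k"] e
    by simp
  moreover have "\<alpha> \<Gamma> \<le> ?n" "\<omega> \<Gamma> \<le> ?n"
    using assms by (auto simp: agwp_instance_def digraph_of_def)
  ultimately have "size (enc_graph \<Gamma>) \<le> 3 * ?n + 3 + ?m * (2 * ?n + ?k)"
    by (simp add: enc_graph_def size_enc_list)
  also have "\<dots> \<le> ?k * (?n + ?m + 1) ^ 2"
    by (simp add: power2_eq_square algebra_simps)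
  also have "\<dots> \<le> ?k * (graph_size \<Gamma> + 1) ^ 2"
    by (intro mult_left_mono power_mono) (auto simp: graph_size_def)
  finally show ?thesis .
qed

lemma graph_size_le: "graph_size \<Gamma> \<le> 2 * size (enc_graph \<Gamma>)"
proof -
  let ?m = "length (edges \<Gamma>)"
  have "(\<Sum>i<?m. length (edge_label \<Gamma> i)) \<le> ?m"
    using sum_bounded_above[of "{..<?m}" "\<lambda>i. length (edge_label \<Gamma> i)" 1]
    by (auto simp: edge_label_def split: option.splits)
  moreover have "length es \<le> size (enc_list enc_edge es)" for es
    by (induction es) auto
  note this[of "edges \<Gamma>"]
  ultimately show ?thesis by (simp add: graph_size_def enc_graph_def)
qed

end

theory Submission
  imports Defs
begin

text \<open>
  Let \<open>P = G *\<^sub>C H\<close>. An instance over \<open>P\<close> is an acyclic graph whose edges may be taken to carry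
  elements of \<open>G\<close> or of \<open>H\<close>: the letters of the chosen generating set of \<open>P\<close> are finitely many fixed
  words over the generators of the two factors. The graph is \<^emph>\<open>saturated\<close> by shortcuts. Whenever some path from
  \<open>u\<close> to \<open>v\<close> that stays in one factor has a value \<open>c \<in> C\<close>, an edge from \<open>u\<close> to \<open>v\<close> with label \<open>c\<close>
  is added; it may afterwards be used as an edge over either factor. Shortcuts do not change the
  set of values in \<open>P\<close> of paths between two vertices, and they do not create cycles.

  In a saturated graph it suffices to look at paths within \<open>G\<close>
  (\<open>saturated_decides\<close>). Cut a path from \<open>\<alpha>\<close> to \<open>\<omega>\<close> with value \<open>1\<close> in \<open>P\<close> into syllables, each
  of them a path within one factor. If two adjacent syllables belong to the same factor, they are merged. If
  a syllable has its value in \<open>C\<close>, the shortcut parallel to it moves it to the other factor, where it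
  is merged with a neighbour. When neither is possible, the syllables are alternating and outside of
  \<open>C\<close>, or there is at most one syllable. By the normal form theorem (\<open>reduced_nontrivial\<close>) an alternating
  product of at least one such syllable is not \<open>1\<close>. So at most one syllable remains, and since the factors embed in
  \<open>P\<close> its value is \<open>1\<close> in its factor. The normal form theorem is proved by
  van der Waerden's method: \<open>G\<close> and \<open>H\<close> act on the set of normal forms, the actions agree on \<open>C\<close>, and
  so the words over both factors act, where equal elements of \<open>P\<close> act equally
  (\<open>act_word_rel\<close>).

  There are at most \<open>card C\<close> times the square of the number of vertices possible shortcuts, so the saturation is reached
  after polynomially many rounds, and one round asks for each possible shortcut whether some path within
  a factor has a given value \<open>c \<in> C\<close>. This is one question to the oracle of that factor: the
  labels from \<open>C\<close> are spelled out by fixed words over the generators, and a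
  word for \<open>c\<inverse>\<close> is put in front of the start vertex (\<open>oracle_query\<close>). As the queries have to be
  acyclic graphs themselves, a rank function on the vertices is carried along. That the input is a
  well-formed acyclic graph at all is also checked by the oracle of \<open>G\<close>: with all labels erased and \<open>\<alpha> = \<omega>\<close>, an
  instance has the answer yes because of the empty path.

  Programs are not written down. Instead, the functions on trees that are computable in polynomial time
  with oracles are shown to be closed under composition, pairing, case distinction, oracle calls, and
  folding over the entries of a tree as long as the intermediate values stay of polynomial size
  (\<open>polytime_fold_bounded\<close>). The algorithm is a function \<open>solve\<close> built from these operations.
\<close>

section \<open>Normal forms in amalgamated products\<close>

text \<open>
  A transversal of the right cosets \<open>\<phi> C g\<close> in which the subgroup itself is represented by the
  identity, so that an element has the trivial representative iff it lies in the subgroup.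
\<close>

definition coset_rep ::
    "('c, 'k) monoid_scheme \<Rightarrow> ('a, 'm) monoid_scheme \<Rightarrow> ('c \<Rightarrow> 'a) \<Rightarrow> 'a \<Rightarrow> 'a" where
  "coset_rep C G \<phi> g = (if g \<in> \<phi> ` carrier C then \<one>\<^bsub>G\<^esub>
     else SOME t. t \<in> (\<lambda>c. \<phi> c \<otimes>\<^bsub>G\<^esub> g) ` carrier C)"

definition coset_coeff ::
    "('c, 'k) monoid_scheme \<Rightarrow> ('a, 'm) monoid_scheme \<Rightarrow> ('c \<Rightarrow> 'a) \<Rightarrow> 'a \<Rightarrow> 'c" where
  "coset_coeff C G \<phi> g = (THE c. c \<in> carrier C \<and> g = \<phi> c \<otimes>\<^bsub>G\<^esub> coset_rep C G \<phi> g)"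

text \<open>
  The action of one factor on normal forms. A normal form is a pair \<open>(c, s)\<close> that stands for the
  product of \<open>c \<in> C\<close> with the entries of \<open>s\<close>, which are nontrivial coset representatives from alternating
  factors. All that matters of the other factor is which lists are alternating. Hence the set \<open>NF\<close> of these lists is a
  parameter, as is the embedding \<open>e\<close> of the factor into the entries, and one development serves both factors.
\<close>

locale factor_action = G: group G + C: group C
  for G :: "('a, 'm) monoid_scheme" and C :: "('c, 'k) monoid_scheme" +
  fixes \<phi> :: "'c \<Rightarrow> 'a" and e :: "'a \<Rightarrow> 's" and NF :: "'s list set"
  assumes \<phi>_hom: "\<phi> \<in> hom C G" and \<phi>_inj: "inj_on \<phi> (carrier C)" and e_inj: "inj e"
    and NF_Cons: "\<And>t s. e t # s \<in> NF \<longleftrightarrow>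
      t \<in> carrier G \<and> coset_rep C G \<phi> t = t \<and> t \<noteq> \<one>\<^bsub>G\<^esub> \<and> s \<in> NF \<and> (\<nexists>t y. s = e t # y)"
begin

abbreviation rep where "rep \<equiv> coset_rep C G \<phi>"
abbreviation coeff where "coeff \<equiv> coset_coeff C G \<phi>"

lemma phi_closed: "c \<in> carrier C \<Longrightarrow> \<phi> c \<in> carrier G"
  by (rule hom_in_carrier[OF \<phi>_hom])

lemma phi_mult: "c \<in> carrier C \<Longrightarrow> d \<in> carrier C \<Longrightarrow> \<phi> (c \<otimes>\<^bsub>C\<^esub> d) = \<phi> c \<otimes>\<^bsub>G\<^esub> \<phi> d"
  by (rule hom_mult[OF \<phi>_hom])

lemma phi_one: "\<phi> \<one>\<^bsub>C\<^esub> = \<one>\<^bsub>G\<^esub>"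
  by (rule hom_one[OF \<phi>_hom C.group_axioms G.group_axioms])

lemma phi_inv: "c \<in> carrier C \<Longrightarrow> \<phi> (inv\<^bsub>C\<^esub> c) = inv\<^bsub>G\<^esub> \<phi> c"
  by (metis C.inv_closed C.r_inv G.inv_equality C.l_inv phi_closed phi_mult phi_one)

lemma in_image_mult:
  assumes c: "c \<in> carrier C" and g: "g \<in> carrier G"
  shows "\<phi> c \<otimes>\<^bsub>G\<^esub> g \<in> \<phi> ` carrier C \<longleftrightarrow> g \<in> \<phi> ` carrier C"
proof
  assume "\<phi> c \<otimes>\<^bsub>G\<^esub> g \<in> \<phi> ` carrier C"
  then obtain d where d: "d \<in> carrier C" "\<phi> c \<otimes>\<^bsub>G\<^esub> g = \<phi> d" by blast
  then have "g = \<phi> (inv\<^bsub>C\<^esub> c \<otimes>\<^bsub>C\<^esub> d)"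
    using c g by (metis C.inv_closed G.inv_solve_left' G.inv_solve_left phi_closed phi_inv phi_mult)
  then show "g \<in> \<phi> ` carrier C" using c d by simp
next
  assume "g \<in> \<phi> ` carrier C"
  then obtain d where "d \<in> carrier C" "g = \<phi> d" by blast
  then show "\<phi> c \<otimes>\<^bsub>G\<^esub> g \<in> \<phi> ` carrier C" using c by (simp add: phi_mult[symmetric])
qed

lemma coset_eq:
  assumes c: "c \<in> carrier C" and g: "g \<in> carrier G"
  shows "(\<lambda>d. \<phi> d \<otimes>\<^bsub>G\<^esub> (\<phi> c \<otimes>\<^bsub>G\<^esub> g)) ` carrier C = (\<lambda>d. \<phi> d \<otimes>\<^bsub>G\<^esub> g) ` carrier C" (is "?A = ?B")
proof -
  have eq: "\<phi> d \<otimes>\<^bsub>G\<^esub> (\<phi> c \<otimes>\<^bsub>G\<^esub> g) = \<phi> (d \<otimes>\<^bsub>C\<^esub> c) \<otimes>\<^bsub>G\<^esub> g" if "d \<in> carrier C" for d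
    using that c g by (simp add: phi_mult phi_closed G.m_assoc)
  have "?A \<subseteq> ?B" using eq c by auto
  moreover have "?B \<subseteq> ?A"
  proof
    fix t assume "t \<in> ?B"
    then obtain d where d: "d \<in> carrier C" "t = \<phi> d \<otimes>\<^bsub>G\<^esub> g" by blast
    have "(d \<otimes>\<^bsub>C\<^esub> inv\<^bsub>C\<^esub> c) \<otimes>\<^bsub>C\<^esub> c = d" using c d by (simp add: C.m_assoc)
    with eq[of "d \<otimes>\<^bsub>C\<^esub> inv\<^bsub>C\<^esub> c"] c d show "t \<in> ?A"
      by (intro image_eqI[of _ _ "d \<otimes>\<^bsub>C\<^esub> inv\<^bsub>C\<^esub> c"]) auto
  qed
  ultimately show ?thesis by blast
qed

lemma rep_mult:
  "c \<in> carrier C \<Longrightarrow> g \<in> carrier G \<Longrightarrow> rep (\<phi> c \<otimes>\<^bsub>G\<^esub> g) = rep g"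
  by (simp add: coset_rep_def in_image_mult coset_eq)

lemma rep_decomp:
  assumes g: "g \<in> carrier G"
  obtains c where "c \<in> carrier C" "rep g \<in> carrier G" "g = \<phi> c \<otimes>\<^bsub>G\<^esub> rep g"
proof (cases "g \<in> \<phi> ` carrier C")
  case True
  then show ?thesis using that g by (auto simp: coset_rep_def)
next
  case False
  have "\<phi> \<one>\<^bsub>C\<^esub> \<otimes>\<^bsub>G\<^esub> g \<in> (\<lambda>c. \<phi> c \<otimes>\<^bsub>G\<^esub> g) ` carrier C" by blast
  then have "rep g \<in> (\<lambda>c. \<phi> c \<otimes>\<^bsub>G\<^esub> g) ` carrier C"
    using False unfolding coset_rep_def by (simp only: if_False) (rule someI)
  then obtain c where c: "c \<in> carrier C" "rep g = \<phi> c \<otimes>\<^bsub>G\<^esub> g" by blast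
  have "g = \<phi> (inv\<^bsub>C\<^esub> c) \<otimes>\<^bsub>G\<^esub> rep g"
    unfolding c(2) phi_inv[OF c(1)] using c g
    by (simp add: phi_closed G.m_assoc[symmetric])
  then show ?thesis using c g by (intro that[of "inv\<^bsub>C\<^esub> c"]) (auto simp: phi_closed)
qed

lemma rep_closed: "g \<in> carrier G \<Longrightarrow> rep g \<in> carrier G"
  by (rule rep_decomp)

lemma coeff_eqI:
  assumes "c \<in> carrier C" "g \<in> carrier G" "g = \<phi> c \<otimes>\<^bsub>G\<^esub> rep g"
  shows "coeff g = c"
  unfolding coset_coeff_def
proof (rule the_equality)
  fix d assume d: "d \<in> carrier C \<and> g = \<phi> d \<otimes>\<^bsub>G\<^esub> rep g"
  then have "\<phi> d = \<phi> c" using assms by (metis G.right_cancel phi_closed rep_closed)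
  then show "d = c" using d assms(1) \<phi>_inj by (auto dest: inj_onD)
qed (use assms in auto)

lemma coeff_closed: "g \<in> carrier G \<Longrightarrow> coeff g \<in> carrier C"
  and coeff_rep: "g \<in> carrier G \<Longrightarrow> \<phi> (coeff g) \<otimes>\<^bsub>G\<^esub> rep g = g"
  by (metis coeff_eqI rep_decomp)+

lemma coeff_mult:
  assumes "c \<in> carrier C" "g \<in> carrier G"
  shows "coeff (\<phi> c \<otimes>\<^bsub>G\<^esub> g) = c \<otimes>\<^bsub>C\<^esub> coeff g"
  using assms
  by (intro coeff_eqI) (simp_all add: coeff_closed phi_closed phi_mult rep_mult G.m_assoc rep_closed coeff_rep)

lemma rep_eq_one: "g \<in> carrier G \<Longrightarrow> rep g = \<one>\<^bsub>G\<^esub> \<longleftrightarrow> g \<in> \<phi> ` carrier C"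
  by (metis G.r_one coeff_closed coeff_rep coset_rep_def image_eqI phi_closed)

lemma rep_rep: "g \<in> carrier G \<Longrightarrow> rep (rep g) = rep g"
  by (metis coeff_closed coeff_rep rep_closed rep_mult)

definition heads :: "'s list \<Rightarrow> bool" where
  "heads s \<longleftrightarrow> (\<exists>t y. s = e t # y)"

text \<open>
  A normal form is read as \<open>g\<close> followed by a list that does not begin in this factor, by absorbing a first entry
  from this factor. This is a bijection with inverse \<open>pack\<close>, and on the right-hand side the factor
  acts by left multiplication of \<open>g\<close>. That it acts on normal forms needs no case distinction then.
\<close>

definition unpack :: "'c \<times> 's list \<Rightarrow> 'a \<times> 's list" where
  "unpack x = (if heads (snd x) then (\<phi> (fst x) \<otimes>\<^bsub>G\<^esub> inv_into UNIV e (hd (snd x)), tl (snd x))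
     else (\<phi> (fst x), snd x))"

definition pack :: "'a \<times> 's list \<Rightarrow> 'c \<times> 's list" where
  "pack p = (coeff (fst p), if rep (fst p) = \<one>\<^bsub>G\<^esub> then snd p else e (rep (fst p)) # snd p)"

definition act :: "'a \<Rightarrow> 'c \<times> 's list \<Rightarrow> 'c \<times> 's list" where
  "act g x = pack (g \<otimes>\<^bsub>G\<^esub> fst (unpack x), snd (unpack x))"

abbreviation X where "X \<equiv> carrier C \<times> NF"
abbreviation Y where "Y \<equiv> carrier G \<times> {y \<in> NF. \<not> heads y}"

lemma unpack_Cons: "unpack (c, e t # y) = (\<phi> c \<otimes>\<^bsub>G\<^esub> t, y)"
  by (auto simp: unpack_def heads_def inv_into_f_f[OF e_inj])

lemma unpack_other: "\<not> heads s \<Longrightarrow> unpack (c, s) = (\<phi> c, s)"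
  by (auto simp: unpack_def)

lemma unpack_closed: "x \<in> X \<Longrightarrow> unpack x \<in> Y"
proof (cases "heads (snd x)")
  case True
  assume x: "x \<in> X"
  from True obtain c t y where "x = (c, e t # y)" unfolding heads_def by (metis prod.collapse)
  then show ?thesis using x by (auto simp: unpack_Cons NF_Cons phi_closed heads_def)
qed (auto simp: unpack_def phi_closed)

lemma pack_closed: "p \<in> Y \<Longrightarrow> pack p \<in> X"
  by (auto simp: pack_def NF_Cons coeff_closed rep_closed rep_rep heads_def)

lemma unpack_pack: "p \<in> Y \<Longrightarrow> unpack (pack p) = p"
  by (cases p) (use coeff_rep[of "fst p"] coeff_closed[of "fst p"] phi_closed in
      \<open>auto simp: pack_def unpack_Cons unpack_other\<close>)

lemma pack_unpack: "x \<in> X \<Longrightarrow> pack (unpack x) = x"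
proof (cases "heads (snd x)")
  case True
  assume x: "x \<in> X"
  from True obtain c t y where xe: "x = (c, e t # y)" unfolding heads_def by (metis prod.collapse)
  with x have t: "c \<in> carrier C" "t \<in> carrier G" "rep t = t" "t \<noteq> \<one>\<^bsub>G\<^esub>" by (auto simp: NF_Cons)
  then have "coeff t = \<one>\<^bsub>C\<^esub>" by (intro coeff_eqI) (auto simp: phi_one)
  with t show ?thesis by (simp add: xe unpack_Cons pack_def rep_mult coeff_mult)
next
  case False
  assume x: "x \<in> X"
  obtain c s where xe: "x = (c, s)" by force
  with x have c: "c \<in> carrier C" by simp
  then have "rep (\<phi> c) = \<one>\<^bsub>G\<^esub>" by (simp add: coset_rep_def)
  moreover from this have "coeff (\<phi> c) = c" using c by (intro coeff_eqI) (auto simp: phi_closed)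
  ultimately show ?thesis using False by (simp add: xe unpack_other pack_def)
qed

lemma act_closed:
  assumes "g \<in> carrier G" "x \<in> X" shows "act g x \<in> X"
  unfolding act_def using unpack_closed[OF assms(2)] assms(1) by (intro pack_closed) auto

lemma act_one: "x \<in> X \<Longrightarrow> act \<one>\<^bsub>G\<^esub> x = x"
  using unpack_closed[of x] pack_unpack[of x] by (cases "unpack x") (auto simp: act_def)

lemma act_mult:
  assumes "g \<in> carrier G" "h \<in> carrier G" "x \<in> X"
  shows "act g (act h x) = act (g \<otimes>\<^bsub>G\<^esub> h) x"
proof -
  obtain k y where ky: "unpack x = (k, y)" by force
  with unpack_closed[OF assms(3)] have "(k, y) \<in> Y" by simp
  then have "(h \<otimes>\<^bsub>G\<^esub> k, y) \<in> Y" "k \<in> carrier G" using assms by auto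
  then show ?thesis using assms by (simp add: act_def ky unpack_pack G.m_assoc)
qed

text \<open>
  Elements of \<open>C\<close> only change the \<open>C\<close>-component. The formula does not mention the factor, so the
  actions of both factors agree on \<open>C\<close>.
\<close>

lemma act_phi:
  assumes "d \<in> carrier C" "(c, s) \<in> X"
  shows "act (\<phi> d) (c, s) = (d \<otimes>\<^bsub>C\<^esub> c, s)"
proof -
  obtain k y where ky: "unpack (c, s) = (k, y)" by force
  with unpack_closed[OF assms(2)] have k: "k \<in> carrier G" by auto
  from pack_unpack[OF assms(2)] ky have p: "pack (k, y) = (c, s)" by simp
  have "pack (\<phi> d \<otimes>\<^bsub>G\<^esub> k, y) = (d \<otimes>\<^bsub>C\<^esub> fst (pack (k, y)), snd (pack (k, y)))"
    using assms(1) k by (simp add: pack_def rep_mult coeff_mult)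
  then show ?thesis by (simp add: act_def ky p)
qed

lemma act_long:
  assumes "g \<in> carrier G" "g \<notin> \<phi> ` carrier C" "c \<in> carrier C" "\<not> heads s"
  shows "\<exists>d t. act g (c, s) = (d, e t # s)"
proof -
  have "g \<otimes>\<^bsub>G\<^esub> \<phi> c \<notin> \<phi> ` carrier C"
  proof
    assume "g \<otimes>\<^bsub>G\<^esub> \<phi> c \<in> \<phi> ` carrier C"
    then obtain d where d: "d \<in> carrier C" "g \<otimes>\<^bsub>G\<^esub> \<phi> c = \<phi> d" by blast
    then have "g = \<phi> (d \<otimes>\<^bsub>C\<^esub> inv\<^bsub>C\<^esub> c)"
      using assms(1,3) by (metis C.inv_closed G.inv_solve_right phi_closed phi_inv phi_mult)
    with d assms show False by simp
  qed
  then have "rep (g \<otimes>\<^bsub>G\<^esub> \<phi> c) \<noteq> \<one>\<^bsub>G\<^esub>" using assms by (simp add: rep_eq_one phi_closed)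
  then show ?thesis using assms(4) by (auto simp: act_def unpack_other pack_def)
qed

end

locale amalgam_inj = amalgam G H C \<phi> \<psi>
  for G :: "('a, 'm) monoid_scheme" and H :: "('b, 'n) monoid_scheme"
    and C :: "('c, 'k) monoid_scheme" and \<phi> :: "'c \<Rightarrow> 'a" and \<psi> :: "'c \<Rightarrow> 'b" +
  assumes \<phi>_inj: "inj_on \<phi> (carrier C)" and \<psi>_inj: "inj_on \<psi> (carrier C)"
begin

primrec normal_form :: "('a + 'b) list \<Rightarrow> bool" where
  "normal_form [] \<longleftrightarrow> True"
| "normal_form (x # s) \<longleftrightarrow> normal_form s \<and> (s = [] \<or> isl x \<noteq> isl (hd s)) \<and>
     (case x of Inl g \<Rightarrow> g \<in> carrier G \<and> coset_rep C G \<phi> g = g \<and> g \<noteq> \<one>\<^bsub>G\<^esub>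
      | Inr h \<Rightarrow> h \<in> carrier H \<and> coset_rep C H \<psi> h = h \<and> h \<noteq> \<one>\<^bsub>H\<^esub>)"

lemma isl_hd: "(\<exists>t y. s = Inl t # y) \<longleftrightarrow> s \<noteq> [] \<and> isl (hd s)"
  "(\<exists>t y. s = Inr t # y) \<longleftrightarrow> s \<noteq> [] \<and> \<not> isl (hd s)"
  by (cases s; cases "hd s"; auto)+

sublocale left: factor_action G C \<phi> Inl "{s. normal_form s}"
  by unfold_locales (use \<phi>_hom \<phi>_inj in \<open>auto simp: isl_hd\<close>)

sublocale right: factor_action H C \<psi> Inr "{s. normal_form s}"
  by unfold_locales (use \<psi>_hom \<psi>_inj in \<open>auto simp: isl_hd\<close>)

primrec act_word :: "('a + 'b) list \<Rightarrow> 'c \<times> ('a + 'b) list \<Rightarrow> 'c \<times> ('a + 'b) list" where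
  "act_word [] x = x"
| "act_word (y # w) x = (case y of Inl g \<Rightarrow> left.act g (act_word w x) | Inr h \<Rightarrow> right.act h (act_word w x))"

abbreviation N where "N \<equiv> carrier C \<times> {s. normal_form s}"

lemma act_word_append: "act_word (u @ v) x = act_word u (act_word v x)"
  by (induction u) (auto split: sum.split)

lemma act_word_closed: "w \<in> W \<Longrightarrow> x \<in> N \<Longrightarrow> act_word w x \<in> N"
  by (induction w) (auto simp: amalg_words_def simp del: mem_Times_iff
      intro: left.act_closed right.act_closed split: sum.split)

text \<open>
  Every defining relation of the amalgamated product holds for the action: the multiplication tables
  because the factors act, and the amalgamation because of \<open>act_phi\<close>.
\<close>

lemma act_word_rel: "(u, v) \<in> R \<Longrightarrow> x \<in> N \<Longrightarrow> act_word u x = act_word v x"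
proof (induction arbitrary: x rule: amalg_rel.induct)
  case (append u v u' v')
  have "act_word v' x \<in> N" using rel_words[OF append.hyps(2)] append.prems act_word_closed by blast
  then show ?case using append.IH append.prems by (simp add: act_word_append)
next
  case (amalgamate c)
  then show ?case by (cases x) (auto simp: left.act_phi right.act_phi)
qed (auto simp: left.act_one right.act_one left.act_mult right.act_mult)

definition amalgamated :: "('a + 'b) set" where
  "amalgamated = Inl ` \<phi> ` carrier C \<union> Inr ` \<psi> ` carrier C"

text \<open>
  Unlike in normal forms, the entries of a reduced word need not be coset representatives.
\<close>

primrec reduced :: "('a + 'b) list \<Rightarrow> bool" where
  "reduced [] \<longleftrightarrow> True"
| "reduced (x # w) \<longleftrightarrow> x \<notin> amalgamated \<and> reduced w \<and> (w = [] \<or> isl x \<noteq> isl (hd w))"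

text \<open>
  Each letter of a reduced word, read from the right, meets a list that does not begin in its
  factor, and as it lies outside of \<open>C\<close> it adds an entry.
\<close>

lemma act_reduced:
  "w \<in> W \<Longrightarrow> reduced w \<Longrightarrow> \<exists>c s. act_word w (\<one>\<^bsub>C\<^esub>, []) = (c, s) \<and> length s = length w \<and>
     (w \<noteq> [] \<longrightarrow> isl (hd s) = isl (hd w))"
proof (induction w)
  case (Cons x w)
  then have w: "w \<in> W" "reduced w" and x: "x \<in> carrier G <+> carrier H" by (auto simp: amalg_words_def)
  from Cons.IH[OF w] obtain c s where cs: "act_word w (\<one>\<^bsub>C\<^esub>, []) = (c, s)" "length s = length w"
     "w \<noteq> [] \<longrightarrow> isl (hd s) = isl (hd w)" by blast
  have c: "c \<in> carrier C" using act_word_closed[OF w(1), of "(\<one>\<^bsub>C\<^esub>, [])"] cs(1) by simp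
  have alt: "s = [] \<or> isl x \<noteq> isl (hd s)" using cs Cons.prems by auto
  show ?case
  proof (cases x)
    case (Inl g)
    then have "\<not> left.heads s" using alt unfolding left.heads_def isl_hd by auto
    moreover have "g \<in> carrier G" "g \<notin> \<phi> ` carrier C"
      using Inl x Cons.prems(2) by (auto simp: amalgamated_def)
    ultimately obtain d t where "left.act g (c, s) = (d, Inl t # s)" using left.act_long c by blast
    then show ?thesis using Inl cs by simp
  next
    case (Inr h)
    then have "\<not> right.heads s" using alt unfolding right.heads_def isl_hd by auto
    moreover have "h \<in> carrier H" "h \<notin> \<psi> ` carrier C"
      using Inr x Cons.prems(2) by (auto simp: amalgamated_def)
    ultimately obtain d t where "right.act h (c, s) = (d, Inr t # s)" using right.act_long c by blast
    then show ?thesis using Inr cs by simp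
  qed
qed simp

lemma reduced_nontrivial:
  assumes "(w, []) \<in> R" "reduced w" shows "w = []"
  using act_reduced[of w] rel_words[OF assms(1)] assms(2) act_word_rel[OF assms(1), of "(\<one>\<^bsub>C\<^esub>, [])"]
  by auto

text \<open>
  The factors embed: an element of \<open>C\<close> that becomes trivial fixes the normal form \<open>(1, [])\<close>, and all other elements are
  reduced words.
\<close>

lemma left_injective:
  assumes "([Inl g], []) \<in> R" shows "g = \<one>\<^bsub>G\<^esub>"
proof -
  have "\<not> reduced [Inl g]" using reduced_nontrivial[OF assms] by blast
  then obtain c where c: "c \<in> carrier C" "g = \<phi> c" by (auto simp: amalgamated_def)
  then have "c = \<one>\<^bsub>C\<^esub>"
    using act_word_rel[OF assms, of "(\<one>\<^bsub>C\<^esub>, [])"] by (simp add: left.act_phi)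
  then show ?thesis using c left.phi_one by simp
qed

lemma right_injective:
  assumes "([Inr g], []) \<in> R" shows "g = \<one>\<^bsub>H\<^esub>"
proof -
  have "\<not> reduced [Inr g]" using reduced_nontrivial[OF assms] by blast
  then obtain c where c: "c \<in> carrier C" "g = \<psi> c" by (auto simp: amalgamated_def)
  then have "c = \<one>\<^bsub>C\<^esub>"
    using act_word_rel[OF assms, of "(\<one>\<^bsub>C\<^esub>, [])"] by (simp add: right.act_phi)
  then show ?thesis using c right.phi_one by simp
qed

end

section \<open>Saturating an acyclic graph over two factors\<close>

text \<open>
  Paths are recorded by the value of their label in a group (\<open>reaches\<close>) or by the label itself
  (\<open>spells\<close>); the vertices in between never matter.
\<close>

inductive reaches :: "('g, 'm) monoid_scheme \<Rightarrow> ('v \<times> 'g \<times> 'v) set \<Rightarrow> 'v \<Rightarrow> 'g \<Rightarrow> 'v \<Rightarrow> bool"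
  for K :: "('g, 'm) monoid_scheme" and A :: "('v \<times> 'g \<times> 'v) set" where
  refl: "reaches K A u \<one>\<^bsub>K\<^esub> u"
| step: "(u, a, v) \<in> A \<Longrightarrow> reaches K A v b w \<Longrightarrow> reaches K A u (a \<otimes>\<^bsub>K\<^esub> b) w"

inductive spells :: "('v \<times> 'x \<times> 'v) set \<Rightarrow> 'v \<Rightarrow> 'x list \<Rightarrow> 'v \<Rightarrow> bool"
  for A :: "('v \<times> 'x \<times> 'v) set" where
  Nil: "spells A u [] u"
| Cons: "(u, x, v) \<in> A \<Longrightarrow> spells A v w z \<Longrightarrow> spells A u (x # w) z"

inductive_cases spells_NilE: "spells A u [] v"
inductive_cases spells_ConsE: "spells A u (x # w) v"

lemma spells_append: "spells A u w v \<Longrightarrow> spells A v w' z \<Longrightarrow> spells A u (w @ w') z"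
  by (induction rule: spells.induct) (auto intro: spells.Cons)

lemma spells_append_iff: "spells A u (w @ w') z \<longleftrightarrow> (\<exists>v. spells A u w v \<and> spells A v w' z)"
proof
  show "spells A u (w @ w') z \<Longrightarrow> \<exists>v. spells A u w v \<and> spells A v w' z"
  proof (induction w arbitrary: u)
    case Nil
    then show ?case using spells.Nil[of A u] by auto
  next
    case (Cons a w)
    from Cons.prems obtain v where v: "(u, a, v) \<in> A" "spells A v (w @ w') z"
      by (auto elim: spells_ConsE)
    from Cons.IH[OF v(2)] v(1) show ?case using spells.Cons by metis
  qed
qed (auto intro: spells_append)

lemma spells_single: "spells A u [x] v \<longleftrightarrow> (u, x, v) \<in> A"
  by (auto intro: spells.intros elim!: spells_ConsE spells_NilE)

context group
begin

lemma reaches_closed: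
  assumes "reaches G A u g v" "A \<subseteq> UNIV \<times> carrier G \<times> UNIV"
  shows "g \<in> carrier G"
  using assms by induction auto

lemma reaches_edge: "(u, g, v) \<in> A \<Longrightarrow> g \<in> carrier G \<Longrightarrow> reaches G A u g v"
  using reaches.step[of u g v A G "\<one>" v] by (simp add: reaches.refl)

lemma reaches_trans:
  assumes "reaches G A u g v" "reaches G A v h w" "A \<subseteq> UNIV \<times> carrier G \<times> UNIV"
  shows "reaches G A u (g \<otimes> h) w"
  using assms
proof (induction rule: reaches.induct)
  case (refl u)
  then show ?case using reaches_closed[of A u h w] by simp
next
  case (step u a v b z)
  then have "a \<in> carrier G" "b \<in> carrier G" "h \<in> carrier G"
    using reaches_closed[OF step.hyps(2)] reaches_closed[of A z h w] by auto
  then show ?case using step by (simp add: m_assoc reaches.step)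
qed

end

lemma reaches_mono: "reaches K A u g v \<Longrightarrow> A \<subseteq> B \<Longrightarrow> reaches K B u g v"
  by (induction rule: reaches.induct) (auto intro: reaches.intros)

text \<open>
  In an acyclic graph the only path from a vertex to itself is the empty one.
\<close>

lemma reaches_rank:
  fixes rank :: "'v \<Rightarrow> nat"
  assumes "reaches K A u g v" "\<And>u a v. (u, a, v) \<in> A \<Longrightarrow> rank u < rank v"
  shows "(u = v \<and> g = \<one>\<^bsub>K\<^esub>) \<or> rank u < rank v"
  using assms by (induction rule: reaches.induct) fastforce+

definition relabel :: "('x \<Rightarrow> 'y) \<Rightarrow> ('v \<times> 'x \<times> 'v) set \<Rightarrow> ('v \<times> 'y \<times> 'v) set" where
  "relabel f A = (\<lambda>(u, x, v). (u, f x, v)) ` A"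

lemma in_relabel: "(u, y, v) \<in> relabel f A \<longleftrightarrow> (\<exists>x. y = f x \<and> (u, x, v) \<in> A)"
  by (force simp: relabel_def)

lemma relabelI: "(u, x, v) \<in> A \<Longrightarrow> (u, f x, v) \<in> relabel f A"
  by (auto simp: in_relabel)

lemma relabel_mono: "A \<subseteq> B \<Longrightarrow> relabel f A \<subseteq> relabel f B"
  unfolding relabel_def by (rule image_mono)

text \<open>
  The edges of \<open>AG\<close> and \<open>AH\<close> carry elements of the two factors, and the rank witnesses that their union is acyclic.
\<close>

locale amalgam_graph = amalgam_inj G H C \<phi> \<psi>
  for G :: "('a, 'm) monoid_scheme" and H :: "('b, 'n) monoid_scheme"
    and C :: "('c, 'k) monoid_scheme" and \<phi> :: "'c \<Rightarrow> 'a" and \<psi> :: "'c \<Rightarrow> 'b" +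
  fixes AG :: "('v \<times> 'a \<times> 'v) set" and AH :: "('v \<times> 'b \<times> 'v) set" and rank :: "'v \<Rightarrow> nat"
  assumes AG: "AG \<subseteq> UNIV \<times> carrier G \<times> UNIV" and AH: "AH \<subseteq> UNIV \<times> carrier H \<times> UNIV"
    and rank_AG: "(u, g, v) \<in> AG \<Longrightarrow> rank u < rank v"
    and rank_AH: "(u, h, v) \<in> AH \<Longrightarrow> rank u < rank v"
begin

definition mixed :: "('v \<times> ('a + 'b) \<times> 'v) set" where
  "mixed = relabel Inl AG \<union> relabel Inr AH"

abbreviation left_edges where "left_edges S \<equiv> AG \<union> relabel \<phi> S"
abbreviation right_edges where "right_edges S \<equiv> AH \<union> relabel \<psi> S"

text \<open>
  Shortcuts are triples \<open>(u, c, v)\<close>. They have to respect the rank, so that adding them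
  keeps the graph acyclic.
\<close>

definition sound :: "('v \<times> 'c \<times> 'v) set \<Rightarrow> bool" where
  "sound S \<longleftrightarrow> (\<forall>(u, c, v) \<in> S. c \<in> carrier C \<and> rank u < rank v \<and>
     (\<exists>w. spells mixed u w v \<and> (w, [Inl (\<phi> c)]) \<in> R))"

text \<open>
  Pairs with \<open>u = v\<close> are left out: such a shortcut would be a cycle, and nothing is lost, since by
  acyclicity it could only stand for the empty path.
\<close>

definition saturated :: "('v \<times> 'c \<times> 'v) set \<Rightarrow> bool" where
  "saturated S \<longleftrightarrow> (\<forall>u c v. u \<noteq> v \<and> c \<in> carrier C \<and>
     (reaches G (left_edges S) u (\<phi> c) v \<or> reaches H (right_edges S) u (\<psi> c) v) \<longrightarrow> (u, c, v) \<in> S)"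

lemma soundD:
  assumes "sound S" "(u, c, v) \<in> S"
  shows "c \<in> carrier C" "rank u < rank v" "\<exists>w. spells mixed u w v \<and> (w, [Inl (\<phi> c)]) \<in> R"
  using assms unfolding sound_def by blast+

lemma left_edges_closed: "sound S \<Longrightarrow> left_edges S \<subseteq> UNIV \<times> carrier G \<times> UNIV"
  using AG by (auto simp: in_relabel intro!: left.phi_closed intro: soundD(1))

lemma right_edges_closed: "sound S \<Longrightarrow> right_edges S \<subseteq> UNIV \<times> carrier H \<times> UNIV"
  using AH by (auto simp: in_relabel intro!: right.phi_closed intro: soundD(1))

lemma rank_left: "sound S \<Longrightarrow> (u, g, v) \<in> left_edges S \<Longrightarrow> rank u < rank v"
  by (auto simp: in_relabel intro: rank_AG soundD(2))

lemma rank_right: "sound S \<Longrightarrow> (u, g, v) \<in> right_edges S \<Longrightarrow> rank u < rank v"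
  by (auto simp: in_relabel intro: rank_AH soundD(2))

text \<open>
  Replacing each edge of a path within a factor, in particular each shortcut, by a path of the original graph with the same
  value in the amalgamated product.
\<close>

lemma reaches_spells:
  assumes r: "reaches K A u g v" and K: "group K" and A: "A \<subseteq> UNIV \<times> carrier K \<times> UNIV"
    and one: "([j \<one>\<^bsub>K\<^esub>], []) \<in> R"
    and mult: "\<And>a b. a \<in> carrier K \<Longrightarrow> b \<in> carrier K \<Longrightarrow> ([j a, j b], [j (a \<otimes>\<^bsub>K\<^esub> b)]) \<in> R"
    and edge: "\<And>u a v. (u, a, v) \<in> A \<Longrightarrow> \<exists>w. spells mixed u w v \<and> (w, [j a]) \<in> R"
  shows "\<exists>w. spells mixed u w v \<and> (w, [j g]) \<in> R"
  using r
proof (induction rule: reaches.induct)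
  case (refl u)
  show ?case using spells.Nil amalg_rel.sym[OF one] by metis
next
  case (step u a v b z)
  interpret K: group K by (rule K)
  have ab: "a \<in> carrier K" "b \<in> carrier K"
    using subsetD[OF A step.hyps(1)] K.reaches_closed[OF step.hyps(2) A] by simp_all
  from step.IH obtain w where w: "spells mixed v w z" "(w, [j b]) \<in> R" by blast
  from edge[OF step.hyps(1)] obtain w' where w': "spells mixed u w' v" "(w', [j a]) \<in> R" by blast
  have "(w' @ w, [j (a \<otimes>\<^bsub>K\<^esub> b)]) \<in> R"
    by (rule amalg_rel.trans[OF amalg_rel.append[OF w'(2) w(2)]]) (use mult[OF ab] in simp)
  then show ?case using spells_append[OF w'(1) w(1)] by blast
qed

lemma mixed_edge_word: "(u, x, v) \<in> mixed \<Longrightarrow> \<exists>w. spells mixed u w v \<and> (w, [x]) \<in> R"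
proof (intro exI conjI)
  assume x: "(u, x, v) \<in> mixed"
  then show "spells mixed u [x] v" by (simp add: spells_single)
  have "x \<in> carrier G <+> carrier H" using x AG AH by (auto simp: mixed_def in_relabel)
  then show "([x], [x]) \<in> R" by (intro amalg_rel.refl) (simp add: amalg_words_def)
qed

lemma reaches_left_spells:
  assumes "reaches G (left_edges S) u g v" "sound S"
  shows "\<exists>w. spells mixed u w v \<and> (w, [Inl g]) \<in> R"
proof (rule reaches_spells[OF assms(1) G.group_axioms left_edges_closed[OF assms(2)]])
  fix u a v assume "(u, a, v) \<in> left_edges S"
  then consider "(u, a, v) \<in> AG" | c where "a = \<phi> c" "(u, c, v) \<in> S" by (auto simp: in_relabel)
  then show "\<exists>w. spells mixed u w v \<and> (w, [Inl a]) \<in> R"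
  proof cases
    case 1
    then show ?thesis by (intro mixed_edge_word) (simp add: mixed_def relabelI)
  qed (use soundD(3)[OF assms(2)] in blast)
qed (auto intro: amalg_rel.one_left amalg_rel.mult_left)

lemma reaches_right_spells:
  assumes "reaches H (right_edges S) u h v" "sound S"
  shows "\<exists>w. spells mixed u w v \<and> (w, [Inr h]) \<in> R"
proof (rule reaches_spells[OF assms(1) H.group_axioms right_edges_closed[OF assms(2)]])
  fix u a v assume "(u, a, v) \<in> right_edges S"
  then consider "(u, a, v) \<in> AH" | c where "a = \<psi> c" "(u, c, v) \<in> S" by (auto simp: in_relabel)
  then show "\<exists>w. spells mixed u w v \<and> (w, [Inr a]) \<in> R"
  proof cases
    case 1
    then show ?thesis by (intro mixed_edge_word) (simp add: mixed_def relabelI)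
  next
    case (2 c)
    then show ?thesis
      using soundD[OF assms(2) 2(2)] amalg_rel.trans[OF _ amalg_rel.amalgamate] by metis
  qed
qed (auto intro: amalg_rel.one_right amalg_rel.mult_right)

text \<open>
  The graph in which every path within one factor, shortcuts allowed, is contracted to an edge.
\<close>

definition syllables :: "('v \<times> 'c \<times> 'v) set \<Rightarrow> ('v \<times> ('a + 'b) \<times> 'v) set" where
  "syllables S = {(u, Inl g, v) | u g v. reaches G (left_edges S) u g v} \<union>
     {(u, Inr h, v) | u h v. reaches H (right_edges S) u h v}"

lemma in_syllables:
  "(u, Inl g, v) \<in> syllables S \<longleftrightarrow> reaches G (left_edges S) u g v"
  "(u, Inr h, v) \<in> syllables S \<longleftrightarrow> reaches H (right_edges S) u h v"
  by (auto simp: syllables_def)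

lemma syllables_words:
  assumes "sound S" "spells (syllables S) u w v" shows "w \<in> W"
proof -
  have "x \<in> carrier G <+> carrier H" if "(a, x, b) \<in> syllables S" for a x b
    using that G.reaches_closed[OF _ left_edges_closed[OF assms(1)]]
      H.reaches_closed[OF _ right_edges_closed[OF assms(1)]] by (cases x) (auto simp: in_syllables)
  with assms(2) show ?thesis by induction (auto simp: amalg_words_def)
qed

lemma spells_mixed_syllables: "spells mixed u w v \<Longrightarrow> spells (syllables S) u w v"
proof (induction rule: spells.induct)
  case (Cons u x v w z)
  have "(u, x, v) \<in> syllables S"
  proof (cases x)
    case (Inl g)
    then have "(u, g, v) \<in> AG" using Cons.hyps(1) by (auto simp: mixed_def in_relabel)
    moreover have "g \<in> carrier G" using AG calculation by auto
    ultimately show ?thesis using Inl G.reaches_edge[of u g v] by (simp add: in_syllables)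
  next
    case (Inr g)
    then have "(u, g, v) \<in> AH" using Cons.hyps(1) by (auto simp: mixed_def in_relabel)
    moreover have "g \<in> carrier H" using AH calculation by auto
    ultimately show ?thesis using Inr H.reaches_edge[of u g v] by (simp add: in_syllables)
  qed
  then show ?case using Cons.IH by (rule spells.Cons)
qed (rule spells.Nil)

text \<open>
  A syllable with a value in \<open>C\<close> can be read over either factor: by saturation there is a parallel
  shortcut, unless the syllable is an empty path.
\<close>

lemma syllable_swap:
  assumes S: "sound S" "saturated S" and c: "c \<in> carrier C"
  shows "reaches G (left_edges S) u (\<phi> c) v \<longleftrightarrow> reaches H (right_edges S) u (\<psi> c) v"
proof (cases "u = v")
  case True
  have "reaches G (left_edges S) u (\<phi> c) u \<longleftrightarrow> c = \<one>\<^bsub>C\<^esub>"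
  proof
    assume "reaches G (left_edges S) u (\<phi> c) u"
    from reaches_rank[OF this rank_left[OF S(1)]] have "\<phi> c = \<phi> \<one>\<^bsub>C\<^esub>" by (simp add: left.phi_one)
    then show "c = \<one>\<^bsub>C\<^esub>" using c \<phi>_inj by (simp add: inj_on_def)
  qed (auto simp: left.phi_one intro: reaches.refl)
  moreover have "reaches H (right_edges S) u (\<psi> c) u \<longleftrightarrow> c = \<one>\<^bsub>C\<^esub>"
  proof
    assume "reaches H (right_edges S) u (\<psi> c) u"
    from reaches_rank[OF this rank_right[OF S(1)]] have "\<psi> c = \<psi> \<one>\<^bsub>C\<^esub>" by (simp add: right.phi_one)
    then show "c = \<one>\<^bsub>C\<^esub>" using c \<psi>_inj by (simp add: inj_on_def)
  qed (auto simp: right.phi_one intro: reaches.refl)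
  ultimately show ?thesis using True by simp
next
  case False
  have "reaches G (left_edges S) u (\<phi> c) v" if "(u, c, v) \<in> S"
    using that c by (intro G.reaches_edge) (auto simp: relabelI left.phi_closed)
  moreover have "reaches H (right_edges S) u (\<psi> c) v" if "(u, c, v) \<in> S"
    using that c by (intro H.reaches_edge) (auto simp: relabelI right.phi_closed)
  ultimately show ?thesis using S(2) False c unfolding saturated_def by blast
qed

lemma merge_same:
  assumes S: "sound S" and "(u, x, v) \<in> syllables S" "(v, y, z) \<in> syllables S" "isl x = isl y"
  shows "\<exists>xy. (u, xy, z) \<in> syllables S \<and> ([x, y], [xy]) \<in> R"
proof (cases x)
  case (Inl g)
  then obtain h where y: "y = Inl h" using assms(4) by (cases y) auto
  have r: "reaches G (left_edges S) u g v" "reaches G (left_edges S) v h z"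
    using assms Inl y by (auto simp: in_syllables)
  then have "g \<in> carrier G" "h \<in> carrier G" using G.reaches_closed[OF _ left_edges_closed[OF S]] by blast+
  then have "([x, y], [Inl (g \<otimes>\<^bsub>G\<^esub> h)]) \<in> R" unfolding Inl y by (rule amalg_rel.mult_left)
  moreover have "(u, Inl (g \<otimes>\<^bsub>G\<^esub> h), z) \<in> syllables S"
    using G.reaches_trans[OF r left_edges_closed[OF S]] by (simp add: in_syllables)
  ultimately show ?thesis by blast
next
  case (Inr g)
  then obtain h where y: "y = Inr h" using assms(4) by (cases y) auto
  have r: "reaches H (right_edges S) u g v" "reaches H (right_edges S) v h z"
    using assms Inr y by (auto simp: in_syllables)
  then have "g \<in> carrier H" "h \<in> carrier H" using H.reaches_closed[OF _ right_edges_closed[OF S]] by blast+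
  then have "([x, y], [Inr (g \<otimes>\<^bsub>H\<^esub> h)]) \<in> R" unfolding Inr y by (rule amalg_rel.mult_right)
  moreover have "(u, Inr (g \<otimes>\<^bsub>H\<^esub> h), z) \<in> syllables S"
    using H.reaches_trans[OF r right_edges_closed[OF S]] by (simp add: in_syllables)
  ultimately show ?thesis by blast
qed

lemma change_side:
  assumes S: "sound S" "saturated S" and "(u, x, v) \<in> syllables S" "x \<in> amalgamated"
  shows "\<exists>y. (u, y, v) \<in> syllables S \<and> isl y \<noteq> isl x \<and> ([x], [y]) \<in> R"
proof -
  from assms(4) obtain c where c: "c \<in> carrier C" "x = Inl (\<phi> c) \<or> x = Inr (\<psi> c)"
    by (auto simp: amalgamated_def)
  have R: "([Inl (\<phi> c)], [Inr (\<psi> c)]) \<in> R" by (rule amalg_rel.amalgamate[OF c(1)])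
  from c(2) show ?thesis
  proof
    assume x: "x = Inl (\<phi> c)"
    then have "(u, Inr (\<psi> c), v) \<in> syllables S"
      using assms(3) syllable_swap[OF S c(1)] by (simp add: in_syllables)
    then show ?thesis using R x by (intro exI[of _ "Inr (\<psi> c)"]) simp
  next
    assume x: "x = Inr (\<psi> c)"
    then have "(u, Inl (\<phi> c), v) \<in> syllables S"
      using assms(3) syllable_swap[OF S c(1)] by (simp add: in_syllables)
    then show ?thesis using amalg_rel.sym[OF R] x by (intro exI[of _ "Inl (\<phi> c)"]) simp
  qed
qed

text \<open>
  A syllable with a value in \<open>C\<close> is first moved to the factor of its neighbour.
\<close>

lemma merge:
  assumes S: "sound S" "saturated S"
    and x: "(u, x, v) \<in> syllables S" and y: "(v, y, z) \<in> syllables S"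
    and "isl x = isl y \<or> x \<in> amalgamated \<or> y \<in> amalgamated"
  shows "\<exists>xy. (u, xy, z) \<in> syllables S \<and> ([x, y], [xy]) \<in> R"
proof (cases "isl x = isl y")
  case True
  then show ?thesis using merge_same[OF S(1) x y] by blast
next
  case False
  have rf: "([x], [x]) \<in> R" "([y], [y]) \<in> R"
    using syllables_words[OF S(1), of u "[x]" v] syllables_words[OF S(1), of v "[y]" z] x y
    by (auto simp: spells_single intro: amalg_rel.refl)
  from False assms(5) consider "x \<in> amalgamated" | "y \<in> amalgamated" by blast
  then show ?thesis
  proof cases
    case 1
    from change_side[OF S x this] obtain x' where x': "(u, x', v) \<in> syllables S" "isl x' \<noteq> isl x" "([x], [x']) \<in> R"
      by blast
    then obtain xy where xy: "(u, xy, z) \<in> syllables S" "([x', y], [xy]) \<in> R"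
      using merge_same[OF S(1) x'(1) y] False by blast
    have "([x, y], [x', y]) \<in> R" using amalg_rel.append[OF x'(3) rf(2)] by simp
    from amalg_rel.trans[OF this xy(2)] xy(1) show ?thesis by blast
  next
    case 2
    from change_side[OF S y this] obtain y' where y': "(v, y', z) \<in> syllables S" "isl y' \<noteq> isl y" "([y], [y']) \<in> R"
      by blast
    then obtain xy where xy: "(u, xy, z) \<in> syllables S" "([x, y'], [xy]) \<in> R"
      using merge_same[OF S(1) x y'(1)] False by blast
    have "([x, y], [x, y']) \<in> R" using amalg_rel.append[OF rf(1) y'(3)] by simp
    from amalg_rel.trans[OF this xy(2)] xy(1) show ?thesis by blast
  qed
qed

lemma not_reduced:
  "\<not> reduced w \<Longrightarrow> length w \<ge> 2 \<Longrightarrow>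
   \<exists>a x y b. w = a @ [x, y] @ b \<and> (isl x = isl y \<or> x \<in> amalgamated \<or> y \<in> amalgamated)"
proof (induction w)
  case (Cons x w)
  then obtain y b where w: "w = y # b" by (cases w) auto
  show ?case
  proof (cases "isl x = isl y \<or> x \<in> amalgamated \<or> y \<in> amalgamated")
    case True
    then show ?thesis using w by (intro exI[of _ "[]"]) auto
  next
    case False
    then have nr: "\<not> reduced w" using Cons.prems w by auto
    have "b \<noteq> []" using nr False w by auto
    then have "length w \<ge> 2" using w by (cases b) auto
    from Cons.IH[OF nr this] obtain a x' y' b' where
      "w = a @ [x', y'] @ b'" "isl x' = isl y' \<or> x' \<in> amalgamated \<or> y' \<in> amalgamated" by blast
    then show ?thesis by (intro exI[of _ "x # a"]) auto
  qed
qed simp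

text \<open>
  Merging shortens the word, so it ends with a word in which no two adjacent syllables can be merged.
\<close>

lemma normalise_syllables:
  assumes S: "sound S" "saturated S"
  shows "spells (syllables S) u w v \<Longrightarrow>
    \<exists>w'. spells (syllables S) u w' v \<and> (w, w') \<in> R \<and> (reduced w' \<or> length w' \<le> 1)"
proof (induction w rule: length_induct)
  case (1 w)
  have wW: "w \<in> W" using syllables_words[OF S(1) 1(2)] .
  show ?case
  proof (cases "reduced w \<or> length w \<le> 1")
    case True
    then show ?thesis using 1(2) amalg_rel.refl[OF wW] by blast
  next
    case False
    with not_reduced[of w] obtain a x y b where w: "w = a @ [x, y] @ b"
      and xy: "isl x = isl y \<or> x \<in> amalgamated \<or> y \<in> amalgamated" by auto
    from 1(2) obtain p q r where p: "spells (syllables S) u a p" "(p, x, q) \<in> syllables S"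
      "(q, y, r) \<in> syllables S" "spells (syllables S) r b v"
      unfolding w spells_append_iff by (auto elim!: spells_ConsE spells_NilE)
    from merge[OF S p(2,3) xy] obtain m where m: "(p, m, r) \<in> syllables S" "([x, y], [m]) \<in> R" by blast
    let ?w = "a @ [m] @ b"
    have sp: "spells (syllables S) u ?w v"
      using p m unfolding spells_append_iff spells_single by blast
    have ab: "(a, a) \<in> R" "(b, b) \<in> R"
      using syllables_words[OF S(1)] p(1,4) by (auto intro: amalg_rel.refl)
    have wR: "(w, ?w) \<in> R" unfolding w by (intro amalg_rel.append ab m)
    have "length ?w < length w" by (simp add: w)
    with 1(1) sp obtain w' where w': "spells (syllables S) u w' v" "(?w, w') \<in> R" "reduced w' \<or> length w' \<le> 1"
      by blast
    from amalg_rel.trans[OF wR w'(2)] w' show ?thesis by blast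
  qed
qed

text \<open>
  The remaining word is reduced or has at most one letter. If it is trivial in the amalgamated product,
  the normal form theorem leaves the empty word and a single trivial syllable.
\<close>

theorem saturated_decides:
  assumes S: "sound S" "saturated S"
  shows "(\<exists>w. spells mixed u w v \<and> (w, []) \<in> R) \<longleftrightarrow> reaches G (left_edges S) u \<one>\<^bsub>G\<^esub> v"
proof
  assume "reaches G (left_edges S) u \<one>\<^bsub>G\<^esub> v"
  from reaches_left_spells[OF this S(1)] show "\<exists>w. spells mixed u w v \<and> (w, []) \<in> R"
    using amalg_rel.trans[OF _ amalg_rel.one_left] by metis
next
  assume "\<exists>w. spells mixed u w v \<and> (w, []) \<in> R"
  then obtain w where w: "spells mixed u w v" "(w, []) \<in> R" by blast
  from normalise_syllables[OF S spells_mixed_syllables[OF w(1)]] obtain w' where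
    w': "spells (syllables S) u w' v" "(w, w') \<in> R" "reduced w' \<or> length w' \<le> 1" by blast
  have nil: "(w', []) \<in> R" using amalg_rel.trans[OF amalg_rel.sym[OF w'(2)] w(2)] .
  show "reaches G (left_edges S) u \<one>\<^bsub>G\<^esub> v"
  proof (cases w')
    case Nil
    then show ?thesis using w'(1) by (auto elim!: spells_NilE intro: reaches.refl)
  next
    case (Cons x w'')
    then have "w'' = []" using reduced_nontrivial[OF nil] w'(3) by auto
    then have x: "(u, x, v) \<in> syllables S" "([x], []) \<in> R" using w'(1) nil Cons by (auto simp: spells_single)
    show ?thesis
    proof (cases x)
      case (Inl g)
      then have "g = \<one>\<^bsub>G\<^esub>" using x(2) left_injective by simp
      then show ?thesis using x(1) Inl by (simp add: in_syllables)
    next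
      case (Inr h)
      then have "h = \<one>\<^bsub>H\<^esub>" using x(2) right_injective by simp
      then have "reaches H (right_edges S) u (\<psi> \<one>\<^bsub>C\<^esub>) v"
        using x(1) Inr by (simp add: in_syllables right.phi_one)
      then show ?thesis using syllable_swap[OF S, of "\<one>\<^bsub>C\<^esub>" u v] by (simp add: left.phi_one)
    qed
  qed
qed

text \<open>
  One round of the saturation, restricted to a set \<open>T\<close> of possible shortcuts. Triples that are already present are
  found again, so that \<open>S\<close> need not be added to the result.
\<close>

definition saturate_step :: "('v \<times> 'c \<times> 'v) set \<Rightarrow> ('v \<times> 'c \<times> 'v) set \<Rightarrow> ('v \<times> 'c \<times> 'v) set" where
  "saturate_step T S = {(u, c, v) \<in> T. u \<noteq> v \<and>
     (reaches G (left_edges S) u (\<phi> c) v \<or> reaches H (right_edges S) u (\<psi> c) v)}"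

lemma sound_step:
  assumes "sound S" "T \<subseteq> UNIV \<times> carrier C \<times> UNIV"
  shows "sound (saturate_step T S)"
  unfolding sound_def
proof (clarify, intro conjI)
  fix u c v assume t: "(u, c, v) \<in> saturate_step T S"
  then show c: "c \<in> carrier C" using assms(2) by (auto simp: saturate_step_def)
  from t have uv: "u \<noteq> v" and r: "reaches G (left_edges S) u (\<phi> c) v \<or> reaches H (right_edges S) u (\<psi> c) v"
    by (auto simp: saturate_step_def)
  from r show "rank u < rank v"
    using uv reaches_rank[of G "left_edges S" u _ v rank] reaches_rank[of H "right_edges S" u _ v rank]
      rank_left[OF assms(1)] rank_right[OF assms(1)] by metis
  from r show "\<exists>w. spells mixed u w v \<and> (w, [Inl (\<phi> c)]) \<in> R"
    using reaches_left_spells[OF _ assms(1)] reaches_right_spells[OF _ assms(1)]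
      amalg_rel.trans[OF _ amalg_rel.sym[OF amalg_rel.amalgamate[OF c]]] by metis
qed

lemma mono_step: "mono (saturate_step T)"
proof (rule monoI, clarify)
  fix S S' :: "('v \<times> 'c \<times> 'v) set" and u c v
  assume "S \<subseteq> S'" "(u, c, v) \<in> saturate_step T S"
  moreover from this have l: "left_edges S \<subseteq> left_edges S'" and r: "right_edges S \<subseteq> right_edges S'"
    using relabel_mono[of S S'] by blast+
  ultimately show "(u, c, v) \<in> saturate_step T S'"
    using reaches_mono[OF _ l, of G u "\<phi> c" v] reaches_mono[OF _ r, of H u "\<psi> c" v]
    unfolding saturate_step_def by blast
qed

end

text \<open>
  As long as the iteration has not become stationary, each round adds an element.
\<close>

lemma funpow_mono_fixpoint:
  fixes F :: "'x set \<Rightarrow> 'x set"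
  assumes mono: "mono F" and T: "\<And>S. F S \<subseteq> T" "finite T" "card T \<le> n"
  shows "F ((F ^^ n) {}) = (F ^^ n) {}"
proof -
  define S where "S i = (F ^^ i) {}" for i
  have S0: "S 0 = {}" and S_Suc: "S (Suc i) = F (S i)" for i by (simp_all add: S_def)
  have sub: "S (Suc i) \<subseteq> T" for i unfolding S_Suc by (rule T(1))
  have inc: "S i \<subseteq> S (Suc i)" for i
  proof (induction i)
    case (Suc i)
    from monoD[OF mono this] show ?case by (simp only: S_Suc)
  qed (simp add: S0)
  have "S (Suc i) = S i \<or> i + 1 \<le> card (S (Suc i))" for i
  proof (induction i)
    case 0
    have "finite (S (Suc 0))" using finite_subset[OF sub T(2)] .
    then show ?case by (cases "S (Suc 0) = {}") (auto simp: Suc_le_eq card_gt_0_iff S0)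
  next
    case (Suc i)
    show ?case
    proof (cases "S (Suc (Suc i)) = S (Suc i)")
      case False
      then have "S (Suc i) \<noteq> S i" by (metis S_Suc)
      with Suc have "i + 1 \<le> card (S (Suc i))" by blast
      moreover have "S (Suc i) \<subset> S (Suc (Suc i))" using inc[of "Suc i"] False by blast
      then have "card (S (Suc i)) < card (S (Suc (Suc i)))"
        by (rule psubset_card_mono[OF finite_subset[OF sub T(2)]])
      ultimately show ?thesis by linarith
    qed simp
  qed
  from this[of n] show ?thesis
  proof
    assume "n + 1 \<le> card (S (Suc n))"
    also have "\<dots> \<le> card T" using sub T(2) by (intro card_mono)
    finally show ?thesis using T(3) by simp
  qed (simp add: S_def)
qed

section \<open>Polynomial-time functions on trees\<close>

lemma poly_nat_mono:
  fixes q :: "nat poly"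
  assumes "m \<le> n"
  shows "poly q m \<le> poly q n"
  using assms by (induction q) (auto intro!: mult_mono)

text \<open>
  Building a tree costs at least its size.
\<close>

lemma exec_size:
  "exec Os p s t s' \<Longrightarrow> size (s' x) \<le> size (s x) + t"
proof (induction rule: exec.induct)
  case (Assign y e s)
  show ?case using size_eval_le_cost[of e s] by simp
qed (auto simp: tree_of_bool_def)

text \<open>
  The argument and the result are passed in register \<open>k\<close>, and the registers below \<open>k\<close> are
  preserved. So a program may keep values in the registers below the one at which it runs another program, and no
  bookkeeping of used registers is needed. The registers above \<open>k\<close> may hold anything at the start; the time bound
  depends only on the argument.
\<close>

definition computes :: "bintree set list \<Rightarrow> com \<Rightarrow> nat \<Rightarrow> (bintree \<Rightarrow> bintree) \<Rightarrow> nat poly \<Rightarrow> bool" where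
  "computes Os p k f q \<longleftrightarrow>
     (\<forall>s. \<exists>t s'. exec Os p s t s' \<and> s' k = f (s k) \<and> (\<forall>j<k. s' j = s j) \<and>
        t \<le> poly q (size (s k)))"

text \<open>
  The time bound must not depend on the register at which the program is run.
\<close>

definition polytime :: "bintree set list \<Rightarrow> (bintree \<Rightarrow> bintree) \<Rightarrow> bool" where
  "polytime Os f \<longleftrightarrow> (\<exists>q. \<forall>k. \<exists>p. computes Os p k f q)"

lemma computesE:
  assumes "computes Os p k f q"
  obtains t s' where "exec Os p s t s'" "s' k = f (s k)" "\<And>j. j < k \<Longrightarrow> s' j = s j"
    "t \<le> poly q (size (s k))"
  using assms unfolding computes_def by meson

lemma runI:
  assumes "exec Os p s t s'" "s' k = y" "\<And>j. j < k \<Longrightarrow> s' j = s j" "t \<le> b"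
  shows "\<exists>t s'. exec Os p s t s' \<and> s' k = y \<and> (\<forall>j<k. s' j = s j) \<and> t \<le> b"
  using assms by blast

lemma polytimeI:
  "(\<And>k. \<exists>p. computes Os p k f q) \<Longrightarrow> polytime Os f"
  unfolding polytime_def by blast

lemma polytimeE:
  assumes "polytime Os f"
  obtains q where "\<And>k. \<exists>p. computes Os p k f q"
  using assms unfolding polytime_def by blast

lemma polytime_size:
  assumes "polytime Os f"
  obtains q where "\<And>x. size (f x) \<le> poly q (size x)"
proof -
  from assms obtain q where q: "\<And>k. \<exists>p. computes Os p k f q" by (rule polytimeE) blast
  from q[of 0] obtain p where p: "computes Os p 0 f q" ..
  have "size (f x) \<le> poly ([:0, 1:] + q) (size x)" for x
  proof -
    obtain t s' where "exec Os p (\<lambda>_. x) t s'" "s' 0 = f x" "t \<le> poly q (size x)"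
      using computesE[OF p, of "\<lambda>_. x"] by metis
    with exec_size[of Os p "\<lambda>_. x" t s' 0] show ?thesis by simp
  qed
  then show ?thesis by (rule that)
qed

lemma polytime_expr:
  assumes "\<And>k s. eval (e k) s = f (s k)" and "\<And>k s. cost (e k) s \<le> poly q (size (s k))"
  shows "polytime Os f"
proof (rule polytimeI)
  fix k
  have "computes Os (Assign k (e k)) k f ([:1:] + q)"
    unfolding computes_def
  proof
    fix s
    show "\<exists>t s'. exec Os (Assign k (e k)) s t s' \<and> s' k = f (s k) \<and> (\<forall>j<k. s' j = s j) \<and>
        t \<le> poly ([:1:] + q) (size (s k))"
      by (intro exI conjI, rule exec.Assign) (use assms(1)[of k s] assms(2)[of k s] in auto)
  qed
  then show "\<exists>p. computes Os p k f ([:1:] + q)" ..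
qed

lemma polytime_id: "polytime Os (\<lambda>x. x)"
  by (rule polytime_expr[of "\<lambda>k. Var k" _ "[:1, 1:]"]) auto

lemma polytime_left_fun: "polytime Os left"
  by (rule polytime_expr[of "\<lambda>k. Hd (Var k)" _ "[:2, 1:]"]) auto

lemma polytime_right_fun: "polytime Os right"
  by (rule polytime_expr[of "\<lambda>k. Tl (Var k)" _ "[:2, 1:]"]) auto

lemma polytime_eq_fun: "polytime Os (\<lambda>x. tree_of_bool (left x = right x))"
  by (rule polytime_expr[of "\<lambda>k. Eq (Hd (Var k)) (Tl (Var k))" _ "[:5, 2:]"]) auto

fun const_expr :: "bintree \<Rightarrow> expr" where
  "const_expr Leaf = Const_Leaf"
| "const_expr (Node a b) = Join (const_expr a) (const_expr b)"

lemma eval_const_expr: "eval (const_expr c) s = c"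
  by (induction c) auto

lemma cost_const_expr: "cost (const_expr c) s = 1 + 2 * size c"
  by (induction c) auto

lemma polytime_const: "polytime Os (\<lambda>x. c)"
  by (rule polytime_expr[of "\<lambda>k. const_expr c" _ "[:1 + 2 * size c:]"])
    (simp_all add: eval_const_expr cost_const_expr)

lemma polytime_ask_fun:
  assumes "i < length Os"
  shows "polytime Os (\<lambda>x. tree_of_bool (x \<in> Os ! i))"
proof (rule polytimeI)
  fix k
  have "computes Os (Ask i k (Var k)) k (\<lambda>x. tree_of_bool (x \<in> Os ! i)) [:2, 1:]"
    unfolding computes_def
  proof
    fix s
    show "\<exists>t s'. exec Os (Ask i k (Var k)) s t s' \<and> s' k = tree_of_bool (s k \<in> Os ! i) \<and>
        (\<forall>j<k. s' j = s j) \<and> t \<le> poly [:2, 1:] (size (s k))"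
      by (intro exI conjI, rule exec.Ask) (use assms in auto)
  qed
  then show "\<exists>p. computes Os p k (\<lambda>x. tree_of_bool (x \<in> Os ! i)) [:2, 1:]" ..
qed

lemma polytime_comp:
  assumes f: "polytime Os f" and g: "polytime Os g"
  shows "polytime Os (\<lambda>x. g (f x))"
proof -
  from f obtain qf where qf: "\<And>k. \<exists>p. computes Os p k f qf" by (rule polytimeE) blast
  from g obtain qg where qg: "\<And>k. \<exists>p. computes Os p k g qg" by (rule polytimeE) blast
  from f obtain qs where qs: "\<And>x. size (f x) \<le> poly qs (size x)" by (rule polytime_size) blast
  let ?q = "[:1:] + qf + pcompose qg qs"
  show ?thesis
  proof (rule polytimeI)
    fix k
    from qf obtain p where p: "computes Os p k f qf" by blast
    from qg obtain p' where p': "computes Os p' k g qg" by blast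
    have "computes Os (Seq p p') k (\<lambda>x. g (f x)) ?q"
      unfolding computes_def
    proof
      fix s
      obtain t1 s1 where 1: "exec Os p s t1 s1" "s1 k = f (s k)" "\<And>j. j < k \<Longrightarrow> s1 j = s j"
        "t1 \<le> poly qf (size (s k))" using computesE[OF p, of s] by metis
      obtain t2 s2 where 2: "exec Os p' s1 t2 s2" "s2 k = g (s1 k)" "\<And>j. j < k \<Longrightarrow> s2 j = s1 j"
        "t2 \<le> poly qg (size (s1 k))" using computesE[OF p', of s1] by metis
      have "poly qg (size (s1 k)) \<le> poly qg (poly qs (size (s k)))"
        using 1(2) qs by (simp add: poly_nat_mono)
      then have "1 + t1 + t2 \<le> poly ?q (size (s k))" using 1(4) 2(4) by (simp add: poly_pcompose)
      note b = this
      from exec.Seq[OF 1(1) 2(1)] show "\<exists>t s'. exec Os (Seq p p') s t s' \<and> s' k = g (f (s k)) \<and>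
        (\<forall>j<k. s' j = s j) \<and> t \<le> poly ?q (size (s k))"
        by (rule runI) (use 1 2 b in auto)
    qed
    then show "\<exists>p. computes Os p k (\<lambda>x. g (f x)) ?q" ..
  qed
qed

lemmas polytime_left = polytime_comp[OF _ polytime_left_fun]
lemmas polytime_right = polytime_comp[OF _ polytime_right_fun]
lemmas polytime_ask = polytime_comp[OF _ polytime_ask_fun]

text \<open>
  Calling a program on the contents of register \<open>k\<close> without losing these.
\<close>

lemma computes_copy:
  assumes "computes Os p (Suc (k + i)) f q"
  obtains t s' where
    "exec Os (Seq (Assign (Suc (k + i)) (Var k)) p) s t s'" "s' (Suc (k + i)) = f (s k)"
    "\<And>j. j \<le> k + i \<Longrightarrow> s' j = s j" "t \<le> 3 + size (s k) + poly q (size (s k))"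
proof -
  let ?s = "s(Suc (k + i) := s k)"
  obtain t s' where 1: "exec Os p ?s t s'" "s' (Suc (k + i)) = f (s k)"
    "\<And>j. j < Suc (k + i) \<Longrightarrow> s' j = ?s j" "t \<le> poly q (size (s k))"
    using computesE[OF assms, of ?s] by (metis fun_upd_same)
  have "exec Os (Assign (Suc (k + i)) (Var k)) s (1 + cost (Var k) s) ?s"
    using exec.Assign[of Os "Suc (k + i)" "Var k" s] by simp
  from exec.Seq[OF this 1(1)] show ?thesis
    by (rule that) (use 1 in auto)
qed

lemma polytime_Node:
  assumes f: "polytime Os f" and g: "polytime Os g"
  shows "polytime Os (\<lambda>x. Node (f x) (g x))"
proof -
  from f obtain qf where qf: "\<And>k. \<exists>p. computes Os p k f qf" by (rule polytimeE) blast
  from g obtain qg where qg: "\<And>k. \<exists>p. computes Os p k g qg" by (rule polytimeE) blast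
  from f obtain rf where rf: "\<And>x. size (f x) \<le> poly rf (size x)" by (rule polytime_size) blast
  from g obtain rg where rg: "\<And>x. size (g x) \<le> poly rg (size x)" by (rule polytime_size) blast
  let ?q = "[:12, 2:] + qf + qg + rf + rg"
  show ?thesis
  proof (rule polytimeI)
    fix k
    from qf obtain p where p: "computes Os p (Suc (k + 0)) f qf" by blast
    from qg obtain p' where p': "computes Os p' (Suc (k + 1)) g qg" by blast
    let ?p1 = "Seq (Assign (Suc (k + 0)) (Var k)) p" and ?p2 = "Seq (Assign (Suc (k + 1)) (Var k)) p'"
    let ?e = "Join (Var (k + 1)) (Var (k + 2))"
    let ?p = "Seq ?p1 (Seq ?p2 (Assign k ?e))"
    have "computes Os ?p k (\<lambda>x. Node (f x) (g x)) ?q"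
      unfolding computes_def
    proof
      fix s
      obtain t1 s1 where 1: "exec Os ?p1 s t1 s1" "s1 (Suc (k + 0)) = f (s k)"
        "\<And>j. j \<le> k + 0 \<Longrightarrow> s1 j = s j" "t1 \<le> 3 + size (s k) + poly qf (size (s k))"
        by (rule computes_copy[OF p, of s]) blast
      obtain t2 s2 where 2: "exec Os ?p2 s1 t2 s2" "s2 (Suc (k + 1)) = g (s1 k)"
        "\<And>j. j \<le> k + 1 \<Longrightarrow> s2 j = s1 j" "t2 \<le> 3 + size (s1 k) + poly qg (size (s1 k))"
        by (rule computes_copy[OF p', of s1]) blast
      have "1 + t1 + (1 + t2 + (1 + cost ?e s2)) \<le> poly ?q (size (s k))"
        using 1(2-4) 2(2-4) rf[of "s k"] rg[of "s k"] by simp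
      note b = this
      from exec.Seq[OF 1(1) exec.Seq[OF 2(1) exec.Assign[of Os k ?e s2]]]
      show "\<exists>t s'. exec Os ?p s t s' \<and> s' k = Node (f (s k)) (g (s k)) \<and>
        (\<forall>j<k. s' j = s j) \<and> t \<le> poly ?q (size (s k))"
        by (rule runI) (use 1(2,3) 2(2,3) b in auto)
    qed
    then show "\<exists>p. computes Os p k (\<lambda>x. Node (f x) (g x)) ?q" ..
  qed
qed

lemma polytime_eq:
  assumes "polytime Os f" and "polytime Os g"
  shows "polytime Os (\<lambda>x. tree_of_bool (f x = g x))"
  using polytime_comp[OF polytime_Node[OF assms] polytime_eq_fun] by simp

lemma polytime_if:
  assumes b: "polytime Os b" and f: "polytime Os f" and g: "polytime Os g"
  shows "polytime Os (\<lambda>x. if b x \<noteq> Leaf then f x else g x)"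
proof -
  from b obtain qb where qb: "\<And>k. \<exists>p. computes Os p k b qb" by (rule polytimeE) blast
  from f obtain qf where qf: "\<And>k. \<exists>p. computes Os p k f qf" by (rule polytimeE) blast
  from g obtain qg where qg: "\<And>k. \<exists>p. computes Os p k g qg" by (rule polytimeE) blast
  from b obtain rb where rb: "\<And>x. size (b x) \<le> poly rb (size x)" by (rule polytime_size) blast
  let ?q = "[:12, 2:] + qb + qf + qg + rb"
  show ?thesis
  proof (rule polytimeI)
    fix k
    from qb obtain p where p: "computes Os p (Suc (k + 0)) b qb" by blast
    from qf obtain p1 where p1: "computes Os p1 k f qf" by blast
    from qg obtain p2 where p2: "computes Os p2 k g qg" by blast
    let ?test = "Seq (Assign (Suc (k + 0)) (Var k)) p"
    let ?p = "Seq ?test (Cond (Var (k + 1)) p1 p2)"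
    have "computes Os ?p k (\<lambda>x. if b x \<noteq> Leaf then f x else g x) ?q"
      unfolding computes_def
    proof
      fix s
      obtain t0 s0 where 0: "exec Os ?test s t0 s0" "s0 (Suc (k + 0)) = b (s k)"
        "\<And>j. j \<le> k + 0 \<Longrightarrow> s0 j = s j" "t0 \<le> 3 + size (s k) + poly qb (size (s k))"
        by (rule computes_copy[OF p, of s]) blast
      obtain t1 s1 where 1: "exec Os p1 s0 t1 s1" "s1 k = f (s0 k)" "\<And>j. j < k \<Longrightarrow> s1 j = s0 j"
        "t1 \<le> poly qf (size (s0 k))" using computesE[OF p1, of s0] by metis
      obtain t2 s2 where 2: "exec Os p2 s0 t2 s2" "s2 k = g (s0 k)" "\<And>j. j < k \<Longrightarrow> s2 j = s0 j"
        "t2 \<le> poly qg (size (s0 k))" using computesE[OF p2, of s0] by metis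
      show "\<exists>t s'. exec Os ?p s t s' \<and> s' k = (if b (s k) \<noteq> Leaf then f (s k) else g (s k)) \<and>
        (\<forall>j<k. s' j = s j) \<and> t \<le> poly ?q (size (s k))"
      proof (cases "b (s k) = Leaf")
        case True
        then have "eval (Var (k + 1)) s0 = Leaf" using 0(2) by simp
        from exec.Seq[OF 0(1) exec.Cond_False[OF this 2(1), of p1]]
        show ?thesis 
          by (rule runI) (use 0(2-4) 2(2-4) True rb[of "s k"] in auto)
      next
        case False
        then have "eval (Var (k + 1)) s0 \<noteq> Leaf" using 0(2) by simp
        from exec.Seq[OF 0(1) exec.Cond_True[OF this 1(1), of p2]]
        show ?thesis 
          by (rule runI) (use 0(2-4) 1(2-4) False rb[of "s k"] in auto)
      qed
    qed
    then show "\<exists>p. computes Os p k (\<lambda>x. if b x \<noteq> Leaf then f x else g x) ?q" ..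
  qed
qed

text \<open>
  Every tree is read as the list of its left subtrees along the right spine. This inverts \<^const>\<open>enc_list\<close> for the identity, and
  the unary numbers are the lists of leaves.
\<close>

fun entries :: "bintree \<Rightarrow> bintree list" where
  "entries Leaf = []"
| "entries (Node y l) = y # entries l"

lemma length_entries: "length (entries l) \<le> size l"
  by (induction l) auto

lemma size_entries: "y \<in> set (entries l) \<Longrightarrow> size y \<le> size l"
  by (induction l) auto

text \<open>
  The loop keeps its argument in register \<open>k\<close>, the rest of the list in register \<open>k + 1\<close> and the accumulator in register
  \<open>k + 2\<close>, and runs the step at register \<open>k + 3\<close>. If \<open>L\<close> bounds the list and \<open>M\<close> the accumulator throughout,
  each round takes the time given by the factor of the length in the bound; its constants are chosen generously.
\<close>

lemma exec_fold:
  fixes step :: "bintree \<Rightarrow> bintree \<Rightarrow> bintree"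
  defines "body p k \<equiv> Seq (Assign (k + 3) (Join (Var k) (Join (Hd (Var (k + 1))) (Var (k + 2)))))
      (Seq p (Seq (Assign (k + 2) (Var (k + 3))) (Assign (k + 1) (Tl (Var (k + 1))))))"
  assumes p: "computes Os p (k + 3) f q"
    and f: "\<And>y a. f (Node x (Node y a)) = step y a"
    and "s k = x" "s (k + 1) = l" "s (k + 2) = a" "size l \<le> L"
    and "\<And>i. size (fold step (take i (entries l)) a) \<le> M"
  shows "\<exists>t s'. exec Os (Loop (Var (k + 1)) (body p k)) s t s' \<and>
      s' (k + 2) = fold step (entries l) a \<and> (\<forall>j\<le>k. s' j = s j) \<and>
      t \<le> length (entries l) * (20 + size x + 3 * L + 2 * M + poly q (size x + L + M + 2)) + (2 + L)"
  using assms(4-)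
proof (induction l arbitrary: s a)
  case Leaf
  then have "eval (Var (k + 1)) s = Leaf" by simp
  note exec.Loop_False[OF this, of Os "body p k"]
  moreover have "1 + cost (Var (k + 1)) s = 2" using Leaf by simp
  ultimately have "exec Os (Loop (Var (k + 1)) (body p k)) s 2 s" by metis
  moreover have "s (k + 2) = fold step (entries Leaf) a" using Leaf by simp
  moreover have "2 \<le> length (entries Leaf) *
    (20 + size x + 3 * L + 2 * M + poly q (size x + L + M + 2)) + (2 + L)" by simp
  ultimately show ?case by blast
next
  case (Node y l)
  let ?c = "20 + size x + 3 * L + 2 * M + poly q (size x + L + M + 2)"
  let ?e = "Join (Var k) (Join (Hd (Var (k + 1))) (Var (k + 2)))"
  let ?z = "Node x (Node y a)"
  let ?s1 = "s(k + 3 := ?z)"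
  have 1: "exec Os (Assign (k + 3) ?e) s (1 + cost ?e s) ?s1"
    using exec.Assign[of Os "k + 3" ?e s] Node.prems by simp
  obtain t2 s2 where 2: "exec Os p ?s1 t2 s2" "s2 (k + 3) = f ?z"
    "\<And>j. j < k + 3 \<Longrightarrow> s2 j = ?s1 j" "t2 \<le> poly q (size ?z)"
    using computesE[OF p, of ?s1] by (metis fun_upd_same)
  let ?a = "step y a"
  let ?s3 = "s2(k + 2 := ?a)"
  have 3: "exec Os (Assign (k + 2) (Var (k + 3))) s2 (2 + size ?a) ?s3"
    using exec.Assign[of Os "k + 2" "Var (k + 3)" s2] 2(2) by (simp add: f)
  let ?s4 = "?s3(k + 1 := l)"
  have s3: "?s3 (k + 1) = Node y l" using 2(3)[of "k + 1"] Node.prems by simp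
  have 4: "exec Os (Assign (k + 1) (Tl (Var (k + 1)))) ?s3 (3 + size (Node y l)) ?s4"
    using exec.Assign[of Os "k + 1" "Tl (Var (k + 1))" ?s3] s3 by (simp add: eval_nat_numeral)
  have bound: "size (fold step (take i (entries l)) ?a) \<le> M" for i
    using Node.prems(5)[of "Suc i"] by simp
  have sa: "size a \<le> M" "size ?a \<le> M" using Node.prems(5)[of 0] bound[of 0] by simp_all
  have IH: "\<exists>t s'. exec Os (Loop (Var (k + 1)) (body p k)) ?s4 t s' \<and>
      s' (k + 2) = fold step (entries l) ?a \<and> (\<forall>j\<le>k. s' j = ?s4 j) \<and>
      t \<le> length (entries l) * ?c + (2 + L)"
    by (rule Node.IH(2)) (use bound Node.prems(1-4) 2(3)[of k] in auto)
  then obtain t5 s5 where 5: "exec Os (Loop (Var (k + 1)) (body p k)) ?s4 t5 s5"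
    "s5 (k + 2) = fold step (entries l) ?a" "\<And>j. j \<le> k \<Longrightarrow> s5 j = ?s4 j"
    "t5 \<le> length (entries l) * ?c + (2 + L)" by blast
  have b: "exec Os (body p k) s (1 + (1 + cost ?e s) + (1 + t2 + (1 + (2 + size ?a) + (3 + size (Node y l))))) ?s4"
    unfolding body_def by (rule exec.Seq[OF 1 exec.Seq[OF 2(1) exec.Seq[OF 3 4]]])
  have nz: "eval (Var (k + 1)) s \<noteq> Leaf" using Node.prems by simp
  have "poly q (size ?z) \<le> poly q (size x + L + M + 2)"
    using Node.prems(4) sa by (intro poly_nat_mono) auto
  then have t: "t2 \<le> poly q (size x + L + M + 2)" using 2(4) by simp
  have ce: "cost ?e s \<le> 7 + size x + L + M" using Node.prems(1-4) sa by simp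
  have sn: "size (Node y l) \<le> L" using Node.prems(4) .
  have cv: "cost (Var (k + 1)) s \<le> 1 + L" using Node.prems by simp
  have "1 + cost (Var (k + 1)) s
      + (1 + (1 + cost ?e s) + (1 + t2 + (1 + (2 + size ?a) + (3 + size (Node y l))))) + t5
      \<le> ?c + length (entries l) * ?c + (2 + L)"
    using t ce sn sa cv 5(4) by linarith
  then have t': "1 + cost (Var (k + 1)) s
      + (1 + (1 + cost ?e s) + (1 + t2 + (1 + (2 + size ?a) + (3 + size (Node y l))))) + t5
      \<le> length (entries (Node y l)) * ?c + (2 + L)"
    by (simp only: entries.simps list.size mult_Suc add_mult_distrib)
  have "\<forall>j\<le>k. s5 j = s j" using 5(3) 2(3) by auto
  moreover have "s5 (k + 2) = fold step (entries (Node y l)) a" using 5(2) by simp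
  ultimately show ?case using exec.Loop_True[OF nz b 5(1)] t' by blast
qed

text \<open>
  The central closure property. The step may also use the argument \<open>x\<close> of the whole function. Since iterating a
  polynomial-time function can build trees of exponential size, a bound on the intermediate results is required.
\<close>

lemma polytime_fold_bounded:
  assumes step: "polytime Os (\<lambda>z. step (left z) (left (right z)) (right (right z)))"
    and l: "polytime Os l" and a: "polytime Os a"
    and bound: "\<And>x i. size (fold (step x) (take i (entries (l x))) (a x)) \<le> poly g (size x)"
  shows "polytime Os (\<lambda>x. fold (step x) (entries (l x)) (a x))"
proof -
  let ?f = "\<lambda>z. step (left z) (left (right z)) (right (right z))"
  from step obtain qs where qs: "\<And>k. \<exists>p. computes Os p k ?f qs" by (rule polytimeE) blast
  from l obtain ql where ql: "\<And>k. \<exists>p. computes Os p k l ql" by (rule polytimeE) blast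
  from a obtain qa where qa: "\<And>k. \<exists>p. computes Os p k a qa" by (rule polytimeE) blast
  from l obtain rl where rl: "\<And>x. size (l x) \<le> poly rl (size x)" by (rule polytime_size) blast
  let ?c = "[:20, 1:] + rl + rl + rl + g + g + pcompose qs ([:2, 1:] + rl + g)"
  let ?q = "[:20, 2:] + ql + qa + rl * ?c + rl + g"
  show ?thesis
  proof (rule polytimeI)
    fix k
    from ql obtain pl where pl: "computes Os pl (Suc (k + 0)) l ql" by blast
    from qa obtain pa where pa: "computes Os pa (Suc (k + 1)) a qa" by blast
    from qs obtain ps where ps: "computes Os ps (k + 3) ?f qs" by blast
    let ?p1 = "Seq (Assign (Suc (k + 0)) (Var k)) pl" and ?p2 = "Seq (Assign (Suc (k + 1)) (Var k)) pa"
    let ?body = "Seq (Assign (k + 3) (Join (Var k) (Join (Hd (Var (k + 1))) (Var (k + 2)))))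
      (Seq ps (Seq (Assign (k + 2) (Var (k + 3))) (Assign (k + 1) (Tl (Var (k + 1))))))"
    let ?w = "Loop (Var (k + 1)) ?body"
    let ?p = "Seq ?p1 (Seq ?p2 (Seq ?w (Assign k (Var (k + 2)))))"
    have "computes Os ?p k (\<lambda>x. fold (step x) (entries (l x)) (a x)) ?q"
      unfolding computes_def
    proof
      fix s :: store
      let ?x = "s k" let ?n = "size ?x"
      let ?L = "poly rl ?n" and ?m = "poly g ?n"
      obtain t1 s1 where 1: "exec Os ?p1 s t1 s1" "s1 (Suc (k + 0)) = l ?x"
        "\<And>j. j \<le> k + 0 \<Longrightarrow> s1 j = s j" "t1 \<le> 3 + ?n + poly ql ?n"
        by (rule computes_copy[OF pl, of s]) blast
      obtain t2 s2 where 2: "exec Os ?p2 s1 t2 s2" "s2 (Suc (k + 1)) = a (s1 k)"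
        "\<And>j. j \<le> k + 1 \<Longrightarrow> s2 j = s1 j" "t2 \<le> 3 + size (s1 k) + poly qa (size (s1 k))"
        by (rule computes_copy[OF pa, of s1]) blast
      have "\<exists>t s'. exec Os ?w s2 t s' \<and>
        s' (k + 2) = fold (step ?x) (entries (l ?x)) (a ?x) \<and> (\<forall>j\<le>k. s' j = s2 j) \<and>
        t \<le> length (entries (l ?x)) * (20 + ?n + 3 * ?L + 2 * ?m + poly qs (?n + ?L + ?m + 2)) + (2 + ?L)"
        using 1 2 bound rl by (intro exec_fold[OF ps]) auto
      then obtain t3 s3 where 3: "exec Os ?w s2 t3 s3"
        "s3 (k + 2) = fold (step ?x) (entries (l ?x)) (a ?x)" "\<And>j. j \<le> k \<Longrightarrow> s3 j = s2 j"
        "t3 \<le> length (entries (l ?x)) * (20 + ?n + 3 * ?L + 2 * ?m + poly qs (?n + ?L + ?m + 2)) + (2 + ?L)"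
        by blast
      have c: "20 + ?n + 3 * ?L + 2 * ?m + poly qs (?n + ?L + ?m + 2) = poly ?c ?n"
        by (simp add: poly_pcompose ac_simps)
      have "length (entries (l ?x)) \<le> ?L" using length_entries[of "l ?x"] rl[of ?x] by linarith
      then have "length (entries (l ?x)) * poly ?c ?n \<le> ?L * poly ?c ?n" by (rule mult_le_mono1)
      then have t3: "t3 \<le> ?L * poly ?c ?n + (2 + ?L)" using 3(4) unfolding c by linarith
      have c4: "cost (Var (k + 2)) s3 \<le> 1 + ?m"
        using bound[of ?x "length (entries (l ?x))"] 3(2) by simp
      have "poly ?q ?n = 20 + 2 * ?n + poly ql ?n + poly qa ?n + ?L * poly ?c ?n + ?L + ?m"
        by (simp only: poly_add poly_mult) simp
      moreover have "t2 \<le> 3 + ?n + poly qa ?n" using 2(4) 1(3) by simp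
      ultimately have b: "1 + t1 + (1 + t2 + (1 + t3 + (1 + cost (Var (k + 2)) s3))) \<le> poly ?q ?n"
        using 1(4) t3 c4 by linarith
      from exec.Seq[OF 1(1) exec.Seq[OF 2(1) exec.Seq[OF 3(1) exec.Assign[of Os k "Var (k + 2)" s3]]]]
      show "\<exists>t s'. exec Os ?p s t s' \<and> s' k = fold (step ?x) (entries (l ?x)) (a ?x) \<and>
        (\<forall>j<k. s' j = s j) \<and> t \<le> poly ?q ?n"
        by (rule runI) (use 1(3) 2(3) 3(2,3) b in auto)
    qed
    then show "\<exists>p. computes Os p k (\<lambda>x. fold (step x) (entries (l x)) (a x)) ?q" ..
  qed
qed

text \<open>
  It is enough that each step adds an amount to the accumulator that depends on the argument and on the entry only.
\<close>

lemma polytime_fold: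
  assumes step: "polytime Os (\<lambda>z. step (left z) (left (right z)) (right (right z)))"
    and l: "polytime Os l" and a: "polytime Os a"
    and growth: "\<And>x y b. size (step x y b) \<le> size b + poly g (size x + size y)"
  shows "polytime Os (\<lambda>x. fold (step x) (entries (l x)) (a x))"
proof -
  from l obtain rl where rl: "\<And>x. size (l x) \<le> poly rl (size x)" by (rule polytime_size) blast
  from a obtain ra where ra: "\<And>x. size (a x) \<le> poly ra (size x)" by (rule polytime_size) blast
  \<comment> \<open>\<open>?D\<close> bounds what one step adds; there are at most \<open>rl\<close> steps.\<close>
  let ?D = "pcompose g ([:0, 1:] + rl)"
  have "size (fold (step x) (take i (entries (l x))) (a x)) \<le> poly (ra + rl * ?D) (size x)" for x i
  proof -
    let ?L = "poly rl (size x)" and ?d = "poly ?D (size x)"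
    have gr: "size (step x y b) \<le> size b + ?d" if "size y \<le> ?L" for y b
    proof -
      have "poly g (size x + size y) \<le> poly g (size x + ?L)" using that by (intro poly_nat_mono) simp
      with growth[of x y b] show ?thesis by (simp add: poly_pcompose)
    qed
    have sz: "size (fold (step x) ys b) \<le> size b + length ys * ?d" if "\<forall>y\<in>set ys. size y \<le> ?L" for ys b
      using that
    proof (induction ys arbitrary: b)
      case (Cons y ys)
      have "size (step x y b) \<le> size b + ?d" using Cons.prems gr by simp
      with Cons.IH[of "step x y b"] Cons.prems show ?case by simp
    qed simp
    have "\<forall>y\<in>set (take i (entries (l x))). size y \<le> ?L"
      using size_entries[of _ "l x"] rl[of x] by (meson in_set_takeD order_trans)
    from sz[OF this] have "size (fold (step x) (take i (entries (l x))) (a x))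
        \<le> size (a x) + length (take i (entries (l x))) * ?d" .
    also have "length (take i (entries (l x))) \<le> ?L"
      using length_entries[of "l x"] rl[of x] by simp
    finally show ?thesis using ra[of x] unfolding poly_add poly_mult by simp
  qed
  then show ?thesis by (rule polytime_fold_bounded[OF step l a])
qed

lemma cook_reducible_polytime:
  assumes "polytime Bs f" and "\<And>x. f x \<noteq> Leaf \<longleftrightarrow> x \<in> A"
  shows "cook_reducible A Bs"
proof -
  from assms(1) obtain q where q: "\<And>k. \<exists>p. computes Bs p k f q" by (rule polytimeE) blast
  from q[of 0] obtain p where p: "computes Bs p 0 f q" ..
  have "\<exists>t s. exec Bs p ((\<lambda>_. Leaf)(0 := x)) t s \<and> t \<le> poly q (size x) \<and> (s 0 \<noteq> Leaf \<longleftrightarrow> x \<in> A)" for x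
    using computesE[OF p, of "(\<lambda>_. Leaf)(0 := x)"] assms(2) by (metis fun_upd_same)
  then show ?thesis unfolding cook_reducible_def by blast
qed


text \<open>
  These operations reverse the order of the entries, which is harmless: all lists below
  represent sets, or unary numbers, whose entries are all equal.
\<close>

definition tree_append :: "bintree \<Rightarrow> bintree \<Rightarrow> bintree" where
  "tree_append a b = fold Node (entries a) b"

definition tree_map :: "(bintree \<Rightarrow> bintree) \<Rightarrow> bintree \<Rightarrow> bintree" where
  "tree_map h l = fold (\<lambda>y b. Node (h y) b) (entries l) Leaf"

definition tree_concat_map :: "(bintree \<Rightarrow> bintree) \<Rightarrow> bintree \<Rightarrow> bintree" where
  "tree_concat_map h l = fold (\<lambda>y b. tree_append (h y) b) (entries l) Leaf"

definition tree_filter :: "(bintree \<Rightarrow> bintree) \<Rightarrow> bintree \<Rightarrow> bintree" where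
  "tree_filter P l = fold (\<lambda>y b. if P y \<noteq> Leaf then Node y b else b) (entries l) Leaf"

lemma entries_fold_Node: "entries (fold (\<lambda>y b. Node (h y) b) ys b) = rev (map h ys) @ entries b"
  by (induction ys arbitrary: b) auto

lemma entries_tree_append: "entries (tree_append a b) = rev (entries a) @ entries b"
  using entries_fold_Node[of "\<lambda>x. x" "entries a" b] by (simp add: tree_append_def)

lemma set_tree_append [simp]: "set (entries (tree_append a b)) = set (entries a) \<union> set (entries b)"
  by (simp add: entries_tree_append)

lemma set_tree_map [simp]: "set (entries (tree_map h l)) = h ` set (entries l)"
  by (simp add: tree_map_def entries_fold_Node)

lemma set_tree_concat_map [simp]:
  "set (entries (tree_concat_map h l)) = (\<Union>y\<in>set (entries l). set (entries (h y)))"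
proof -
  have "set (entries (fold (\<lambda>y b. tree_append (h y) b) ys b)) = (\<Union>y\<in>set ys. set (entries (h y))) \<union> set (entries b)"
    for ys b by (induction ys arbitrary: b) auto
  then show ?thesis by (simp add: tree_concat_map_def)
qed

lemma entries_tree_filter: "entries (tree_filter P l) = rev (filter (\<lambda>y. P y \<noteq> Leaf) (entries l))"
proof -
  have "entries (fold (\<lambda>y b. if P y \<noteq> Leaf then Node y b else b) ys b) = rev (filter (\<lambda>y. P y \<noteq> Leaf) ys) @ entries b"
    for ys b by (induction ys arbitrary: b) auto
  then show ?thesis by (simp add: tree_filter_def)
qed

lemma set_tree_filter [simp]: "set (entries (tree_filter P l)) = {y \<in> set (entries l). P y \<noteq> Leaf}"
  by (auto simp: entries_tree_filter)

lemma size_tree_append: "size (tree_append a b) = size a + size b"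
proof (induction a arbitrary: b)
  case (Node y a)
  show ?case using Node.IH(2)[of "Node y b"] by (simp add: tree_append_def)
qed (simp add: tree_append_def)

lemma size_tree_filter: "size (tree_filter P l) \<le> size l"
proof -
  have "size (fold (\<lambda>y b. if P y \<noteq> Leaf then Node y b else b) (entries l) b) \<le> size l + size b" for b
  proof (induction l arbitrary: b)
    case (Node y l)
    show ?case using Node.IH(2)[of b] Node.IH(2)[of "Node y b"] by simp
  qed simp
  from this[of Leaf] show ?thesis by (simp add: tree_filter_def)
qed

lemma polytime_append:
  assumes "polytime Os f" and "polytime Os g"
  shows "polytime Os (\<lambda>x. tree_append (f x) (g x))"
  unfolding tree_append_def
  by (rule polytime_fold[where step="\<lambda>x. Node" and g="[:1, 1:]"])
    (use assms in \<open>auto intro!: polytime_Node polytime_left polytime_right polytime_id\<close>)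

lemma size_pair_bound:
  assumes h: "polytime Os (\<lambda>z. h (left z) (right z))"
  obtains q where "\<And>x y. size (h x y) \<le> poly q (size x + size y)"
proof -
  from h obtain q where q: "\<And>z. size (h (left z) (right z)) \<le> poly q (size z)"
    by (rule polytime_size) blast
  have "size (h x y) \<le> poly (pcompose q [:1, 1:]) (size x + size y)" for x y
    using q[of "Node x y"] by (simp add: poly_pcompose)
  then show ?thesis by (rule that)
qed

lemma polytime_pair_arg:
  assumes h: "polytime Os (\<lambda>z. h (left z) (right z))" and f: "polytime Os f" and g: "polytime Os g"
  shows "polytime Os (\<lambda>x. h (f x) (g x))"
  using polytime_comp[OF polytime_Node[OF f g] h] by simp

lemma polytime_map:
  assumes h: "polytime Os (\<lambda>z. h (left z) (right z))" and l: "polytime Os l"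
  shows "polytime Os (\<lambda>x. tree_map (h x) (l x))"
proof -
  from h obtain q where q: "\<And>x y. size (h x y) \<le> poly q (size x + size y)"
    by (rule size_pair_bound) blast
  show ?thesis
    unfolding tree_map_def
    by (rule polytime_fold[where step="\<lambda>x y b. Node (h x y) b" and g="q + [:1:]"])
      (use q l in \<open>auto intro!: polytime_Node polytime_left polytime_right polytime_id polytime_const
         polytime_pair_arg[OF h] simp: add.commute\<close>)
qed

lemma polytime_concat_map:
  assumes h: "polytime Os (\<lambda>z. h (left z) (right z))" and l: "polytime Os l"
  shows "polytime Os (\<lambda>x. tree_concat_map (h x) (l x))"
proof -
  from h obtain q where q: "\<And>x y. size (h x y) \<le> poly q (size x + size y)"
    by (rule size_pair_bound) blast
  show ?thesis
    unfolding tree_concat_map_def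
    by (rule polytime_fold[where step="\<lambda>x y b. tree_append (h x y) b" and g=q])
      (use q l in \<open>auto intro!: polytime_append polytime_left polytime_right polytime_id polytime_const
         polytime_pair_arg[OF h] simp: size_tree_append\<close>)
qed

lemma polytime_filter:
  assumes h: "polytime Os (\<lambda>z. h (left z) (right z))" and l: "polytime Os l"
  shows "polytime Os (\<lambda>x. tree_filter (h x) (l x))"
  unfolding tree_filter_def
  by (rule polytime_fold[where step="\<lambda>x y b. if h x y \<noteq> Leaf then Node y b else b" and g="[:1, 1:]"])
    (use l in \<open>auto intro!: polytime_if polytime_Node polytime_left polytime_right polytime_id
       polytime_const polytime_pair_arg[OF h]\<close>)

text \<open>
  A function that is iterated may also depend arbitrarily on its previous value if the size of its result is bounded in terms of
  \<open>x\<close> alone.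
\<close>

lemma polytime_iterate:
  assumes h: "polytime Os (\<lambda>z. h (left z) (right z))" and l: "polytime Os l"
    and bound: "\<And>x b. size (h x b) \<le> poly g (size x)"
  shows "polytime Os (\<lambda>x. (h x ^^ length (entries (l x))) Leaf)"
proof -
  have eq: "(h x ^^ length ys) b = fold (\<lambda>y. h x) ys b" for x ys b
    by (induction ys arbitrary: b) (simp_all add: funpow_Suc_right del: funpow.simps(2))
  have "size (h x b) \<le> size b + poly g (size x + size y)" for x y b
    using bound[of x b] poly_nat_mono[of "size x" "size x + size y" g] by linarith
  then have "polytime Os (\<lambda>x. fold (\<lambda>y. h x) (entries (l x)) Leaf)"
    by (intro polytime_fold[where step="\<lambda>x y. h x" and g=g])
      (use l in \<open>auto intro!: polytime_left polytime_right polytime_id polytime_const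
         polytime_pair_arg[OF h]\<close>)
  then show ?thesis unfolding eq .
qed

section \<open>Instances of the acyclic graph word problem\<close>

lemma word_value_Nil [simp]: "word_value K xs [] = \<one>\<^bsub>K\<^esub>"
  and word_value_Cons [simp]: "word_value K xs (l # w) = letter_value K xs l \<otimes>\<^bsub>K\<^esub> word_value K xs w"
  by (simp_all add: word_value_def)

definition valid_word :: "'a list \<Rightarrow> letter list \<Rightarrow> bool" where
  "valid_word xs w \<longleftrightarrow> (\<forall>l\<in>set w. letter_index l < length xs)"

fun valid_label :: "'a list \<Rightarrow> letter option \<Rightarrow> bool" where
  "valid_label xs None \<longleftrightarrow> True"
| "valid_label xs (Some l) \<longleftrightarrow> letter_index l < length xs"

fun label_value :: "('a, 'm) monoid_scheme \<Rightarrow> 'a list \<Rightarrow> letter option \<Rightarrow> 'a" where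
  "label_value K xs None = \<one>\<^bsub>K\<^esub>"
| "label_value K xs (Some l) = letter_value K xs l"

context group
begin

lemma letter_value_closed:
  "set xs \<subseteq> carrier G \<Longrightarrow> letter_index l < length xs \<Longrightarrow> letter_value G xs l \<in> carrier G"
  by (cases l) (auto intro!: inv_closed subsetD[OF _ nth_mem])

lemma label_value_closed:
  "set xs \<subseteq> carrier G \<Longrightarrow> valid_label xs l \<Longrightarrow> label_value G xs l \<in> carrier G"
  by (cases l) (auto simp: letter_value_closed)

lemma word_value_closed:
  "set xs \<subseteq> carrier G \<Longrightarrow> valid_word xs w \<Longrightarrow> word_value G xs w \<in> carrier G"
  by (induction w) (auto simp: letter_value_closed valid_word_def)

lemma word_value_append:
  "set xs \<subseteq> carrier G \<Longrightarrow> valid_word xs v \<Longrightarrow> valid_word xs w \<Longrightarrow>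
   word_value G xs (v @ w) = word_value G xs v \<otimes> word_value G xs w"
  by (induction v) (auto simp: letter_value_closed word_value_closed valid_word_def m_assoc)

lemma generating_word:
  assumes "generating_list G xs" "g \<in> carrier G"
  obtains w where "valid_word xs w" "word_value G xs w = g"
proof -
  have xs: "set xs \<subseteq> carrier G" and "g \<in> generate G (set xs)"
    using assms by (auto simp: generating_list_def)
  from this(2) have "\<exists>w. valid_word xs w \<and> word_value G xs w = g"
  proof (induction rule: generate.induct)
    case one
    show ?case by (intro exI[of _ "[]"]) (simp add: valid_word_def)
  next
    case (incl h)
    then obtain i where "i < length xs" "h = xs ! i" by (auto simp: in_set_conv_nth)
    then show ?case using subsetD[OF xs incl] by (intro exI[of _ "[Pos i]"]) (auto simp: valid_word_def)
  next
    case (inv h)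
    then obtain i where "i < length xs" "h = xs ! i" by (auto simp: in_set_conv_nth)
    then show ?case using subsetD[OF xs inv] by (intro exI[of _ "[Neg i]"]) (auto simp: valid_word_def)
  next
    case (eng g h)
    then obtain v w where "valid_word xs v" "word_value G xs v = g" "valid_word xs w" "word_value G xs w = h"
      by blast
    then show ?case using xs
      by (intro exI[of _ "v @ w"]) (auto simp: word_value_append valid_word_def)
  qed
  then show ?thesis using that by blast
qed

end

definition adjacency :: "(nat \<times> letter option \<times> nat) list \<Rightarrow> (nat \<times> nat) set" where
  "adjacency es = (\<lambda>(u, l, v). (u, v)) ` set es"

lemma arcs_ends_digraph_of: "arcs_ends (digraph_of \<Gamma>) = adjacency (edges \<Gamma>)"
proof -
  have "arcs_ends (digraph_of \<Gamma>) = (\<lambda>i. (\<lambda>(u, l, v). (u, v)) (edges \<Gamma> ! i)) ` {..<length (edges \<Gamma>)}"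
    by (auto simp: arcs_ends_def arc_to_ends_def digraph_of_def split_beta)
  also have "\<dots> = adjacency (edges \<Gamma>)"
  proof -
    have "set (edges \<Gamma>) = (!) (edges \<Gamma>) ` {..<length (edges \<Gamma>)}"
      by (auto simp: set_conv_nth)
    then show ?thesis by (simp add: adjacency_def image_image)
  qed
  finally show ?thesis .
qed

text \<open>
  Whether a graph is an instance, and its answer, depend only on the set of its edges. Their positions in the
  list, by which they are identified as arcs, are eliminated here and in \<open>agwp_answer_iff\<close>.
\<close>

lemma agwp_instance_iff:
  "agwp_instance xs \<Gamma> \<longleftrightarrow>
     (\<forall>(u, l, v) \<in> set (edges \<Gamma>). u < vertex_count \<Gamma> \<and> v < vertex_count \<Gamma> \<and> valid_label xs l) \<and>
     acyclic (adjacency (edges \<Gamma>)) \<and> \<alpha> \<Gamma> < vertex_count \<Gamma> \<and> \<omega> \<Gamma> < vertex_count \<Gamma>"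
proof -
  let ?es = "edges \<Gamma>" and ?n = "vertex_count \<Gamma>"
  have "fin_digraph (digraph_of \<Gamma>) \<longleftrightarrow> (\<forall>i<length ?es. fst (?es ! i) < ?n \<and> snd (snd (?es ! i)) < ?n)"
    by (auto simp: fin_digraph_def wf_digraph_def fin_digraph_axioms_def digraph_of_def)
  moreover have "(\<forall>l\<in>set (edge_label \<Gamma> i). letter_index l < length xs) \<longleftrightarrow> valid_label xs (fst (snd (?es ! i)))" for i
    by (cases "fst (snd (?es ! i))") (auto simp: edge_label_def)
  moreover have "(\<forall>(u, l, v) \<in> set ?es. u < ?n \<and> v < ?n \<and> valid_label xs l) \<longleftrightarrow>
    (\<forall>i<length ?es. fst (?es ! i) < ?n \<and> snd (snd (?es ! i)) < ?n \<and> valid_label xs (fst (snd (?es ! i))))"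
    unfolding all_set_conv_all_nth split_beta by auto
  ultimately show ?thesis
    unfolding agwp_instance_def arcs_ends_digraph_of by (auto simp: digraph_of_def)
qed

lemma (in group) agwp_answer_iff:
  assumes xs: "set xs \<subseteq> carrier G" and inst: "agwp_instance xs \<Gamma>"
  shows "agwp_answer G xs \<Gamma> \<longleftrightarrow>
    reaches G (relabel (label_value G xs) (set (edges \<Gamma>))) (\<alpha> \<Gamma>) \<one> (\<omega> \<Gamma>)"
proof -
  let ?A = "relabel (label_value G xs) (set (edges \<Gamma>))" and ?es = "edges \<Gamma>" and ?D = "digraph_of \<Gamma>"
  interpret D: pre_digraph ?D .
  have valid: "valid_label xs l" if "(u, l, v) \<in> set ?es" for u l v
    using inst that unfolding agwp_instance_iff by blast
  have closed: "?A \<subseteq> UNIV \<times> carrier G \<times> UNIV"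
    using valid xs by (auto simp: in_relabel label_value_closed)
  have D: "i \<in> arcs ?D \<longleftrightarrow> i < length ?es" "tail ?D i = fst (?es ! i)" "head ?D i = snd (snd (?es ! i))" for i
    by (simp_all add: digraph_of_def)
  have lab: "word_value G xs (edge_label \<Gamma> i @ w) = label_value G xs (fst (snd (?es ! i))) \<otimes> word_value G xs w"
    if "i < length ?es" "word_value G xs w \<in> carrier G" for i w
    using that by (cases "fst (snd (?es ! i))") (auto simp: edge_label_def)
  have edge: "(tail ?D i, label_value G xs (fst (snd (?es ! i))), head ?D i) \<in> ?A" if "i < length ?es" for i
  proof -
    obtain u l v where e: "?es ! i = (u, l, v)" by (cases "?es ! i") auto
    with nth_mem[OF that] have "(u, l, v) \<in> set ?es" by simp
    then show ?thesis by (simp add: digraph_of_def e relabelI)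
  qed
  have walk: "reaches G ?A u (word_value G xs (path_label \<Gamma> p)) v"
    if "D.cas u p v" "set p \<subseteq> arcs ?D" for u p v
    using that
  proof (induction p arbitrary: u)
    case Nil
    then show ?case by (simp add: path_label_def reaches.refl)
  next
    case (Cons i p)
    then have i: "i < length ?es" "tail ?D i = u" and r: "reaches G ?A (head ?D i) (word_value G xs (path_label \<Gamma> p)) v"
      by (auto simp: D(1))
    from reaches_closed[OF r closed] have "word_value G xs (path_label \<Gamma> p) \<in> carrier G" .
    with lab[OF i(1), of "path_label \<Gamma> p"] show ?case
      using reaches.step[OF edge[OF i(1)] r] i(2) by (simp add: path_label_def)
  qed
  have conv: "\<exists>p. D.cas u p v \<and> set p \<subseteq> arcs ?D \<and> word_value G xs (path_label \<Gamma> p) = g"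
    if "reaches G ?A u g v" for u g v
    using that
  proof (induction rule: reaches.induct)
    case (refl u)
    show ?case by (intro exI[of _ "[]"]) (simp add: path_label_def)
  next
    case (step u a v b w)
    then obtain p where p: "D.cas v p w" "set p \<subseteq> arcs ?D" "word_value G xs (path_label \<Gamma> p) = b" by blast
    from step.hyps(1) obtain l where l: "(u, l, v) \<in> set ?es" "a = label_value G xs l" by (auto simp: in_relabel)
    then obtain i where i: "i < length ?es" "?es ! i = (u, l, v)" by (auto simp: in_set_conv_nth)
    have "b \<in> carrier G" using reaches_closed[OF step.hyps(2) closed] .
    with lab[OF i(1), of "path_label \<Gamma> p"] p l i show ?case
      by (intro exI[of _ "i # p"]) (auto simp: path_label_def D)
  qed
  have "\<alpha> \<Gamma> \<in> verts ?D" using inst by (simp add: agwp_instance_def)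
  then show ?thesis unfolding agwp_answer_def D.awalk_def using walk conv by metis
qed

text \<open>
  The number of predecessors in the transitive closure is a rank.
\<close>

lemma acyclic_rank:
  fixes r :: "('v \<times> 'v) set"
  assumes "finite r" "acyclic r"
  obtains rank :: "'v \<Rightarrow> nat" where "\<And>u v. (u, v) \<in> r \<Longrightarrow> rank u < rank v"
proof (rule that)
  fix u v assume uv: "(u, v) \<in> r"
  have fin: "finite {w. (w, z) \<in> r\<^sup>+}" for z
    by (rule finite_subset[of _ "fst ` r\<^sup>+"]) (use assms(1) in \<open>force+\<close>)
  have "{w. (w, u) \<in> r\<^sup>+} \<subset> {w. (w, v) \<in> r\<^sup>+}"
    using uv assms(2) by (auto simp: acyclic_def intro: trancl_into_trancl)
  then show "card {w. (w, u) \<in> r\<^sup>+} < card {w. (w, v) \<in> r\<^sup>+}"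
    by (rule psubset_card_mono[OF fin])
qed

lemma rank_acyclic:
  fixes rank :: "'v \<Rightarrow> nat"
  assumes "\<And>u v. (u, v) \<in> r \<Longrightarrow> rank u < rank v"
  shows "acyclic r"
proof -
  have "rank u < rank v" if "(u, v) \<in> r\<^sup>+" for u v
    using that by induction (auto dest: assms)
  then show ?thesis unfolding acyclic_def by blast
qed

fun move_edge :: "('v \<Rightarrow> 'w) \<Rightarrow> 'v \<times> 'x \<times> 'v \<Rightarrow> 'w \<times> 'x \<times> 'w" where
  "move_edge f (u, x, v) = (f u, x, f v)"

lemma reaches_move:
  assumes inj: "inj_on f D" and A: "A \<subseteq> D \<times> UNIV \<times> D" and "u \<in> D" "v \<in> D"
  shows "reaches K (move_edge f ` A) (f u) g (f v) \<longleftrightarrow> reaches K A u g v"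
proof
  assume "reaches K A u g v"
  then show "reaches K (move_edge f ` A) (f u) g (f v)"
  proof (induction rule: reaches.induct)
    case (step u a v b w)
    from imageI[OF step.hyps(1), of "move_edge f"] step.IH show ?case by (auto intro: reaches.step)
  qed (rule reaches.refl)
next
  assume "reaches K (move_edge f ` A) (f u) g (f v)"
  then show "reaches K A u g v"
    using assms(3,4)
  proof (induction "f u" g "f v" arbitrary: u rule: reaches.induct)
    case refl
    then have "u = v" using inj by (auto dest: inj_onD)
    then show ?case by (simp add: reaches.refl)
  next
    case (step a y b)
    then obtain u' v' where e: "(u', a, v') \<in> A" "f u = f u'" "y = f v'" by auto
    then have "u' = u" "v' \<in> D" using A inj step.prems by (auto dest: inj_onD)
    then show ?case using e step by (auto intro: reaches.step)
  qed
qed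

lemma AGWP_iff:
  assumes "group K" "set xs \<subseteq> carrier K"
  shows "x \<in> AGWP K xs \<longleftrightarrow> (\<exists>n es a b.
     x = Node (enc_nat n) (Node (enc_list enc_edge es) (Node (enc_nat a) (enc_nat b))) \<and>
     (\<forall>(u, l, v) \<in> set es. u < n \<and> v < n \<and> valid_label xs l) \<and> acyclic (adjacency es) \<and> a < n \<and> b < n \<and>
     reaches K (relabel (label_value K xs) (set es)) a \<one>\<^bsub>K\<^esub> b)" (is "_ \<longleftrightarrow> (\<exists>n es a b. ?P n es a b)")
proof
  assume "x \<in> AGWP K xs"
  then obtain \<Gamma> where g: "x = enc_graph \<Gamma>" "agwp_instance xs \<Gamma>" "agwp_answer K xs \<Gamma>" by (auto simp: AGWP_def)
  have "?P (vertex_count \<Gamma>) (edges \<Gamma>) (\<alpha> \<Gamma>) (\<omega> \<Gamma>)"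
    using g group.agwp_answer_iff[OF assms g(2)] by (simp add: enc_graph_def agwp_instance_iff)
  then show "\<exists>n es a b. ?P n es a b" by blast
next
  assume "\<exists>n es a b. ?P n es a b"
  then obtain n es a b where P: "?P n es a b" by blast
  let ?\<Gamma> = "\<lparr>vertex_count = n, edges = es, \<alpha> = a, \<omega> = b\<rparr>"
  have i: "agwp_instance xs ?\<Gamma>" using P by (simp add: agwp_instance_iff)
  have "agwp_answer K xs ?\<Gamma>" using P group.agwp_answer_iff[OF assms i] by simp
  moreover have "x = enc_graph ?\<Gamma>" using P by (simp add: enc_graph_def)
  ultimately show "x \<in> AGWP K xs" using i by (auto simp: AGWP_def)
qed

section \<open>Queries to a factor\<close>

type_synonym mixed_word = "(letter + letter) list"
type_synonym slot = "mixed_word \<times> mixed_word"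

text \<open>
  The edges over one factor of the refined instance. Its vertices are pairs \<open>(v, q)\<close> of a vertex of the instance and a
  suffix \<open>q\<close> of a word that spells a label; being at \<open>(v, q)\<close> means that \<open>q\<close> has still to be read before \<open>v\<close> is
  reached. An edge from \<open>u\<close> to \<open>v\<close> with label \<open>l\<close> becomes an empty edge from \<open>(u, [])\<close> to \<open>(v, zw l)\<close>. The words
  mix letters of both factors; \<open>e\<close> is the embedding of the letters of one factor, so that only those are read.
\<close>

definition base_edges ::
    "('g, 'm) monoid_scheme \<Rightarrow> 'g list \<Rightarrow> (letter \<Rightarrow> letter + letter) \<Rightarrow> nat \<Rightarrow> mixed_word set \<Rightarrow>
     (letter option \<Rightarrow> mixed_word) \<Rightarrow> (nat \<times> letter option \<times> nat) set \<Rightarrow>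
     ((nat \<times> mixed_word) \<times> 'g \<times> (nat \<times> mixed_word)) set" where
  "base_edges K ks e n Q zw E =
     {((v, e l # q), letter_value K ks l, (v, q)) | v l q. v < n \<and> e l # q \<in> Q} \<union>
     {((u, []), \<one>\<^bsub>K\<^esub>, (v, zw l)) | u l v. (u, l, v) \<in> E}"

lemma base_letterI:
  "v < n \<Longrightarrow> e l # q \<in> Q \<Longrightarrow> ((v, e l # q), letter_value K ks l, (v, q)) \<in> base_edges K ks e n Q zw E"
  and base_epsI: "(u, l', v) \<in> E \<Longrightarrow> ((u, []), \<one>\<^bsub>K\<^esub>, (v, zw l')) \<in> base_edges K ks e n Q zw E"
  unfolding base_edges_def by blast+

lemma base_edgesE:
  assumes "(a, g, b) \<in> base_edges K ks e n Q zw E"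
  obtains (letter) v l q where "a = (v, e l # q)" "b = (v, q)" "g = letter_value K ks l" "v < n" "e l # q \<in> Q"
    | (eps) u l v where "a = (u, [])" "b = (v, zw l)" "g = \<one>\<^bsub>K\<^esub>" "(u, l, v) \<in> E"
  using assms by (auto simp: base_edges_def)

text \<open>
  In a query, a second word \<open>s\<close> is pending at a vertex \<open>(v, q)\<close>, and is read before \<open>q\<close>. It is kept apart from \<open>q\<close>, because
  in the concatenation one could not tell at which vertices shortcuts may start.
\<close>

definition slot_steps :: "(slot \<times> (letter + letter) \<times> slot) set" where
  "slot_steps = {((x # s, q), x, (s, q)) | x s q. True} \<union> {(([], x # q), x, ([], q)) | x q. True}"

lemma slot_stepE:
  assumes "(d, y, d') \<in> slot_steps"
  obtains (pending) s q where "d = (y # s, q)" "d' = (s, q)"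
    | (suffix) q where "d = ([], y # q)" "d' = ([], q)"
  using assms by (auto simp: slot_steps_def)

lemma slot_step_pending: "((x # s, q), x, (s, q)) \<in> slot_steps"
  and slot_step_suffix: "(([], x # q), x, ([], q)) \<in> slot_steps"
  by (simp_all add: slot_steps_def)

text \<open>
  A shortcut \<open>((u, p), c, (v, q))\<close> becomes an empty edge to the vertex over \<open>(v, q)\<close> at which a word \<open>wC c\<close> for \<open>c\<close> is pending. In
  this way one set of vertices serves all sets of shortcuts, and these vertices are numbered arithmetically.
\<close>

definition query_edges ::
    "(letter \<Rightarrow> letter + letter) \<Rightarrow> ('c \<Rightarrow> letter list) \<Rightarrow> nat \<Rightarrow> slot set \<Rightarrow>
     (letter option \<Rightarrow> mixed_word) \<Rightarrow> (nat \<times> letter option \<times> nat) set \<Rightarrow>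
     ((nat \<times> mixed_word) \<times> 'c \<times> (nat \<times> mixed_word)) set \<Rightarrow>
     ((nat \<times> slot) \<times> letter option \<times> (nat \<times> slot)) set" where
  "query_edges e wC n D zw E S =
     {((v, d), Some l, (v, d')) | v d l d'. v < n \<and> d \<in> D \<and> d' \<in> D \<and> (d, e l, d') \<in> slot_steps} \<union>
     {((u, ([], [])), None, (v, ([], zw l))) | u l v. (u, l, v) \<in> E} \<union>
     {((u, ([], p)), None, (v, (map e (wC c), q))) | u p c v q. ((u, p), c, (v, q)) \<in> S}"

text \<open>
  The query for one factor \<open>K\<close> with generators \<open>ks\<close>, into which \<open>C\<close> embeds by \<open>\<kappa>\<close>. \<open>P\<close> and \<open>Q\<close> contain the pending words and the suffixes
  of the words for the labels; \<open>idx\<close> numbers the pairs from \<open>P \<times> Q\<close> below \<open>k\<close>.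
\<close>

locale query_graph = group K for K :: "('g, 'm) monoid_scheme" (structure) +
  fixes ks :: "'g list" and e :: "letter \<Rightarrow> letter + letter" and \<kappa> :: "'c \<Rightarrow> 'g"
    and wC :: "'c \<Rightarrow> letter list" and Cs :: "'c set" and n :: nat
    and E :: "(nat \<times> letter option \<times> nat) set" and zw :: "letter option \<Rightarrow> mixed_word"
    and P Q :: "mixed_word set" and S :: "((nat \<times> mixed_word) \<times> 'c \<times> (nat \<times> mixed_word)) set"
    and rank :: "nat \<times> mixed_word \<Rightarrow> nat" and idx :: "slot \<Rightarrow> nat" and k :: nat
  assumes e_inj: "inj e" and ks: "set ks \<subseteq> carrier K"
    and Q_valid: "e l # q \<in> Q \<Longrightarrow> letter_index l < length ks"
    and wC: "c \<in> Cs \<Longrightarrow> valid_word ks (wC c) \<and> word_value K ks (wC c) = \<kappa> c \<and> map e (wC c) \<in> P"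
    and P_valid: "e l # s \<in> P \<Longrightarrow> letter_index l < length ks"
    and P_suffix: "x # s \<in> P \<Longrightarrow> s \<in> P" and P_nil: "[] \<in> P" and P_fin: "finite P"
    and Q_suffix: "x # q \<in> Q \<Longrightarrow> q \<in> Q" and Q_nil: "[] \<in> Q"
    and E: "(u, l', v) \<in> E \<Longrightarrow> u < n \<and> v < n \<and> zw l' \<in> Q"
    and S: "((u, p), c, (v, q)) \<in> S \<Longrightarrow> c \<in> Cs \<and> u < n \<and> v < n \<and> p \<in> Q \<and> q \<in> Q"
    and rank: "(a, g, b) \<in> base_edges K ks e n Q zw E \<union> relabel \<kappa> S \<Longrightarrow> rank a < rank b"
    and idx_inj: "inj_on idx (P \<times> Q)" and idx_less: "d \<in> P \<times> Q \<Longrightarrow> idx d < k"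
begin

abbreviation "base \<equiv> base_edges K ks e n Q zw E"
abbreviation "query \<equiv> query_edges e wC n (P \<times> Q) zw E S"
abbreviation "query_val \<equiv> relabel (label_value K ks) query"

lemma query_valid: "(a, l, b) \<in> query \<Longrightarrow>
    a \<in> {..<n} \<times> (P \<times> Q) \<and> b \<in> {..<n} \<times> (P \<times> Q) \<and> valid_label ks l"
  using E S wC P_nil Q_nil P_valid Q_valid
  by (auto simp: query_edges_def elim!: slot_stepE)

lemma query_cases:
  assumes "(x, l', y) \<in> query"
  obtains (letter) v d l d' where "x = (v, d)" "y = (v, d')" "l' = Some l" "v < n" "d \<in> P \<times> Q"
      "(d, e l, d') \<in> slot_steps"
    | (eps) u l v where "x = (u, ([], []))" "y = (v, ([], zw l))" "l' = None" "(u, l, v) \<in> E"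
    | (short) u p c v q where "x = (u, ([], p))" "y = (v, (map e (wC c), q))" "l' = None" "((u, p), c, (v, q)) \<in> S"
  using assms unfolding query_edges_def
proof (elim UnE CollectE exE conjE)
  fix v d l d'
  assume "(x, l', y) = ((v, d), Some l, (v, d'))" "v < n" "d \<in> P \<times> Q" "(d, e l, d') \<in> slot_steps"
  then show thesis by (intro letter[of v d d' l]) simp_all
next
  fix u l v
  assume "(x, l', y) = ((u, ([], [])), None, (v, ([], zw l)))" "(u, l, v) \<in> E"
  then show thesis by (intro eps[of u v l]) simp_all
next
  fix u p c v q
  assume "(x, l', y) = ((u, ([], p)), None, (v, (map e (wC c), q)))" "((u, p), c, (v, q)) \<in> S"
  then show thesis by (intro short[of u p v c q]) simp_all
qed

lemma query_val_closed: "query_val \<subseteq> UNIV \<times> carrier K \<times> UNIV"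
  using query_valid label_value_closed[OF ks] by (fastforce simp: in_relabel)

lemma base_closed: "base \<subseteq> UNIV \<times> carrier K \<times> UNIV"
  using letter_value_closed[OF ks] Q_valid by (fastforce simp: base_edges_def)

lemma \<kappa>_closed: "c \<in> Cs \<Longrightarrow> \<kappa> c \<in> carrier K"
  using wC word_value_closed[OF ks] by metis

lemma all_closed: "base \<union> relabel \<kappa> S \<subseteq> UNIV \<times> carrier K \<times> UNIV"
  using base_closed S \<kappa>_closed by (auto simp: in_relabel)

lemma read_pending:
  assumes "u < n" "p \<in> Q"
  shows "map e s \<in> P \<Longrightarrow> reaches K query_val (u, (map e s, p)) (word_value K ks s) (u, ([], p))"
proof (induction s)
  case (Cons l s)
  then have s: "map e s \<in> P" using P_suffix by auto
  have "((u, (map e (l # s), p)), Some l, (u, (map e s, p))) \<in> query"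
    using assms Cons.prems s by (auto simp: query_edges_def intro: slot_step_pending)
  from relabelI[OF this, of "label_value K ks"] show ?case
    using reaches.step[OF _ Cons.IH[OF s]] by simp
qed (simp add: reaches.refl)

text \<open>
  A shortcut is simulated by its empty edge and then reading the pending word.
\<close>

lemma query_complete:
  assumes "reaches K (base \<union> relabel \<kappa> S) a g b"
  shows "reaches K query_val (fst a, ([], snd a)) g (fst b, ([], snd b))"
  using assms
proof (induction rule: reaches.induct)
  case (refl a)
  show ?case by (rule reaches.refl)
next
  case (step a x b g c)
  from step.hyps(1) consider
    (letter) v l q where "a = (v, e l # q)" "b = (v, q)" "x = letter_value K ks l" "v < n" "e l # q \<in> Q"
  | (eps) u l v where "a = (u, [])" "b = (v, zw l)" "x = \<one>" "(u, l, v) \<in> E"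
  | (short) u p d v q where "a = (u, p)" "b = (v, q)" "x = \<kappa> d" "((u, p), d, (v, q)) \<in> S"
    by (cases a; cases b) (auto simp: base_edges_def in_relabel)
  then show ?case
  proof cases
    case letter
    then have "((v, ([], e l # q)), Some l, (v, ([], q))) \<in> query"
      using P_nil Q_suffix by (auto simp: query_edges_def intro: slot_step_suffix)
    from relabelI[OF this, of "label_value K ks"] letter step.IH show ?thesis
      by (auto intro: reaches.step)
  next
    case eps
    then have "((u, ([], [])), None, (v, ([], zw l))) \<in> query"
      by (auto simp: query_edges_def)
    from relabelI[OF this, of "label_value K ks"] eps step.IH show ?thesis
      by (auto intro: reaches.step)
  next
    case short
    then have "((u, ([], p)), None, (v, (map e (wC d), q))) \<in> query"
      unfolding query_edges_def by blast
    from relabelI[OF this, of "label_value K ks"]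
    have 1: "((u, ([], p)), \<one>, (v, (map e (wC d), q))) \<in> query_val" by simp
    have d: "d \<in> Cs" "v < n" "q \<in> Q" using S[OF short(4)] by auto
    have r: "reaches K query_val (v, (map e (wC d), q)) (\<kappa> d) (v, ([], q))"
      using read_pending[OF d(2,3), of "wC d"] wC[OF d(1)] by auto
    have r2: "reaches K query_val (v, ([], q)) g (fst c, ([], snd c))" using step.IH short by simp
    from reaches.step[OF 1 reaches_trans[OF r r2 query_val_closed]]
    have "reaches K query_val (u, ([], p)) (\<one> \<otimes> (\<kappa> d \<otimes> g)) (fst c, ([], snd c))" .
    moreover have "g \<in> carrier K" using reaches_closed[OF r2 query_val_closed] .
    ultimately show ?thesis using short \<kappa>_closed[OF d(1)] by simp
  qed
qed

text \<open>
  Conversely, a path can leave a vertex with a pending word only by reading it.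
\<close>

lemma query_sound:
  assumes "reaches K query_val x g y"
  shows "x = (u, (map e s, p)) \<Longrightarrow> y = (v, ([], q)) \<Longrightarrow> valid_word ks s \<Longrightarrow>
    \<exists>h. reaches K (base \<union> relabel \<kappa> S) (u, p) h (v, q) \<and> g = word_value K ks s \<otimes> h"
  using assms
proof (induction arbitrary: u s p rule: reaches.induct)
  case (refl a)
  then have "s = []" "u = v" "p = q" by auto
  then show ?case using reaches.refl[of K "base \<union> relabel \<kappa> S" "(v, q)"]
    by (intro exI[of _ \<one>]) simp
next
  case (step x a x' g y)
  from step.hyps(1) obtain l' where l': "a = label_value K ks l'" "(x, l', x') \<in> query" by (auto simp: in_relabel)
  from l'(2) show ?case
  proof (cases rule: query_cases)
    case (letter w d l d')
    from letter(6) show ?thesis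
    proof (cases rule: slot_stepE)
      case (pending s' q')
      then obtain s2 where s: "s = l # s2" "s' = map e s2"
        using letter step.prems(1) e_inj by (cases s) (auto dest: injD)
      have "x' = (u, (map e s2, p))" "valid_word ks s2" "letter_index l < length ks"
        using pending letter step.prems s by (auto simp: valid_word_def)
      with step.IH[OF this(1) step.prems(2) this(2)] obtain h where
        h: "reaches K (base \<union> relabel \<kappa> S) (u, p) h (v, q)" "g = word_value K ks s2 \<otimes> h" by blast
      have "h \<in> carrier K" using reaches_closed[OF h(1) all_closed] .
      then have "a \<otimes> g = word_value K ks s \<otimes> h"
        using l'(1) letter(3) s(1) h(2) letter_value_closed[OF ks \<open>letter_index l < length ks\<close>]
          word_value_closed[OF ks \<open>valid_word ks s2\<close>] by (simp add: m_assoc)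
      with h(1) show ?thesis by blast
    next
      case (suffix q')
      then have s: "s = []" and p: "p = e l # q'" using letter step.prems(1) by auto
      have "x' = (u, (map e [], q'))" "valid_word ks []"
        using suffix letter step.prems s by (auto simp: valid_word_def)
      from step.IH[OF this(1) step.prems(2) this(2)] obtain h where
        h: "reaches K (base \<union> relabel \<kappa> S) (u, q') h (v, q)" "g = \<one> \<otimes> h"
        unfolding word_value_Nil by blast
      have hc: "h \<in> carrier K" using reaches_closed[OF h(1) all_closed] .
      have "((u, p), a, (u, q')) \<in> base"
        using letter suffix p l'(1) step.prems(1) by (auto simp: base_edges_def)
      then have 1: "((u, p), a, (u, q')) \<in> base \<union> relabel \<kappa> S" by blast
      then have "a \<in> carrier K" using subsetD[OF all_closed 1] by simp
      then have "a \<otimes> g = word_value K ks s \<otimes> (a \<otimes> h)" using h(2) hc s by simp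
      then show ?thesis using reaches.step[OF 1 h(1)] by blast
    qed
  next
    case (eps w l v')
    then have s: "s = []" "p = []" "w = u" using step.prems(1) by auto
    have "x' = (v', (map e [], zw l))" "valid_word ks []" using eps by (auto simp: valid_word_def)
    from step.IH[OF this(1) step.prems(2) this(2)] obtain h where
      h: "reaches K (base \<union> relabel \<kappa> S) (v', zw l) h (v, q)" "g = \<one> \<otimes> h"
      unfolding word_value_Nil by blast
    have hc: "h \<in> carrier K" using reaches_closed[OF h(1) all_closed] .
    have "((u, p), \<one>, (v', zw l)) \<in> base \<union> relabel \<kappa> S" using eps s by (auto simp: base_edges_def)
    from reaches.step[OF this h(1)] have "reaches K (base \<union> relabel \<kappa> S) (u, p) (\<one> \<otimes> h) (v, q)" .
    moreover have "a \<otimes> g = word_value K ks s \<otimes> (\<one> \<otimes> h)" using h(2) hc s l'(1) eps(3) by simp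
    ultimately show ?thesis by blast
  next
    case (short w p' d v' q')
    then have s: "s = []" "p = p'" "w = u" using step.prems(1) by auto
    have d: "d \<in> Cs" using S[OF short(4)] by auto
    have w: "valid_word ks (wC d)" "word_value K ks (wC d) = \<kappa> d" using wC[OF d] by auto
    from step.IH[OF short(2) step.prems(2) w(1)] obtain h where
      h: "reaches K (base \<union> relabel \<kappa> S) (v', q') h (v, q)" "g = \<kappa> d \<otimes> h"
      unfolding w(2) by blast
    have hc: "h \<in> carrier K" using reaches_closed[OF h(1) all_closed] .
    have "((u, p), \<kappa> d, (v', q')) \<in> base \<union> relabel \<kappa> S" using short s by (auto simp: in_relabel)
    from reaches.step[OF this h(1)] have "reaches K (base \<union> relabel \<kappa> S) (u, p) (\<kappa> d \<otimes> h) (v, q)" .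
    moreover have "a \<otimes> g = word_value K ks s \<otimes> (\<kappa> d \<otimes> h)"
      using h(2) hc s l'(1) short(3) \<kappa>_closed[OF d] by simp
    ultimately show ?thesis by blast
  qed
qed

text \<open>
  Pending words at the start vertex are used to ask for values other than the identity.
\<close>

lemma query_reaches_iff:
  assumes "u < n" "p \<in> Q" "valid_word ks s" "map e s \<in> P"
  shows "reaches K query_val (u, (map e s, p)) \<one> (v, ([], q)) \<longleftrightarrow>
    reaches K (base \<union> relabel \<kappa> S) (u, p) (inv (word_value K ks s)) (v, q)"
proof
  have ws: "word_value K ks s \<in> carrier K" using word_value_closed[OF ks assms(3)] .
  assume "reaches K query_val (u, (map e s, p)) \<one> (v, ([], q))"
  from query_sound[OF this HOL.refl HOL.refl assms(3)] obtain h where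
    h: "reaches K (base \<union> relabel \<kappa> S) (u, p) h (v, q)" "\<one> = word_value K ks s \<otimes> h" by blast
  moreover have "h \<in> carrier K" using reaches_closed[OF h(1) all_closed] .
  ultimately have "h = inv (word_value K ks s)" using ws by (metis inv_equality inv_comm)
  with h show "reaches K (base \<union> relabel \<kappa> S) (u, p) (inv (word_value K ks s)) (v, q)" by simp
next
  have ws: "word_value K ks s \<in> carrier K" using word_value_closed[OF ks assms(3)] .
  assume "reaches K (base \<union> relabel \<kappa> S) (u, p) (inv (word_value K ks s)) (v, q)"
  from query_complete[OF this]
  have "reaches K query_val (u, ([], p)) (inv (word_value K ks s)) (v, ([], q))" by simp
  from reaches_trans[OF read_pending[OF assms(1,2,4)] this query_val_closed]
  show "reaches K query_val (u, (map e s, p)) \<one> (v, ([], q))" using ws by simp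
qed

definition num :: "nat \<times> slot \<Rightarrow> nat" where
  "num a = fst a * k + idx (snd a)"

lemma num_inj: "inj_on num ({..<n} \<times> (P \<times> Q))"
proof (rule inj_onI)
  fix x y assume xy: "x \<in> {..<n} \<times> (P \<times> Q)" "y \<in> {..<n} \<times> (P \<times> Q)" "num x = num y"
  obtain u d v d' where e: "x = (u, d)" "y = (v, d')" by (metis surj_pair)
  from xy e have a: "d \<in> P \<times> Q" "d' \<in> P \<times> Q" by auto
  then have l: "idx d < k" "idx d' < k" using idx_less by auto
  have eq: "u * k + idx d = v * k + idx d'" using xy(3) e by (simp add: num_def)
  then have "(u * k + idx d) div k = (v * k + idx d') div k" by simp
  then have uv: "u = v" using l by simp
  then have "idx d = idx d'" using eq by simp
  then have "d = d'" using inj_onD[OF idx_inj _ a] by simp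
  with uv e show "x = y" by simp
qed

lemma num_less:
  assumes "a \<in> {..<n} \<times> (P \<times> Q)" shows "num a < n * k"
proof -
  have "fst a * k + idx (snd a) < fst a * k + k" using idx_less assms by auto
  also have "\<dots> = Suc (fst a) * k" by simp
  also have "\<dots> \<le> n * k" using assms by (intro mult_le_mono1) auto
  finally show ?thesis by (simp add: num_def)
qed

text \<open>
  Lexicographic: first the rank of the vertex of the refined instance, then how much of the pending word has been read.
\<close>

definition query_rank :: "nat \<times> slot \<Rightarrow> nat" where
  "query_rank = (\<lambda>(v, s, q). rank (v, q) * Suc (Max (length ` P)) + (Max (length ` P) - length s))"

lemma query_rank: "(a, l, b) \<in> query \<Longrightarrow> query_rank a < query_rank b"
proof -
  let ?L = "Suc (Max (length ` P))"
  have len: "length s \<le> Max (length ` P)" if "s \<in> P" for s using that P_fin by (intro Max_ge) auto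
  have up: "query_rank (u, s, p) < query_rank (v, s', q)" if "rank (u, p) < rank (v, q)" for u s p v s' q
  proof -
    have "rank (u, p) * ?L + (Max (length ` P) - length s) < Suc (rank (u, p)) * ?L" by simp
    also have "\<dots> \<le> rank (v, q) * ?L" using that by (intro mult_le_mono1) simp
    finally show ?thesis by (simp add: query_rank_def)
  qed
  assume "(a, l, b) \<in> query"
  then show "query_rank a < query_rank b"
  proof (cases rule: query_cases)
    case (letter v d l d')
    from letter(6) show ?thesis
    proof (cases rule: slot_stepE)
      case (pending s q)
      then have "Suc (length s) \<le> Max (length ` P)" using len[of "e l # s"] letter by auto
      then show ?thesis using letter pending by (simp add: query_rank_def)
    next
      case (suffix q)
      then have "((v, e l # q), letter_value K ks l, (v, q)) \<in> base" using letter by (auto simp: base_edges_def)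
      from up[OF rank[OF UnI1, OF this]] show ?thesis using letter suffix by simp
    qed
  next
    case (eps u l v)
    then have "((u, []), \<one>, (v, zw l)) \<in> base" by (auto simp: base_edges_def)
    from up[OF rank[OF UnI1, OF this]] show ?thesis using eps by simp
  next
    case (short u p d v q)
    then have "((u, p), \<kappa> d, (v, q)) \<in> relabel \<kappa> S" by (auto simp: in_relabel)
    from up[OF rank[OF UnI2, OF this]] show ?thesis using short by simp
  qed
qed

text \<open>
  The query, with its vertices numbered, is a legal instance, as its rank can be carried over along the numbering. So
  the oracle answers the question whether there is a path of the given value.
\<close>

lemma oracle_query:
  assumes et: "set (entries et) = (\<lambda>(a, l, b). enc_edge (num a, l, num b)) ` query"
    and up: "u < n" "p \<in> Q" and vq: "v < n" "q \<in> Q" and s: "valid_word ks s" "map e s \<in> P"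
  shows "Node (enc_nat (n * k)) (Node et (Node (enc_nat (num (u, (map e s, p)))) (enc_nat (num (v, ([], q)))))) \<in> AGWP K ks
    \<longleftrightarrow> reaches K (base \<union> relabel \<kappa> S) (u, p) (inv (word_value K ks s)) (v, q)"
proof -
  let ?D = "{..<n} \<times> (P \<times> Q)" and ?E = "move_edge num ` query"
  let ?a = "(u, (map e s, p))" and ?b = "(v, ([], q))"
  have et': "set (entries et) = enc_edge ` ?E" unfolding et by force
  have inj_enc: "inj enc_edge" by (rule injI) auto
  have tree_list: "enc_list enc_edge es = t" if "entries t = map enc_edge es" for t es
    using that by (induction t arbitrary: es) auto
  obtain es where es: "entries et = map enc_edge es"
  proof -
    have "\<forall>y\<in>set (entries et). \<exists>x. y = enc_edge x" unfolding et' by blast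
    then show ?thesis using that ex_map_conv[of "entries et" enc_edge] by metis
  qed
  then have ets: "et = enc_list enc_edge es" and set_es: "set es = ?E"
    using tree_list et' inj_image_eq_iff[OF inj_enc] by auto
  have inD: "?a \<in> ?D" "?b \<in> ?D" using up vq s P_nil by auto
  have inst: "\<forall>(u, l, v) \<in> set es. u < n * k \<and> v < n * k \<and> valid_label ks l"
    unfolding set_es using query_valid num_less by fastforce
  have acyc: "acyclic (adjacency es)"
  proof (rule rank_acyclic)
    fix x y assume "(x, y) \<in> adjacency es"
    then obtain a l b where q: "(a, l, b) \<in> query" "x = num a" "y = num b"
      by (auto simp: adjacency_def set_es)
    then show "query_rank (inv_into ?D num x) < query_rank (inv_into ?D num y)"
      using query_rank[OF q(1)] query_valid[OF q(1)] inv_into_f_f[OF num_inj] by auto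
  qed
  have "relabel (label_value K ks) ?E = move_edge num ` query_val"
    unfolding relabel_def image_image by (rule image_cong) auto
  moreover have "query_val \<subseteq> ?D \<times> UNIV \<times> ?D" using query_valid by (fastforce simp: in_relabel)
  ultimately have r: "reaches K (relabel (label_value K ks) (set es)) (num ?a) \<one> (num ?b) \<longleftrightarrow> reaches K query_val ?a \<one> ?b"
    unfolding set_es using reaches_move[OF num_inj _ inD, of query_val K \<one>] by simp
  have "Node (enc_nat (n * k)) (Node et (Node (enc_nat (num ?a)) (enc_nat (num ?b)))) \<in> AGWP K ks \<longleftrightarrow>
    reaches K (relabel (label_value K ks) (set es)) (num ?a) \<one> (num ?b)"
    unfolding AGWP_iff[OF group_axioms ks] ets
    using inst acyc num_less[OF inD(1)] num_less[OF inD(2)] enc_list_inject[OF inj_enc] by auto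
  then show ?thesis unfolding r query_reaches_iff[OF up s] .
qed

end

section \<open>From the amalgamated product to its factors\<close>

text \<open>
  A finite set containing \<open>w\<close> that is closed under removing the first letter.
\<close>

definition tails :: "'x list \<Rightarrow> 'x list set" where
  "tails w = (\<lambda>i. drop i w) ` {..length w}"

lemma finite_tails: "finite (tails w)"
  and self_in_tails: "w \<in> tails w"
  by (force simp: tails_def)+

lemma tails_tl: "x # s \<in> tails w \<Longrightarrow> s \<in> tails w"
proof -
  assume "x # s \<in> tails w"
  then obtain i where i: "i \<le> length w" "drop i w = x # s" by (auto simp: tails_def)
  then have "s = drop (Suc i) w" by (metis drop_Suc list.sel(3) tl_drop)
  moreover have "i \<noteq> length w" using i by auto
  ultimately show ?thesis using i by (auto simp: tails_def)
qed

lemma set_tails: "s \<in> tails w \<Longrightarrow> set s \<subseteq> set w"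
  by (auto simp: tails_def dest: in_set_dropD)

locale amalgam_reduction = amalgam_inj G H C \<phi> \<psi>
  for G :: "('a, 'm) monoid_scheme" and H :: "('b, 'n) monoid_scheme"
    and C :: "('c, 'k) monoid_scheme" and \<phi> :: "'c \<Rightarrow> 'a" and \<psi> :: "'c \<Rightarrow> 'b" +
  fixes xs :: "'a list" and ys :: "'b list" and zs :: "('a + 'b) list set list"
  assumes C_fin: "finite (carrier C)" and xs: "generating_list G xs" and ys: "generating_list H ys"
    and zs: "generating_list (amalgamated_product G H C \<phi> \<psi>) zs"
begin

lemma xs_carrier: "set xs \<subseteq> carrier G" and ys_carrier: "set ys \<subseteq> carrier H" and zs_carrier: "set zs \<subseteq> carrier P"
  using xs ys zs by (auto simp: generating_list_def)

text \<open>
  Fixed words over the generators of the factors for the elements of \<open>C\<close>. The choice does not matter, as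
  these words and the tables made from them are constants of the algorithm.
\<close>

definition wG :: "'c \<Rightarrow> letter list" where
  "wG c = (SOME w. valid_word xs w \<and> word_value G xs w = \<phi> c)"

definition wH :: "'c \<Rightarrow> letter list" where
  "wH c = (SOME w. valid_word ys w \<and> word_value H ys w = \<psi> c)"

lemma wG: assumes "c \<in> carrier C" shows "valid_word xs (wG c)" "word_value G xs (wG c) = \<phi> c"
proof -
  have "\<exists>w. valid_word xs w \<and> word_value G xs w = \<phi> c"
    using G.generating_word[OF xs left.phi_closed[OF assms]] by metis
  from someI_ex[OF this] show "valid_word xs (wG c)" "word_value G xs (wG c) = \<phi> c" unfolding wG_def by blast+
qed

lemma wH: assumes "c \<in> carrier C" shows "valid_word ys (wH c)" "word_value H ys (wH c) = \<psi> c"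
proof -
  have "\<exists>w. valid_word ys w \<and> word_value H ys w = \<psi> c"
    using H.generating_word[OF ys right.phi_closed[OF assms]] by metis
  from someI_ex[OF this] show "valid_word ys (wH c)" "word_value H ys (wH c) = \<psi> c" unfolding wH_def by blast+
qed

definition mixed_value :: "letter + letter \<Rightarrow> 'a + 'b" where
  "mixed_value = map_sum (letter_value G xs) (letter_value H ys)"

lemma mixed_value_simps:
  "mixed_value (Inl l) = Inl (letter_value G xs l)" "mixed_value (Inr l) = Inr (letter_value H ys l)"
  by (simp_all add: mixed_value_def)

definition mixed_valid :: "mixed_word \<Rightarrow> bool" where
  "mixed_valid w \<longleftrightarrow> (\<forall>l. Inl l \<in> set w \<longrightarrow> letter_index l < length xs) \<and> (\<forall>l. Inr l \<in> set w \<longrightarrow> letter_index l < length ys)"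

lemma mixed_valid_W: "mixed_valid w \<Longrightarrow> map mixed_value w \<in> W"
proof (induction w)
  case (Cons x w)
  then show ?case
    by (cases x) (auto simp: mixed_valid_def mixed_value_def amalg_words_def
        intro: G.letter_value_closed[OF xs_carrier] H.letter_value_closed[OF ys_carrier])
qed (simp add: nil_words)

lemma left_word: "valid_word xs w \<Longrightarrow> (map (mixed_value \<circ> Inl) w, [Inl (word_value G xs w)]) \<in> R"
proof (induction w)
  case Nil
  show ?case using amalg_rel.sym[OF amalg_rel.one_left] by simp
next
  case (Cons l w)
  then have l: "letter_value G xs l \<in> carrier G" and w: "valid_word xs w"
    by (auto simp: valid_word_def intro: G.letter_value_closed[OF xs_carrier])
  have "([Inl (letter_value G xs l)], [Inl (letter_value G xs l)]) \<in> R"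
    using l by (intro amalg_rel.refl) (auto simp: amalg_words_def)
  from amalg_rel.append[OF this Cons.IH[OF w]]
  have 1: "(map (mixed_value \<circ> Inl) (l # w), [Inl (letter_value G xs l), Inl (word_value G xs w)]) \<in> R"
    by (simp add: mixed_value_simps comp_def)
  have "([Inl (letter_value G xs l), Inl (word_value G xs w)], [Inl (word_value G xs (l # w))]) \<in> R"
    using amalg_rel.mult_left[OF l G.word_value_closed[OF xs_carrier w]] by simp
  from amalg_rel.trans[OF 1 this] show ?case .
qed

lemma right_word: "valid_word ys w \<Longrightarrow> (map (mixed_value \<circ> Inr) w, [Inr (word_value H ys w)]) \<in> R"
proof (induction w)
  case Nil
  show ?case using amalg_rel.sym[OF amalg_rel.one_right] by simp
next
  case (Cons l w)
  then have l: "letter_value H ys l \<in> carrier H" and w: "valid_word ys w"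
    by (auto simp: valid_word_def intro: H.letter_value_closed[OF ys_carrier])
  have "([Inr (letter_value H ys l)], [Inr (letter_value H ys l)]) \<in> R"
    using l by (intro amalg_rel.refl) (auto simp: amalg_words_def)
  from amalg_rel.append[OF this Cons.IH[OF w]]
  have 1: "(map (mixed_value \<circ> Inr) (l # w), [Inr (letter_value H ys l), Inr (word_value H ys w)]) \<in> R"
    by (simp add: mixed_value_simps comp_def)
  have "([Inr (letter_value H ys l), Inr (word_value H ys w)], [Inr (word_value H ys (l # w))]) \<in> R"
    using amalg_rel.mult_right[OF l H.word_value_closed[OF ys_carrier w]] by simp
  from amalg_rel.trans[OF 1 this] show ?case .
qed

text \<open>
  An element of the amalgamated product is a class of words over both factors, and each letter of such a word can be spelled
  by generators of its factor.
\<close>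

lemma mixed_word_exists:
  assumes "A \<in> carrier P"
  shows "\<exists>w. mixed_valid w \<and> R `` {map mixed_value w} = A"
proof -
  from assms obtain u where u: "u \<in> W" "A = R `` {u}" unfolding carrier_P by (rule quotientE)
  have "\<exists>w. mixed_valid w \<and> (map mixed_value w, u) \<in> R" using u(1)
  proof (induction u)
    case Nil
    have "mixed_valid []" "(map mixed_value [], []) \<in> R"
      using amalg_rel.refl[OF nil_words] by (simp_all add: mixed_valid_def)
    then show ?case by blast
  next
    case (Cons x u)
    then have x: "x \<in> carrier G <+> carrier H" and "u \<in> W" by (auto simp: amalg_words_def)
    with Cons.IH obtain w where w: "mixed_valid w" "(map mixed_value w, u) \<in> R" by blast
    have "\<exists>v. mixed_valid v \<and> (map mixed_value v, [x]) \<in> R"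
    proof (cases x)
      case (Inl g)
      then have "g \<in> carrier G" using x by auto
      then obtain v where v: "valid_word xs v" "word_value G xs v = g"
        by (rule G.generating_word[OF xs])
      have "(map mixed_value (map Inl v), [x]) \<in> R" using left_word[OF v(1)] v(2) Inl by simp
      moreover have "mixed_valid (map Inl v)" using v(1) by (auto simp: mixed_valid_def valid_word_def)
      ultimately show ?thesis by blast
    next
      case (Inr h)
      then have "h \<in> carrier H" using x by auto
      then obtain v where v: "valid_word ys v" "word_value H ys v = h"
        by (rule H.generating_word[OF ys])
      have "(map mixed_value (map Inr v), [x]) \<in> R" using right_word[OF v(1)] v(2) Inr by simp
      moreover have "mixed_valid (map Inr v)" using v(1) by (auto simp: mixed_valid_def valid_word_def)
      ultimately show ?thesis by blast
    qed
    then obtain v where v: "mixed_valid v" "(map mixed_value v, [x]) \<in> R" by blast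
    have "mixed_valid (v @ w)" using v(1) w(1) by (auto simp: mixed_valid_def)
    moreover have "(map mixed_value (v @ w), x # u) \<in> R" using amalg_rel.append[OF v(2) w(2)] by simp
    ultimately show ?case by blast
  qed
  then obtain w where w: "mixed_valid w" "(map mixed_value w, u) \<in> R" by blast
  have "R `` {map mixed_value w} = A" unfolding u(2) by (rule class_eq[OF w(2)])
  with w(1) show ?thesis by blast
qed

definition zword :: "letter option \<Rightarrow> mixed_word" where
  "zword l = (SOME w. mixed_valid w \<and> R `` {map mixed_value w} = label_value P zs l)"

lemma zword:
  assumes "valid_label zs l"
  shows "mixed_valid (zword l)" "R `` {map mixed_value (zword l)} = label_value P zs l"
proof -
  have "\<exists>w. mixed_valid w \<and> R `` {map mixed_value w} = label_value P zs l"
    using mixed_word_exists[OF group.label_value_closed[OF group_P zs_carrier assms]] .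
  from someI_ex[OF this] show "mixed_valid (zword l)" "R `` {map mixed_value (zword l)} = label_value P zs l" unfolding zword_def by blast+
qed

definition labels :: "letter option list" where
  "labels = None # map (Some \<circ> Pos) [0..<length zs] @ map (Some \<circ> Neg) [0..<length zs]"

lemma set_labels: "l \<in> set labels \<longleftrightarrow> valid_label zs l"
proof (cases l)
  case (Some a)
  then show ?thesis by (cases a) (auto simp: labels_def)
qed (simp add: labels_def)

text \<open>
  What can remain to be read before a vertex of the instance is reached; \<open>pending_tails\<close> is what can be pending in
  queries. The empty words stand for having read everything.
\<close>

definition base_tails :: "mixed_word set" where
  "base_tails = insert [] (\<Union>l\<in>set labels. tails (zword l))"

definition pending_tails :: "mixed_word set" where
  "pending_tails = insert [] (\<Union>c\<in>carrier C. tails (map Inl (wG c)) \<union> tails (map Inr (wH c)))"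

lemma finite_slots: "finite base_tails" "finite pending_tails"
  using C_fin by (auto simp: base_tails_def pending_tails_def finite_tails)

lemma base_tails_props: "x # q \<in> base_tails \<Longrightarrow> q \<in> base_tails" "[] \<in> base_tails"
  "valid_label zs l \<Longrightarrow> zword l \<in> base_tails"
  by (auto simp: base_tails_def set_labels[symmetric] intro: self_in_tails dest: tails_tl)

lemma pending_tails_props: "x # q \<in> pending_tails \<Longrightarrow> q \<in> pending_tails" "[] \<in> pending_tails"
  "c \<in> carrier C \<Longrightarrow> map Inl (wG c) \<in> pending_tails" "c \<in> carrier C \<Longrightarrow> map Inr (wH c) \<in> pending_tails"
  by (auto simp: pending_tails_def intro: self_in_tails dest: tails_tl)

lemma base_tails_valid: "q \<in> base_tails \<Longrightarrow> mixed_valid q"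
proof -
  assume "q \<in> base_tails"
  then consider "q = []" | l where "valid_label zs l" "q \<in> tails (zword l)"
    by (auto simp: base_tails_def set_labels)
  then show ?thesis
  proof cases
    case 2
    with zword(1)[of l] set_tails[of q "zword l"] show ?thesis by (auto simp: mixed_valid_def)
  qed (simp add: mixed_valid_def)
qed

lemma pending_tails_valid: "s \<in> pending_tails \<Longrightarrow> mixed_valid s"
proof -
  assume "s \<in> pending_tails"
  then consider "s = []" | c where "c \<in> carrier C" "s \<in> tails (map Inl (wG c))"
    | c where "c \<in> carrier C" "s \<in> tails (map Inr (wH c))"
    by (auto simp: pending_tails_def)
  then show ?thesis
  proof cases
    case 2
    with wG(1)[of c] set_tails[of s "map Inl (wG c)"] show ?thesis by (auto simp: mixed_valid_def valid_word_def)
  next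
    case 3
    with wH(1)[of c] set_tails[of s "map Inr (wH c)"] show ?thesis by (auto simp: mixed_valid_def valid_word_def)
  qed (simp add: mixed_valid_def)
qed

definition slots :: "slot set" where "slots = pending_tails \<times> base_tails"
definition slot_index :: "slot \<Rightarrow> nat" where
  "slot_index = (SOME f. bij_betw f slots {0..<card slots})"

lemma slot_index: "bij_betw slot_index slots {0..<card slots}"
proof -
  have "finite slots" by (simp add: slots_def finite_slots)
  from ex_bij_betw_finite_nat[OF this] show ?thesis unfolding slot_index_def by (rule someI_ex)
qed

end

text \<open>
  A well-formed instance over the amalgamated product, with its edges as a set and its acyclicity as a rank.
\<close>

locale reduction_input = amalgam_reduction G H C \<phi> \<psi> xs ys zs
  for G :: "('a, 'm) monoid_scheme" and H :: "('b, 'n) monoid_scheme"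
    and C :: "('c, 'k) monoid_scheme" and \<phi> :: "'c \<Rightarrow> 'a" and \<psi> :: "'c \<Rightarrow> 'b"
    and xs :: "'a list" and ys :: "'b list" and zs :: "('a + 'b) list set list" +
  fixes n :: nat and E :: "(nat \<times> letter option \<times> nat) set" and vertex_rank :: "nat \<Rightarrow> nat"
  assumes E: "(u, l, v) \<in> E \<Longrightarrow> u < n \<and> v < n \<and> valid_label zs l \<and> vertex_rank u < vertex_rank v"
begin

text \<open>
  Lexicographic: first the rank of the vertex of the instance, then how much of the word has been read.
\<close>

definition base_rank :: "nat \<times> mixed_word \<Rightarrow> nat" where
  "base_rank = (\<lambda>(v, q). vertex_rank v * Suc (Max (length ` base_tails)) + (Max (length ` base_tails) - length q))"

abbreviation "AG \<equiv> base_edges G xs Inl n base_tails zword E"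
abbreviation "AH \<equiv> base_edges H ys Inr n base_tails zword E"

lemma base_rank_less:
  assumes "(a, g, b) \<in> base_edges K ks e n base_tails zword E"
  shows "base_rank a < base_rank b"
proof -
  let ?M = "Max (length ` base_tails)"
  from assms show ?thesis
  proof (cases rule: base_edgesE)
    case (letter v l q)
    have "length (e l # q) \<le> ?M" using letter(5) finite_slots(1) by (intro Max_ge finite_imageI imageI)
    then show ?thesis using letter by (simp add: base_rank_def)
  next
    case (eps u l v)
    have "vertex_rank u * Suc ?M + ?M < Suc (vertex_rank u) * Suc ?M" by simp
    also have "\<dots> \<le> vertex_rank v * Suc ?M" using E[OF eps(4)] by (intro mult_le_mono1) auto
    finally show ?thesis using eps by (simp add: base_rank_def)
  qed
qed

lemma AG_closed: "AG \<subseteq> UNIV \<times> carrier G \<times> UNIV"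
  using base_tails_valid G.letter_value_closed[OF xs_carrier] by (fastforce simp: base_edges_def mixed_valid_def)

lemma AH_closed: "AH \<subseteq> UNIV \<times> carrier H \<times> UNIV"
  using base_tails_valid H.letter_value_closed[OF ys_carrier] by (fastforce simp: base_edges_def mixed_valid_def)

sublocale graph: amalgam_graph G H C \<phi> \<psi> AG AH base_rank
  by unfold_locales (use AG_closed AH_closed base_rank_less in auto)

lemma mixed_edge:
  "((v, x # q), mixed_value x, (v, q)) \<in> graph.mixed" if "v < n" "x # q \<in> base_tails"
  using that base_letterI[where e=Inl] base_letterI[where e=Inr]
  unfolding graph.mixed_def in_relabel Un_iff by (cases x) (auto simp: mixed_value_simps)

lemma mixed_cases:
  assumes "(a, y, b) \<in> graph.mixed"
  obtains (letter) v x q where "a = (v, x # q)" "b = (v, q)" "y = mixed_value x" "v < n" "x # q \<in> base_tails"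
    | (eps) u l v where "a = (u, [])" "b = (v, zword l)" "y = Inl \<one>\<^bsub>G\<^esub> \<or> y = Inr \<one>\<^bsub>H\<^esub>" "(u, l, v) \<in> E"
proof -
  from assms consider g where "(a, g, b) \<in> AG" "y = Inl g" | h where "(a, h, b) \<in> AH" "y = Inr h"
    by (auto simp: graph.mixed_def in_relabel)
  then show thesis
  proof cases
    case 1
    from 1(1) show thesis
    proof (cases rule: base_edgesE)
      case (letter v l q)
      then show thesis using that(1)[of v "Inl l" q] 1(2) by (simp add: mixed_value_simps)
    next
      case (eps u l v)
      then show thesis using that(2)[of u v l] 1(2) by simp
    qed
  next
    case 2
    from 2(1) show thesis
    proof (cases rule: base_edgesE)
      case (letter v l q)
      then show thesis using that(1)[of v "Inr l" q] 2(2) by (simp add: mixed_value_simps)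
    next
      case (eps u l v)
      then show thesis using that(2)[of u v l] 2(2) by simp
    qed
  qed
qed

abbreviation "input_edges \<equiv> relabel (label_value P zs) E"

lemma input_closed: "input_edges \<subseteq> UNIV \<times> carrier P \<times> UNIV"
proof -
  have "g \<in> carrier P" if "(u, g, v) \<in> input_edges" for u g v
  proof -
    from that obtain l where "(u, l, v) \<in> E" "g = label_value P zs l" by (auto simp: in_relabel)
    then show ?thesis using E group.label_value_closed[OF group_P zs_carrier] by blast
  qed
  then show ?thesis by auto
qed

lemma class_closed: "w \<in> W \<Longrightarrow> R `` {w} \<in> carrier P"
  by (simp add: carrier_P quotientI)

lemma one_class: "x = Inl \<one>\<^bsub>G\<^esub> \<or> x = Inr \<one>\<^bsub>H\<^esub> \<Longrightarrow> w \<in> W \<Longrightarrow> R `` {x # w} = R `` {w}"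
  using class_eq[OF amalg_rel.append[OF amalg_rel.one_left amalg_rel.refl], of w]
    class_eq[OF amalg_rel.append[OF amalg_rel.one_right amalg_rel.refl], of w] by auto

text \<open>
  A path of the refined instance from \<open>(u, q)\<close> first reads \<open>q\<close> and then follows a path of the instance from \<open>u\<close>.
  The empty edges carry the identity of one of the factors.
\<close>

lemma mixed_spells_sound:
  assumes "spells graph.mixed a w b"
  shows "b = (v, []) \<Longrightarrow> snd a \<in> base_tails \<Longrightarrow> w \<in> W \<and>
    (\<exists>g. reaches P input_edges (fst a) g v \<and> R `` {w} = R `` {map mixed_value (snd a)} \<otimes>\<^bsub>P\<^esub> g)"
  using assms
proof (induction rule: spells.induct)
  case (Nil u)
  have "R `` {[]} \<otimes>\<^bsub>P\<^esub> \<one>\<^bsub>P\<^esub> = R `` {[]}" by (simp add: one_P mult_P nil_words)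
  then show ?case using reaches.refl[of P input_edges v] Nil nil_words by auto
next
  case (Cons a y a' w b)
  interpret P: group P by (rule group_P)
  from Cons.hyps(1) show ?case
  proof (cases rule: mixed_cases)
    case (letter v' x q)
    then have "snd a' \<in> base_tails" using base_tails_props(1) by auto
    from Cons.IH[OF Cons.prems(1) this] letter obtain g where w: "w \<in> W"
      and g: "reaches P input_edges v' g v" "R `` {w} = R `` {map mixed_value q} \<otimes>\<^bsub>P\<^esub> g" by auto
    have q: "map mixed_value (x # q) \<in> W" by (rule mixed_valid_W[OF base_tails_valid[OF letter(5)]])
    then have x: "[mixed_value x] \<in> W" and q: "map mixed_value q \<in> W" by (auto simp: amalg_words_def)
    have gc: "g \<in> carrier P" using P.reaches_closed[OF g(1) input_closed] .
    have "R `` {y # w} = R `` {[mixed_value x]} \<otimes>\<^bsub>P\<^esub> R `` {w}"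
      using mult_P[OF x w] letter(3) by simp
    also have "\<dots> = (R `` {[mixed_value x]} \<otimes>\<^bsub>P\<^esub> R `` {map mixed_value q}) \<otimes>\<^bsub>P\<^esub> g"
      unfolding g(2) using gc class_closed x q by (simp add: P.m_assoc)
    also have "R `` {[mixed_value x]} \<otimes>\<^bsub>P\<^esub> R `` {map mixed_value q} = R `` {map mixed_value (x # q)}"
      using mult_P[OF x q] by simp
    finally show ?thesis using letter g(1) words_append[OF x w] by auto
  next
    case (eps u l v')
    then have l: "valid_label zs l" using E by blast
    then have "snd a' \<in> base_tails" using eps base_tails_props(3) by simp
    from Cons.IH[OF Cons.prems(1) this] eps obtain g where w: "w \<in> W"
      and g: "reaches P input_edges v' g v" "R `` {w} = R `` {map mixed_value (zword l)} \<otimes>\<^bsub>P\<^esub> g" by auto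
    have "(u, label_value P zs l, v') \<in> input_edges" using eps(4) by (rule relabelI)
    from reaches.step[OF this g(1)] have r: "reaches P input_edges u (R `` {w}) v"
      unfolding g(2) zword(2)[OF l] .
    have "R `` {y # w} = R `` {w}" by (rule one_class[OF eps(3) w])
    moreover have "R `` {[]} \<otimes>\<^bsub>P\<^esub> R `` {w} = R `` {w}" using mult_P[OF nil_words w] by simp
    moreover have "y # w \<in> W" using eps(3) w by (auto simp: amalg_words_def)
    ultimately show ?thesis using r eps by auto
  qed
qed

lemma spells_tail: "q \<in> base_tails \<Longrightarrow> v < n \<Longrightarrow> spells graph.mixed (v, q) (map mixed_value q) (v, [])"
  by (induction q) (auto intro: spells.intros mixed_edge dest: base_tails_props(1))

lemma mixed_spells_complete:
  assumes "reaches P input_edges u g v"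
  shows "\<exists>w. spells graph.mixed (u, []) w (v, []) \<and> w \<in> W \<and> R `` {w} = g"
  using assms
proof (induction rule: reaches.induct)
  case (refl u)
  show ?case using spells.Nil[of graph.mixed "(u, [])"] nil_words one_P by metis
next
  case (step u a v b z)
  from step.IH obtain w where w: "spells graph.mixed (v, []) w (z, [])" "w \<in> W" "R `` {w} = b" by blast
  from step.hyps(1) obtain l where l: "(u, l, v) \<in> E" "a = label_value P zs l" by (auto simp: in_relabel)
  then have vl: "v < n" "valid_label zs l" using E by auto
  let ?m = "map mixed_value (zword l)"
  have "((u, []), Inl \<one>\<^bsub>G\<^esub>, (v, zword l)) \<in> graph.mixed"
    using base_epsI[OF l(1)] unfolding graph.mixed_def in_relabel Un_iff by blast
  then have "spells graph.mixed (u, []) (Inl \<one>\<^bsub>G\<^esub> # ?m @ w) (z, [])"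
    using spells_append[OF spells_tail[OF base_tails_props(3)[OF vl(2)] vl(1)] w(1)] by (rule spells.Cons)
  moreover have m: "?m \<in> W" by (rule mixed_valid_W[OF zword(1)[OF vl(2)]])
  moreover have "R `` {Inl \<one>\<^bsub>G\<^esub> # ?m @ w} = a \<otimes>\<^bsub>P\<^esub> b"
    using one_class[of "Inl \<one>\<^bsub>G\<^esub>" "?m @ w"] words_append[OF m w(2)] mult_P[OF m w(2)] w(3) zword(2)[OF vl(2)] l(2)
    by simp
  moreover have "Inl \<one>\<^bsub>G\<^esub> # ?m @ w \<in> W" using words_append[OF m w(2)] by (auto simp: amalg_words_def)
  ultimately show ?case by blast
qed

lemma input_iff_mixed:
  "reaches P input_edges u \<one>\<^bsub>P\<^esub> v \<longleftrightarrow> (\<exists>w. spells graph.mixed (u, []) w (v, []) \<and> (w, []) \<in> R)"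
proof
  assume "reaches P input_edges u \<one>\<^bsub>P\<^esub> v"
  from mixed_spells_complete[OF this] obtain w where
    "spells graph.mixed (u, []) w (v, [])" "w \<in> W" "R `` {w} = R `` {[]}" by (auto simp: one_P)
  then show "\<exists>w. spells graph.mixed (u, []) w (v, []) \<and> (w, []) \<in> R"
    using eq_equiv_class[OF _ equiv_rel nil_words] by blast
next
  assume "\<exists>w. spells graph.mixed (u, []) w (v, []) \<and> (w, []) \<in> R"
  then obtain w where w: "spells graph.mixed (u, []) w (v, [])" "(w, []) \<in> R" by blast
  interpret P: group P by (rule group_P)
  from mixed_spells_sound[OF w(1) HOL.refl] base_tails_props(2) obtain g where
    g: "reaches P input_edges u g v" "R `` {w} = R `` {[]} \<otimes>\<^bsub>P\<^esub> g" by auto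
  have "g \<in> carrier P" using P.reaches_closed[OF g(1) input_closed] .
  then have "R `` {w} = g" using g(2) by (simp add: one_P[symmetric])
  then show "reaches P input_edges u \<one>\<^bsub>P\<^esub> v" using g(1) class_eq[OF w(2)] by (simp add: one_P)
qed

text \<open>
  The possible shortcuts, and those found after \<open>i\<close> rounds.
\<close>

definition triples :: "((nat \<times> mixed_word) \<times> 'c \<times> (nat \<times> mixed_word)) set" where
  "triples = ({..<n} \<times> base_tails) \<times> carrier C \<times> ({..<n} \<times> base_tails)"

definition closure :: "nat \<Rightarrow> ((nat \<times> mixed_word) \<times> 'c \<times> (nat \<times> mixed_word)) set" where
  "closure i = (graph.saturate_step triples ^^ i) {}"

lemma closure_sound: "graph.sound (closure i) \<and> closure i \<subseteq> triples"
proof (induction i)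
  case 0
  show ?case by (simp add: closure_def graph.sound_def)
next
  case (Suc i)
  have "triples \<subseteq> UNIV \<times> carrier C \<times> UNIV" by (auto simp: triples_def)
  from graph.sound_step[OF _ this] Suc show ?case
    by (auto simp: closure_def graph.saturate_step_def)
qed

lemma reaches_endpoints:
  "reaches K A u g v \<Longrightarrow> A \<subseteq> D \<times> UNIV \<times> D \<Longrightarrow> u = v \<or> u \<in> D \<and> v \<in> D"
  by (induction rule: reaches.induct) auto

lemma base_endpoints: "base_edges K ks e n base_tails zword E \<subseteq> ({..<n} \<times> base_tails) \<times> UNIV \<times> ({..<n} \<times> base_tails)"
  using E base_tails_props by (auto simp: base_edges_def) 

lemma closure_saturated:
  assumes "card triples \<le> i" shows "graph.saturated (closure i)"
proof -
  let ?D = "{..<n} \<times> base_tails" and ?S = "closure i"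
  have "finite triples" using finite_slots C_fin by (simp add: triples_def)
  then have fixpoint: "graph.saturate_step triples ?S = ?S"
    unfolding closure_def using assms
    by (intro funpow_mono_fixpoint[OF graph.mono_step]) (auto simp: graph.saturate_step_def)
  have S: "?S \<subseteq> ?D \<times> UNIV \<times> ?D" using closure_sound[of i] by (auto simp: triples_def)
  have DG: "graph.left_edges ?S \<subseteq> ?D \<times> UNIV \<times> ?D" and DH: "graph.right_edges ?S \<subseteq> ?D \<times> UNIV \<times> ?D"
    using base_endpoints S by (fastforce simp: in_relabel)+
  show ?thesis
    unfolding graph.saturated_def
  proof (intro allI impI, elim conjE)
    fix u v :: "nat \<times> mixed_word" and c
    assume uv: "u \<noteq> v" and c: "c \<in> carrier C"
      and r: "reaches G (graph.left_edges ?S) u (\<phi> c) v \<or> reaches H (graph.right_edges ?S) u (\<psi> c) v"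
    from r have "u \<in> ?D \<and> v \<in> ?D"
      using uv reaches_endpoints[OF _ DG] reaches_endpoints[OF _ DH] by blast
    then have "(u, c, v) \<in> graph.saturate_step triples ?S"
      using uv c r by (auto simp: graph.saturate_step_def triples_def)
    then show "(u, c, v) \<in> ?S" using fixpoint by simp
  qed
qed

theorem closure_decides:
  assumes "card triples \<le> i"
  shows "reaches P input_edges u \<one>\<^bsub>P\<^esub> v \<longleftrightarrow> reaches G (graph.left_edges (closure i)) (u, []) \<one>\<^bsub>G\<^esub> (v, [])"
  unfolding input_iff_mixed
  using graph.saturated_decides closure_sound closure_saturated[OF assms] by blast

abbreviation "factor_graph K ks e \<kappa> w S \<equiv>
  query_graph K ks e \<kappa> w (carrier C) n E zword pending_tails base_tails S base_rank slot_index (card slots)"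

text \<open>
  The pending words mention the letters of both factors. This does no harm, as a query only
  reads those of its own factor.
\<close>

lemma factor_query:
  assumes K: "group K" "set ks \<subseteq> carrier K" and e: "inj e"
    and valid: "\<And>l w. mixed_valid w \<Longrightarrow> e l \<in> set w \<Longrightarrow> letter_index l < length ks"
    and w: "\<And>c. c \<in> carrier C \<Longrightarrow>
      valid_word ks (w c) \<and> word_value K ks (w c) = \<kappa> c \<and> map e (w c) \<in> pending_tails"
    and S: "graph.sound S" "S \<subseteq> triples"
  shows "factor_graph K ks e \<kappa> w S"
proof (rule query_graph.intro[OF K(1)], unfold_locales, goal_cases)
  case (3 l q)
  then show ?case using valid[OF base_tails_valid[OF 3], of l] by simp
next
  case (5 l s)
  then show ?case using valid[OF pending_tails_valid[OF 5], of l] by simp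
next
  case (11 u l v)
  then show ?case using E base_tails_props(3) by blast
next
  case (12 u p c v q)
  then show ?case using S(2) by (auto simp: triples_def)
next
  case (13 a g b)
  then show ?case by (auto simp: in_relabel intro: base_rank_less graph.soundD(2)[OF S(1)])
next
  case 14
  show ?case using slot_index by (simp add: bij_betw_def slots_def)
next
  case (15 d)
  then show ?case using bij_betwE[OF slot_index] by (auto simp: slots_def)
qed (use K e w finite_slots in \<open>auto intro: pending_tails_props base_tails_props\<close>)

lemma left_query:
  assumes "graph.sound S" "S \<subseteq> triples"
  shows "factor_graph G xs Inl \<phi> wG S"
  by (rule factor_query[OF G.group_axioms xs_carrier _ _ _ assms])
    (auto simp: mixed_valid_def wG pending_tails_props(3))

lemma right_query:
  assumes "graph.sound S" "S \<subseteq> triples"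
  shows "factor_graph H ys Inr \<psi> wH S"
  by (rule factor_query[OF H.group_axioms ys_carrier _ _ _ assms])
    (auto simp: mixed_valid_def wH pending_tails_props(4))

end

section \<open>The algorithm\<close>

text \<open>
  Finite tables are constants of the algorithm.
\<close>

fun lookup :: "(bintree \<times> bintree) list \<Rightarrow> bintree \<Rightarrow> bintree" where
  "lookup [] t = Leaf"
| "lookup ((a, b) # r) t = (if t = a then b else lookup r t)"

definition scale :: "nat \<Rightarrow> bintree \<Rightarrow> bintree \<Rightarrow> bintree" where
  "scale k v t = fold (\<lambda>_ b. (Node Leaf ^^ k) b) (entries v) t"

text \<open>
  The list of all unary numbers below \<open>n\<close>, in decreasing order. The first entry of the accumulator serves as the counter; at the end
  it is \<open>n\<close> itself and is dropped.
\<close>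

definition below :: "bintree \<Rightarrow> bintree" where
  "below n = right (fold (\<lambda>_ b. Node (Node Leaf (left b)) b) (entries n) (Node Leaf Leaf))"

lemma Node_funpow_enc_nat: "(Node Leaf ^^ k) (enc_nat j) = enc_nat (k + j)"
  by (induction k) auto

lemma size_Node_funpow: "size ((Node Leaf ^^ k) b) = k + size b"
  by (induction k) auto

lemma scale_enc_nat: "scale k (enc_nat v) (enc_nat j) = enc_nat (v * k + j)"
proof -
  have "fold (\<lambda>_ b. (Node Leaf ^^ k) b) (entries (enc_nat v)) (enc_nat j) = enc_nat (v * k + j)"
    by (induction v arbitrary: j) (simp_all add: Node_funpow_enc_nat algebra_simps)
  then show ?thesis by (simp add: scale_def)
qed

lemma set_below: "set (entries (below (enc_nat n))) = enc_nat ` {..<n}"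
proof -
  let ?f = "fold (\<lambda>_ b. Node (Node Leaf (left b)) b)"
  have "\<exists>l'. ?f (entries (enc_nat n)) (Node (enc_nat i) l) = Node (enc_nat (i + n)) l' \<and>
    set (entries l') = set (entries l) \<union> enc_nat ` {i..<i + n}" for i l
  proof (induction n arbitrary: i l)
    case (Suc n)
    from Suc[of "Suc i" "Node (enc_nat i) l"] obtain l' where
      "?f (entries (enc_nat n)) (Node (enc_nat (Suc i)) (Node (enc_nat i) l)) = Node (enc_nat (Suc i + n)) l'"
      "set (entries l') = set (entries (Node (enc_nat i) l)) \<union> enc_nat ` {Suc i..<Suc i + n}" by blast
    moreover have "{i..<i + Suc n} = insert i {Suc i..<Suc i + n}" by auto
    ultimately show ?case by auto
  qed simp
  from this[of 0 Leaf] show ?thesis by (auto simp: below_def lessThan_atLeast0)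
qed

lemma entries_enc_list: "entries (enc_list f ds) = map f ds"
  by (induction ds) auto

lemma polytime_if_eq:
  assumes "polytime Os f" "polytime Os g" "polytime Os h" "polytime Os k"
  shows "polytime Os (\<lambda>x. if f x = g x then h x else k x)"
proof -
  have "(if f x = g x then h x else k x) = (if tree_of_bool (f x = g x) \<noteq> Leaf then h x else k x)" for x
    by (simp add: tree_of_bool_def)
  then show ?thesis using polytime_if[OF polytime_eq[OF assms(1,2)] assms(3,4)] by simp
qed

lemma polytime_lookup:
  assumes "polytime Os f" shows "polytime Os (\<lambda>x. lookup tbl (f x))"
proof (induction tbl)
  case (Cons e r)
  obtain a b where e: "e = (a, b)" by force
  show ?case unfolding e lookup.simps by (intro polytime_if_eq polytime_const assms Cons.IH)
qed (simp add: polytime_const)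

lemma polytime_Node_funpow:
  assumes "polytime Os f" shows "polytime Os (\<lambda>x. (Node Leaf ^^ k) (f x))"
  by (induction k) (auto intro: polytime_Node polytime_const assms)

lemma polytime_scale:
  assumes "polytime Os f" "polytime Os g" shows "polytime Os (\<lambda>x. scale k (f x) (g x))"
  unfolding scale_def
  by (rule polytime_fold[where step="\<lambda>x y. Node Leaf ^^ k" and g="[:k:]"])
    (use assms in \<open>auto intro!: polytime_Node_funpow polytime_right polytime_id simp: size_Node_funpow\<close>)

lemma polytime_enc_list:
  assumes "\<And>d. d \<in> set ds \<Longrightarrow> polytime Os (\<lambda>x. h d x)"
  shows "polytime Os (\<lambda>x. enc_list (\<lambda>d. h d x) ds)"
  using assms by (induction ds) (auto intro: polytime_const polytime_Node)

lemma enc_list_entries_eq: "enc_list (\<lambda>t. t) (entries t) = t"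
  by (induction t) auto

lemma lookup_map:
  "inj f \<Longrightarrow> l \<in> set ls \<Longrightarrow> lookup (map (\<lambda>l. (f l, g l)) ls) (f l) = g l"
  by (induction ls) (auto dest: injD)

lemma lookup_none: "t \<notin> f ` set ls \<Longrightarrow> lookup (map (\<lambda>l. (f l, g l)) ls) t = Leaf"
  by (induction ls) auto

lemma enc_list_map: "enc_list (\<lambda>t. t) (map f es) = enc_list f es"
  by (induction es) auto

lemma UN_image_Times: "(\<Union>v\<in>A. f v ` B) = (\<lambda>(v, m). f v m) ` (A \<times> B)"
  by auto

lemma inj_enc_label: "inj enc_label"
  by (rule injI) simp

lemma tree_of_bool_Leaf [simp]: "tree_of_bool b = Leaf \<longleftrightarrow> \<not> b"
  by (simp add: tree_of_bool_def)

context amalgam_reduction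
begin

abbreviation "oracles \<equiv> [AGWP G xs, AGWP H ys]"

abbreviation edges_of :: "bintree \<Rightarrow> bintree" where "edges_of x \<equiv> left (right x)"
abbreviation start_of :: "bintree \<Rightarrow> bintree" where "start_of x \<equiv> left (right (right x))"
abbreviation end_of :: "bintree \<Rightarrow> bintree" where "end_of x \<equiv> right (right (right x))"

text \<open>
  The number of a vertex of a query, computed in unary from the number \<open>v\<close> of a vertex of the instance for a fixed pair of words.
\<close>

definition number :: "slot \<Rightarrow> bintree \<Rightarrow> bintree" where
  "number d v = scale (card slots) v (enc_nat (slot_index d))"

definition letters :: "nat \<Rightarrow> letter list" where
  "letters k = map Pos [0..<k] @ map Neg [0..<k]"

definition slot_list :: "slot list" where "slot_list = (SOME ds. set ds = slots)"

definition triple_list :: "(mixed_word \<times> 'c \<times> mixed_word) list" where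
  "triple_list = (SOME ds. set ds = base_tails \<times> carrier C \<times> base_tails)"

definition moves :: "(letter \<Rightarrow> letter + letter) \<Rightarrow> nat \<Rightarrow> (slot \<times> letter \<times> slot) list" where
  "moves e k = filter (\<lambda>(d, l, d'). (d, e l, d') \<in> slot_steps)
     (List.product slot_list (List.product (letters k) slot_list))"

definition word_table :: "(bintree \<times> bintree) list" where
  "word_table = map (\<lambda>l. (enc_label l, enc_nat (slot_index ([], zword l)))) labels"

fun move_tree :: "slot \<times> letter \<times> slot \<Rightarrow> bintree \<Rightarrow> bintree" where
  "move_tree (d, l, d') v = Node (number d v) (Node (enc_label (Some l)) (number d' v))"

definition move_edges :: "(letter \<Rightarrow> letter + letter) \<Rightarrow> nat \<Rightarrow> bintree \<Rightarrow> bintree" where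
  "move_edges e k x = tree_concat_map (\<lambda>v. enc_list (\<lambda>d. move_tree d v) (moves e k)) (below (left x))"

definition empty_edges :: "bintree \<Rightarrow> bintree" where
  "empty_edges x = tree_map (\<lambda>t. Node (number ([], []) (left t))
     (Node Leaf (scale (card slots) (right (right t)) (lookup word_table (left (right t)))))) (edges_of x)"

definition side_tree :: "(letter \<Rightarrow> letter + letter) \<Rightarrow> ('c \<Rightarrow> letter list) \<Rightarrow> mixed_word \<times> 'c \<times> mixed_word \<Rightarrow>
    bintree \<Rightarrow> bintree \<Rightarrow> bintree" where
  "side_tree e w = (\<lambda>(p, c, q) u v. Node (number (map e (w (inv\<^bsub>C\<^esub> c)), p) u)
     (Node (number ([], p) u) (Node Leaf (number (map e (w c), q) v))))"

text \<open>
  A possible shortcut is represented by everything about it that is needed later: its origin, its end, and for each factor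
  the start vertex of the query for it and the edge that it contributes to queries once it has been found.
\<close>

definition triple_tree :: "mixed_word \<times> 'c \<times> mixed_word \<Rightarrow> bintree \<Rightarrow> bintree \<Rightarrow> bintree" where
  "triple_tree d u v = Node (number ([], fst d) u) (Node (number ([], snd (snd d)) v)
     (Node (side_tree Inl wG d u v) (side_tree Inr wH d u v)))"

definition triples_tree :: "bintree \<Rightarrow> bintree" where
  "triples_tree x = tree_concat_map (\<lambda>u. tree_concat_map (\<lambda>v.
     enc_list (\<lambda>d. triple_tree d u v) triple_list) (below (left x))) (below (left x))"

text \<open>
  The query to oracle \<open>i\<close> with shortcuts \<open>S\<close>, start vertex \<open>a\<close> and end vertex \<open>b\<close>. Selecting by \<open>side\<close> the data for a
  factor from a shortcut gives the start vertex of its query and the edge it contributes.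
\<close>

definition ask :: "nat \<Rightarrow> (letter \<Rightarrow> letter + letter) \<Rightarrow> nat \<Rightarrow> (bintree \<Rightarrow> bintree) \<Rightarrow>
    bintree \<Rightarrow> bintree \<Rightarrow> bintree \<Rightarrow> bintree \<Rightarrow> bintree" where
  "ask i e k side x S a b = tree_of_bool (Node (scale (card slots) (left x) Leaf)
     (Node (tree_append (move_edges e k x) (tree_append (empty_edges x)
        (tree_map (\<lambda>t. right (side t)) S))) (Node a b)) \<in> oracles ! i)"

definition left_side :: "bintree \<Rightarrow> bintree" where "left_side t = left (right (right t))"
definition right_side :: "bintree \<Rightarrow> bintree" where "right_side t = right (right (right t))"

abbreviation "ask_left \<equiv> ask 0 Inl (length xs) left_side"
abbreviation "ask_right \<equiv> ask 1 Inr (length ys) right_side"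

definition saturate_tree :: "bintree \<Rightarrow> bintree \<Rightarrow> bintree" where
  "saturate_tree x S = tree_filter (\<lambda>t. if left t = left (right t) then Leaf
     else if ask_left x S (left (left_side t)) (left (right t)) \<noteq> Leaf then Node Leaf Leaf
     else ask_right x S (left (right_side t)) (left (right t))) (triples_tree x)"

text \<open>
  The number of rounds is the number of possible shortcuts, which is large enough for the saturation by
  \<open>funpow_mono_fixpoint\<close>.
\<close>

definition closure_tree :: "bintree \<Rightarrow> bintree" where
  "closure_tree x = (saturate_tree x ^^ length (entries (triples_tree x))) Leaf"

text \<open>
  After the saturation a single query about the value \<open>1\<close> within \<open>G\<close> decides the instance.
\<close>

definition decide_tree :: "bintree \<Rightarrow> bintree" where
  "decide_tree x = ask_left x (closure_tree x) (number ([], []) (start_of x))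
     (number ([], []) (end_of x))"

text \<open>
  Erasing all labels and choosing the start vertex as the end gives a graph with the answer yes, because of the empty path,
  unless it is not a legal instance. So the oracle checks the encoding, the range of the vertices and the acyclicity.
\<close>

definition blank_query :: "bintree \<Rightarrow> bintree \<Rightarrow> bintree" where
  "blank_query x a = tree_of_bool (Node (left x) (Node
     (tree_map (\<lambda>t. Node (left t) (Node Leaf (right (right t)))) (edges_of x)) (Node a a)) \<in> oracles ! 0)"

text \<open>
  What the blank queries do not see is the form of the labels, which are compared with the finitely many legal ones.
\<close>

definition bad_edges :: "bintree \<Rightarrow> bintree" where
  "bad_edges x = tree_filter (\<lambda>t. if t = Node (left t) (Node (left (right t)) (right (right t)))
     then if lookup (map (\<lambda>l. (enc_label l, Node Leaf Leaf)) labels) (left (right t)) = Leaf then Node Leaf Leaf else Leaf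
     else Node Leaf Leaf) (edges_of x)"

definition solve :: "bintree \<Rightarrow> bintree" where
  "solve x =
     (if x = Node (left x) (Node (edges_of x) (Node (start_of x) (end_of x))) then
      if bad_edges x = Leaf then
      if blank_query x (start_of x) \<noteq> Leaf then
      if blank_query x (end_of x) \<noteq> Leaf then decide_tree x
      else Leaf else Leaf else Leaf else Leaf)"

lemmas polytime_basic = polytime_id polytime_const polytime_left polytime_right polytime_Node
  polytime_if_eq polytime_if polytime_lookup polytime_scale polytime_append polytime_map
  polytime_concat_map polytime_filter polytime_enc_list

lemma polytime_number: "polytime Os f \<Longrightarrow> polytime Os (\<lambda>x. number d (f x))"
  unfolding number_def by (intro polytime_scale polytime_const)

text \<open>
  The entries become larger with the accumulator, so that its size is quadratic in \<open>n\<close>.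
\<close>

lemma polytime_below: "polytime Os below"
proof -
  let ?step = "\<lambda>_ b. Node (Node Leaf (left b)) b"
  have "size (fold ?step ys b) \<le> size b + length ys * (size (left b) + length ys + 2)" for ys :: "bintree list" and b
  proof (induction ys arbitrary: b)
    case (Cons y ys)
    from Cons[of "?step y b"] show ?case by (simp add: algebra_simps)
  qed simp
  note b = this
  have "size (fold ?step (take i (entries x)) (Node Leaf Leaf)) \<le> poly [:1, 2, 1:] (size x)" for x i
  proof -
    have len: "length (take i (entries x)) \<le> size x" using length_entries[of x] by simp
    have "size (fold ?step (take i (entries x)) (Node Leaf Leaf))
        \<le> 1 + length (take i (entries x)) * (length (take i (entries x)) + 2)"
      using b[of "take i (entries x)" "Node Leaf Leaf"] by simp
    also have "\<dots> \<le> 1 + size x * (size x + 2)" using len by (intro add_left_mono mult_le_mono) auto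
    also have "\<dots> = poly [:1, 2, 1:] (size x)" by (simp add: algebra_simps)
    finally show ?thesis .
  qed
  then have "polytime Os (\<lambda>x. fold (?step) (entries x) (Node Leaf Leaf))"
    by (intro polytime_fold_bounded[where step="\<lambda>x. ?step"] polytime_basic)
  then show ?thesis unfolding below_def[abs_def] by (rule polytime_right)
qed

lemma polytime_move_edges: "polytime Os (move_edges e k)"
proof -
  have move: "polytime Os (\<lambda>x. move_tree d (g x))" if "polytime Os g" for d g
    using that by (cases d) (auto intro!: polytime_Node polytime_const polytime_number)
  then show ?thesis
    unfolding move_edges_def[abs_def] by (intro polytime_basic polytime_comp[OF _ polytime_below] move)
qed

lemma polytime_empty_edges: "polytime Os empty_edges"
  unfolding empty_edges_def[abs_def] by (intro polytime_basic polytime_number)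

lemma polytime_triple_tree: "polytime Os f \<Longrightarrow> polytime Os g \<Longrightarrow> polytime Os (\<lambda>x. triple_tree d (f x) (g x))"
  unfolding triple_tree_def side_tree_def split_beta by (intro polytime_basic polytime_number)

lemma polytime_triples_tree: "polytime Os triples_tree"
  unfolding triples_tree_def[abs_def]
  by (intro polytime_basic polytime_comp[OF _ polytime_below] polytime_triple_tree)

lemma polytime_sides: "polytime Os left_side" "polytime Os right_side"
  unfolding left_side_def[abs_def] right_side_def[abs_def] by (intro polytime_basic)+

lemma polytime_ask_oracle:
  assumes "i < 2" "polytime oracles side" "polytime oracles f" "polytime oracles S"
    "polytime oracles a" "polytime oracles b"
  shows "polytime oracles (\<lambda>x. ask i e k side (f x) (S x) (a x) (b x))"
  unfolding ask_def
  by (rule polytime_ask) (use assms in \<open>intro polytime_basic polytime_comp[OF _ polytime_move_edges]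
    polytime_comp[OF _ polytime_empty_edges] polytime_comp[OF _ assms(2)], simp_all\<close>)

lemma polytime_saturate_tree: "polytime oracles (\<lambda>z. saturate_tree (left z) (right z))"
  unfolding saturate_tree_def
  by (intro polytime_basic polytime_comp[OF _ polytime_triples_tree] polytime_ask_oracle polytime_sides
    polytime_comp[OF _ polytime_sides(1)] polytime_comp[OF _ polytime_sides(2)]) simp_all

lemma polytime_closure_tree: "polytime oracles closure_tree"
proof -
  have T: "polytime oracles triples_tree" by (rule polytime_triples_tree)
  then obtain g where g: "\<And>x. size (triples_tree x) \<le> poly g (size x)" by (rule polytime_size) blast
  have "size (saturate_tree x S) \<le> poly g (size x)" for x S
    unfolding saturate_tree_def using size_tree_filter g by (rule order_trans)
  from polytime_iterate[OF polytime_saturate_tree T this] show ?thesis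
    unfolding closure_tree_def[abs_def] .
qed

lemma polytime_decide_tree: "polytime oracles decide_tree"
  unfolding decide_tree_def[abs_def]
  by (intro polytime_ask_oracle polytime_sides polytime_closure_tree polytime_number polytime_basic) simp

lemma polytime_blank_query: "polytime oracles f \<Longrightarrow> polytime oracles (\<lambda>x. blank_query x (f x))"
  unfolding blank_query_def by (rule polytime_ask) (intro polytime_basic, simp_all)

lemma polytime_solve: "polytime oracles solve"
  unfolding solve_def[abs_def] bad_edges_def
  by (intro polytime_basic polytime_blank_query polytime_decide_tree)

end

section \<open>Correctness of the algorithm\<close>

context amalgam_reduction
begin

abbreviation vnum :: "nat \<times> slot \<Rightarrow> nat" where
  "vnum a \<equiv> fst a * card slots + slot_index (snd a)"

lemma number_enc: "number d (enc_nat v) = enc_nat (vnum (v, d))"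
  by (simp add: number_def scale_enc_nat)

lemma set_slot_list: "set slot_list = slots"
proof -
  have "finite slots" by (simp add: slots_def finite_slots)
  from finite_list[OF this] show ?thesis unfolding slot_list_def by (rule someI_ex)
qed

lemma set_triple_list: "set triple_list = base_tails \<times> carrier C \<times> base_tails"
proof -
  have "finite (base_tails \<times> carrier C \<times> base_tails)" using finite_slots C_fin by simp
  from finite_list[OF this] show ?thesis unfolding triple_list_def by (rule someI_ex)
qed

lemma set_letters: "l \<in> set (letters k) \<longleftrightarrow> letter_index l < k"
  by (cases l) (auto simp: letters_def)

lemma in_moves: "(d, l, d') \<in> set (moves e k) \<longleftrightarrow>
    d \<in> slots \<and> d' \<in> slots \<and> letter_index l < k \<and> (d, e l, d') \<in> slot_steps"
  by (auto simp: moves_def set_slot_list set_letters)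

lemma lookup_word_table: "valid_label zs l \<Longrightarrow> lookup word_table (enc_label l) = enc_nat (slot_index ([], zword l))"
  unfolding word_table_def by (rule lookup_map[OF inj_enc_label]) (simp add: set_labels)

end

context reduction_input
begin

definition triple_enc :: "(nat \<times> mixed_word) \<times> 'c \<times> (nat \<times> mixed_word) \<Rightarrow> bintree" where
  "triple_enc = (\<lambda>((u, p), c, (v, q)). triple_tree (p, c, q) (enc_nat u) (enc_nat v))"

abbreviation edge_tree :: "(nat \<times> slot) \<times> letter option \<times> (nat \<times> slot) \<Rightarrow> bintree" where
  "edge_tree \<equiv> \<lambda>(a, l, b). enc_edge (vnum a, l, vnum b)"

context
  fixes x r :: bintree and es :: "(nat \<times> letter option \<times> nat) list"
  assumes x: "x = Node (enc_nat n) (Node (enc_list enc_edge es) r)" and es: "set es = E"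
begin

lemma set_move_edges:
  "set (entries (move_edges e k x)) =
    edge_tree ` {((v, d), Some l, (v, d')) | v d l d'. v < n \<and> (d, l, d') \<in> set (moves e k)}" (is "?A = ?B")
proof -
  let ?M = "set (moves e k)"
  have "?A = (\<Union>v\<in>{..<n}. (\<lambda>m. move_tree m (enc_nat v)) ` ?M)"
    by (simp add: move_edges_def x set_below entries_enc_list)
  also have "\<dots> = (\<lambda>(v, m). move_tree m (enc_nat v)) ` ({..<n} \<times> ?M)"
    by (rule UN_image_Times)
  also have "\<dots> = edge_tree ` (\<lambda>(v, d, l, d'). ((v, d), Some l, (v, d'))) ` ({..<n} \<times> ?M)"
    unfolding image_image by (rule image_cong) (auto simp: number_enc)
  also have "(\<lambda>(v, d, l, d'). ((v, d), Some l, (v, d'))) ` ({..<n} \<times> ?M) =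
    {((v, d), Some l, (v, d')) | v d l d'. v < n \<and> (d, l, d') \<in> ?M}"
    by (simp add: set_eq_iff image_iff Bex_def) blast
  finally show ?thesis .
qed

lemma set_empty_edges:
  "set (entries (empty_edges x)) = edge_tree ` {((u, ([], [])), None, (v, ([], zword l))) | u l v. (u, l, v) \<in> E}"
    (is "?A = ?B")
proof -
  let ?f = "\<lambda>t. Node (number ([], []) (left t))
     (Node Leaf (scale (card slots) (right (right t)) (lookup word_table (left (right t)))))"
  have f: "?f (enc_edge (u, l, v)) = edge_tree ((u, ([], [])), None, (v, ([], zword l)))" if "(u, l, v) \<in> E" for u l v
    using E[OF that] by (simp add: number_enc lookup_word_table scale_enc_nat)
  have "?A = (\<lambda>e. ?f (enc_edge e)) ` E" by (simp add: empty_edges_def x entries_enc_list es image_image)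
  also have "\<dots> = (\<lambda>(u, l, v). edge_tree ((u, ([], [])), None, (v, ([], zword l)))) ` E"
  proof (rule image_cong)
    fix e assume "e \<in> E"
    then show "?f (enc_edge e) = (\<lambda>(u, l, v). edge_tree ((u, ([], [])), None, (v, ([], zword l)))) e"
      by (cases e) (simp only: f prod.case)
  qed simp
  also have "\<dots> = edge_tree ` (\<lambda>(u, l, v). ((u, ([], [])), None, (v, ([], zword l)))) ` E"
    unfolding image_image by (rule image_cong) auto
  also have "(\<lambda>(u, l, v). ((u, ([], [])), None, (v, ([], zword l)))) ` E =
    {((u, ([], [])), None, (v, ([], zword l))) | u l v. (u, l, v) \<in> E}"
    by (auto simp: image_iff Bex_def split_beta)
  finally show ?thesis .
qed

lemma set_triples_tree: "set (entries (triples_tree x)) = triple_enc ` triples"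
proof -
  have "set (entries (triples_tree x)) =
    (\<Union>u\<in>{..<n}. \<Union>v\<in>{..<n}. (\<lambda>d. triple_tree d (enc_nat u) (enc_nat v)) ` (base_tails \<times> carrier C \<times> base_tails))"
    by (simp add: triples_tree_def x set_below entries_enc_list set_triple_list)
  also have "\<dots> = (\<lambda>(u, v, d). triple_tree d (enc_nat u) (enc_nat v)) `
    ({..<n} \<times> {..<n} \<times> base_tails \<times> carrier C \<times> base_tails)"
    unfolding UN_image_Times by (rule image_cong) auto
  also have "\<dots> = triple_enc ` (\<lambda>(u, v, p, c, q). ((u, p), c, (v, q))) `
    ({..<n} \<times> {..<n} \<times> base_tails \<times> carrier C \<times> base_tails)"
    unfolding image_image by (rule image_cong) (auto simp: triple_enc_def)
  also have "(\<lambda>(u, v, p, c, q). ((u, p), c, (v, q))) `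
    ({..<n} \<times> {..<n} \<times> base_tails \<times> carrier C \<times> base_tails) = triples"
    by (auto simp: triples_def image_iff)
  finally show ?thesis .
qed

lemma triple_enc_parts:
  fixes u v :: nat and p q :: mixed_word and c :: 'c
  defines "t \<equiv> triple_enc ((u, p), c, (v, q))"
  shows "left t = enc_nat (vnum (u, ([], p)))" "left (right t) = enc_nat (vnum (v, ([], q)))"
    "left (left_side t) = enc_nat (vnum (u, (map Inl (wG (inv\<^bsub>C\<^esub> c)), p)))"
    "right (left_side t) = edge_tree ((u, ([], p)), None, (v, (map Inl (wG c), q)))"
    "left (right_side t) = enc_nat (vnum (u, (map Inr (wH (inv\<^bsub>C\<^esub> c)), p)))"
    "right (right_side t) = edge_tree ((u, ([], p)), None, (v, (map Inr (wH c), q)))"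
  by (simp_all add: t_def left_side_def right_side_def triple_enc_def triple_tree_def side_tree_def number_enc)

text \<open>
  The right-hand side is the part of \<open>query_edges\<close> that comes from the shortcuts \<open>S\<close>.
\<close>

lemma shortcut_edges:
  assumes "\<And>u p c v q. h (triple_enc ((u, p), c, (v, q))) = edge_tree ((u, ([], p)), None, (v, (map e (w c), q)))"
  shows "h ` triple_enc ` S = edge_tree ` {((u, ([], p)), None, (v, (map e (w c), q))) | u p c v q. ((u, p), c, (v, q)) \<in> S}"
proof -
  have "h ` triple_enc ` S = edge_tree ` (\<lambda>((u, p), c, (v, q)). ((u, ([], p)), None, (v, (map e (w c), q)))) ` S"
    unfolding image_image
  proof (rule image_cong)
    fix t assume "t \<in> S"
    obtain u p c v q where t: "t = ((u, p), c, (v, q))" by (metis surj_pair)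
    show "h (triple_enc t) =
      edge_tree ((\<lambda>((u, p), c, (v, q)). ((u, ([], p)), None, (v, (map e (w c), q)))) t)"
      unfolding t assms by simp
  qed simp
  also have "(\<lambda>((u, p), c, (v, q)). ((u, ([], p)), None, (v, (map e (w c), q)))) ` S =
    {((u, ([], p)), None :: letter option, (v, (map e (w c), q))) | u p c v q. ((u, p), c, (v, q)) \<in> S}"
    by (simp add: set_eq_iff image_iff Bex_def) blast
  finally show ?thesis .
qed

lemma letter_edges:
  assumes "\<And>d l d'. d \<in> slots \<Longrightarrow> (d, e l, d') \<in> slot_steps \<Longrightarrow> letter_index l < k"
  shows "{((v, d), Some l, (v, d')) | v d l d'. v < n \<and> (d, l, d') \<in> set (moves e k)} =
    {((v, d), Some l, (v, d')) | v d l d'. v < n \<and> d \<in> slots \<and> d' \<in> slots \<and> (d, e l, d') \<in> slot_steps}"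
  using assms unfolding in_moves by blast

lemma ask_correct:
  assumes Q: "factor_graph K ks e \<kappa> w S"
    and i: "oracles ! i = AGWP K ks"
    and side: "\<And>u p c v q. right (side (triple_enc ((u, p), c, (v, q)))) =
      edge_tree ((u, ([], p)), None, (v, (map e (w c), q)))"
    and St: "set (entries St) = triple_enc ` S"
    and up: "u < n" "p \<in> base_tails" and vq: "v < n" "q \<in> base_tails"
    and s: "valid_word ks s" "map e s \<in> pending_tails"
  shows "ask i e (length ks) side x St (enc_nat (vnum (u, (map e s, p)))) (enc_nat (vnum (v, ([], q)))) \<noteq> Leaf \<longleftrightarrow>
    reaches K (base_edges K ks e n base_tails zword E \<union> relabel \<kappa> S) (u, p)
      (inv\<^bsub>K\<^esub> (word_value K ks s)) (v, q)"
proof -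
  interpret Q: query_graph K ks e \<kappa> w "carrier C" n E zword pending_tails base_tails S base_rank
    slot_index "card slots" by (rule Q)
  let ?et = "tree_append (move_edges e (length ks) x) (tree_append (empty_edges x)
        (tree_map (\<lambda>t. right (side t)) St))"
  have num: "Q.num = vnum" by (simp add: Q.num_def fun_eq_iff)
  have "letter_index l < length ks" if "d \<in> slots" "(d, e l, d') \<in> slot_steps" for d l d'
    using that(2,1) by (cases rule: slot_stepE) (auto simp: slots_def dest: Q.P_valid Q.Q_valid)
  note letters = letter_edges[OF this]
  have "set (entries ?et) = edge_tree ` Q.query"
    unfolding query_edges_def image_Un slots_def[symmetric]
    by (simp only: set_tree_append set_tree_map set_move_edges set_empty_edges St letters
        shortcut_edges[of "\<lambda>t. right (side t)" e w, OF side] Un_assoc)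
  then have et: "set (entries ?et) = (\<lambda>(a, l, b). enc_edge (Q.num a, l, Q.num b)) ` Q.query"
    unfolding num .
  have "scale (card slots) (left x) Leaf = enc_nat (n * card slots)"
    using scale_enc_nat[of "card slots" n 0] by (simp add: x)
  then show ?thesis
    using Q.oracle_query[OF et up vq s] by (simp add: ask_def num i)
qed

lemma vnum_eq:
  assumes "u < n" "v < n" "d \<in> slots" "d' \<in> slots"
  shows "vnum (u, d) = vnum (v, d') \<longleftrightarrow> u = v \<and> d = d'"
proof -
  have "graph.sound {}" by (simp add: graph.sound_def)
  then interpret Q: query_graph G xs Inl \<phi> wG "carrier C" n E zword pending_tails base_tails "{}" base_rank slot_index "card slots"
    by (rule left_query) simp
  have "Q.num (u, d) = Q.num (v, d') \<longleftrightarrow> (u, d) = (v, d')"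
    by (rule inj_on_eq_iff[OF Q.num_inj]) (use assms in \<open>auto simp: slots_def\<close>)
  then show ?thesis by (simp add: Q.num_def)
qed

lemma plain_slot: "q \<in> base_tails \<Longrightarrow> ([], q) \<in> slots"
  by (simp add: slots_def pending_tails_props(2))

text \<open>
  For a shortcut with label \<open>c\<close>, the word pending at the start vertex is one for \<open>c\<inverse>\<close>, so the oracle is asked for
  paths with the value \<open>c\<close>.
\<close>

lemma saturate_tree_correct:
  assumes S: "graph.sound S" "S \<subseteq> triples" and St: "set (entries St) = triple_enc ` S"
  shows "set (entries (saturate_tree x St)) = triple_enc ` graph.saturate_step triples S"
proof -
  let ?P = "\<lambda>t. (if left t = left (right t) then Leaf
     else if ask_left x St (left (left_side t)) (left (right t)) \<noteq> Leaf then Node Leaf Leaf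
     else ask_right x St (left (right_side t)) (left (right t)))"
  have iff: "?P (triple_enc ((u, p), c, (v, q))) \<noteq> Leaf \<longleftrightarrow> ((u, p), c, (v, q)) \<in> graph.saturate_step triples S"
    if t: "((u, p), c, (v, q)) \<in> triples" for u p c v q
  proof -
    have up: "u < n" "p \<in> base_tails" and vq: "v < n" "q \<in> base_tails" and c: "c \<in> carrier C"
      using t by (auto simp: triples_def)
    then have ic: "inv\<^bsub>C\<^esub> c \<in> carrier C" by simp
    have l: "inv\<^bsub>G\<^esub> (word_value G xs (wG (inv\<^bsub>C\<^esub> c))) = \<phi> c"
      using wG(2)[OF ic] left.phi_inv[OF ic] c by simp
    have r: "inv\<^bsub>H\<^esub> (word_value H ys (wH (inv\<^bsub>C\<^esub> c))) = \<psi> c"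
      using wH(2)[OF ic] right.phi_inv[OF ic] c by simp
    have "vnum (u, ([], p)) = vnum (v, ([], q)) \<longleftrightarrow> (u, p) = (v, q)"
      using vnum_eq[OF up(1) vq(1) plain_slot[OF up(2)] plain_slot[OF vq(2)]] by simp
    then show ?thesis
      unfolding triple_enc_parts enc_nat_inject
      using ask_correct[OF left_query[OF S] _ triple_enc_parts(4) St up vq wG(1)[OF ic]
            pending_tails_props(3)[OF ic], unfolded l, of 0]
        ask_correct[OF right_query[OF S] _ triple_enc_parts(6) St up vq wH(1)[OF ic]
            pending_tails_props(4)[OF ic], unfolded r, of 1] t
      by (simp add: graph.saturate_step_def)
  qed
  have "set (entries (saturate_tree x St)) = {y \<in> triple_enc ` triples. ?P y \<noteq> Leaf}"
    unfolding saturate_tree_def set_tree_filter set_triples_tree ..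
  also have "\<dots> = triple_enc ` {t \<in> triples. ?P (triple_enc t) \<noteq> Leaf}" by blast
  also have "{t \<in> triples. ?P (triple_enc t) \<noteq> Leaf} = graph.saturate_step triples S"
  proof -
    have "t \<in> triples \<and> ?P (triple_enc t) \<noteq> Leaf \<longleftrightarrow> t \<in> graph.saturate_step triples S" for t
    proof -
      obtain u p c v q where t: "t = ((u, p), c, (v, q))" by (metis surj_pair)
      have "graph.saturate_step triples S \<subseteq> triples" by (auto simp: graph.saturate_step_def)
      then show ?thesis using iff[of u p c v q] unfolding t by blast
    qed
    then show ?thesis by blast
  qed
  finally show ?thesis .
qed

lemma iterate_correct: "set (entries ((saturate_tree x ^^ i) Leaf)) = triple_enc ` closure i"
proof (induction i)
  case (Suc i)
  from saturate_tree_correct[OF _ _ Suc] closure_sound[of i] show ?case by (simp add: closure_def)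
qed (simp add: closure_def)

text \<open>
  Distinct shortcuts have distinct trees, as they differ in the origin, in the end, or in the pending word. Hence the
  number of rounds is not smaller than the number of possible shortcuts.
\<close>

lemma inj_triple_enc: "inj_on triple_enc triples"
proof (rule inj_onI)
  fix t t' assume tt: "t \<in> triples" "t' \<in> triples" and eq: "triple_enc t = triple_enc t'"
  obtain u p c v q where t: "t = ((u, p), c, (v, q))" by (metis surj_pair)
  obtain u' p' c' v' q' where t': "t' = ((u', p'), c', (v', q'))" by (metis surj_pair)
  from tt have up: "u < n" "p \<in> base_tails" "v < n" "q \<in> base_tails" "c \<in> carrier C"
    and up': "u' < n" "p' \<in> base_tails" "v' < n" "q' \<in> base_tails" "c' \<in> carrier C"
    by (auto simp: triples_def t t')
  have "vnum (u, ([], p)) = vnum (u', ([], p'))" "vnum (v, ([], q)) = vnum (v', ([], q'))"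
    using eq triple_enc_parts(1,2)[of u p c v q] triple_enc_parts(1,2)[of u' p' c' v' q']
    unfolding t t' by (metis enc_nat_inject)+
  then have 1: "u = u'" "p = p'" "v = v'" "q = q'" using vnum_eq up up' plain_slot by auto
  have "edge_tree ((u, ([], p)), None, (v, (map Inl (wG c), q))) = edge_tree ((u', ([], p')), None, (v', (map Inl (wG c'), q')))"
    using eq triple_enc_parts(4)[of u p c v q] triple_enc_parts(4)[of u' p' c' v' q'] unfolding t t' by metis
  then have "vnum (v, (map Inl (wG c), q)) = vnum (v, (map Inl (wG c'), q))" using 1 by simp
  moreover have "(map Inl (wG c), q) \<in> slots" "(map Inl (wG c'), q) \<in> slots"
    using up up' by (auto simp: slots_def pending_tails_props(3))
  ultimately have "map Inl (wG c) = (map Inl (wG c') :: mixed_word)" using vnum_eq[of v v] up(3) by simp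
  then have "wG c = wG c'" by (simp add: inj_map_eq_map)
  then have "\<phi> c = \<phi> c'" using wG(2)[OF up(5)] wG(2)[OF up'(5)] by simp
  then have "c = c'" using \<phi>_inj up(5) up'(5) by (auto dest: inj_onD)
  with 1 show "t = t'" by (simp add: t t')
qed

theorem decide_tree_correct:
  assumes r: "r = Node (enc_nat a) (enc_nat b)" and "a < n" "b < n"
  shows "decide_tree x \<noteq> Leaf \<longleftrightarrow> reaches P input_edges a \<one>\<^bsub>P\<^esub> b"
proof -
  let ?N = "length (entries (triples_tree x))"
  \<comment> \<open>The rounds are counted by the list of trees, which has at least as many entries as there are shortcuts.\<close>
  have "card triples = card (triple_enc ` triples)" by (rule card_image[OF inj_triple_enc, symmetric])
  also have "\<dots> \<le> ?N" unfolding set_triples_tree[symmetric] by (rule card_length)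
  finally have N: "card triples \<le> ?N" .
  have "number ([], []) (start_of x) = enc_nat (vnum (a, (map Inl [], [])))"
    "number ([], []) (end_of x) = enc_nat (vnum (b, ([], [])))"
    by (simp_all add: x r number_enc)
  then have "decide_tree x \<noteq> Leaf \<longleftrightarrow> reaches G (graph.left_edges (closure ?N)) (a, []) (inv\<^bsub>G\<^esub> (word_value G xs [])) (b, [])"
    unfolding decide_tree_def closure_tree_def
    using closure_sound iterate_correct assms(2,3) base_tails_props(2) pending_tails_props(2)
    by (simp only:) (rule ask_correct[OF left_query _ triple_enc_parts(4)], auto simp: valid_word_def)
  then show ?thesis using closure_decides[OF N] by simp
qed

end

end

context amalgam_reduction
begin

lemma bad_edges_Leaf: "bad_edges x = Leaf \<longleftrightarrow>
   (\<forall>t \<in> set (entries (edges_of x)). \<exists>l. valid_label zs l \<and> t = Node (left t) (Node (enc_label l) (right (right t))))"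
proof -
  let ?tbl = "map (\<lambda>l. (enc_label l, Node Leaf Leaf)) labels"
  have look: "lookup ?tbl t \<noteq> Leaf \<longleftrightarrow> (\<exists>l. valid_label zs l \<and> t = enc_label l)" for t
  proof (cases "t \<in> enc_label ` set labels")
    case True
    then show ?thesis
      using lookup_map[OF inj_enc_label, of _ labels "\<lambda>_. Node Leaf Leaf"]
      by (auto simp: set_labels)
  next
    case False
    then show ?thesis using lookup_none[of t enc_label labels "\<lambda>_. Node Leaf Leaf"] by (auto simp: set_labels)
  qed
  have "bad_edges x = Leaf \<longleftrightarrow> set (entries (bad_edges x)) = {}" by (cases "bad_edges x") auto
  also have "\<dots> \<longleftrightarrow> (\<forall>t \<in> set (entries (edges_of x)).
    t = Node (left t) (Node (left (right t)) (right (right t))) \<and> lookup ?tbl (left (right t)) \<noteq> Leaf)"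
    unfolding bad_edges_def set_tree_filter by auto
  also have "\<dots> \<longleftrightarrow> (\<forall>t \<in> set (entries (edges_of x)). \<exists>l. valid_label zs l \<and> t = Node (left t) (Node (enc_label l) (right (right t))))"
  proof -
    have "(t = Node (left t) (Node (left (right t)) (right (right t))) \<and> lookup ?tbl (left (right t)) \<noteq> Leaf) \<longleftrightarrow>
      (\<exists>l. valid_label zs l \<and> t = Node (left t) (Node (enc_label l) (right (right t))))" for t
      unfolding look by (cases t; cases "right t") auto
    then show ?thesis by simp
  qed
  finally show ?thesis .
qed

text \<open>
  If both blank queries are answered yes, the tree is a graph up to the labels. Edges with the label erased have
  the same ends, so acyclicity carries over.
\<close>

lemma instance_check:
  "(x = Node (left x) (Node (edges_of x) (Node (start_of x) (end_of x))) \<and>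
    bad_edges x = Leaf \<and> blank_query x (start_of x) \<noteq> Leaf \<and> blank_query x (end_of x) \<noteq> Leaf)
   \<longleftrightarrow> (\<exists>n es a b. x = Node (enc_nat n) (Node (enc_list enc_edge es) (Node (enc_nat a) (enc_nat b))) \<and>
     (\<forall>(u, l, v) \<in> set es. u < n \<and> v < n \<and> valid_label zs l) \<and> acyclic (adjacency es) \<and> a < n \<and> b < n)"
   (is "?L \<longleftrightarrow> ?R")
proof
  let ?strip = "\<lambda>t. Node (left t) (Node Leaf (right (right t)))"
  assume L: ?L
  let ?e = "edges_of x" and ?y = "\<lambda>a. Node (left x) (Node (tree_map ?strip (edges_of x)) (Node a a))"
  from L have 1: "?y (start_of x) \<in> AGWP G xs" and 2: "?y (end_of x) \<in> AGWP G xs"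
    by (auto simp: blank_query_def)
  from 1 obtain n es0 a a' where n1: "?y (start_of x) = Node (enc_nat n) (Node (enc_list enc_edge es0) (Node (enc_nat a) (enc_nat a')))"
    and es0: "\<forall>(u, l, v) \<in> set es0. u < n \<and> v < n \<and> valid_label xs l" "acyclic (adjacency es0)" "a < n"
    unfolding AGWP_iff[OF G.group_axioms xs_carrier] by blast
  from n1 have n: "left x = enc_nat n" "tree_map ?strip ?e = enc_list enc_edge es0" "start_of x = enc_nat a"
    by simp_all
  from 2 obtain n' b b' es1 where n2: "?y (end_of x) = Node (enc_nat n') (Node (enc_list enc_edge es1) (Node (enc_nat b) (enc_nat b')))" and "b < n'"
    unfolding AGWP_iff[OF G.group_axioms xs_carrier] by blast
  with n(1) have b: "end_of x = enc_nat b" "b < n" by simp_all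
  have "\<exists>u l v. t = enc_edge (u, l, v) \<and> valid_label zs l \<and> (u, None, v) \<in> set es0" if t: "t \<in> set (entries ?e)" for t
  proof -
    from L t obtain l where l: "valid_label zs l" "t = Node (left t) (Node (enc_label l) (right (right t)))"
      unfolding bad_edges_Leaf by blast
    have "?strip t \<in> set (entries (tree_map ?strip ?e))" using t by simp
    then have "?strip t \<in> enc_edge ` set es0" unfolding n(2) by (simp add: entries_enc_list)
    then obtain u l' v where e: "?strip t = enc_edge (u, l', v)" "(u, l', v) \<in> set es0" by auto
    then have "enc_label l' = enc_label None" by simp
    then have "l' = None" unfolding enc_label_inject .
    then have "t = enc_edge (u, l, v)" "(u, None, v) \<in> set es0" using l(2) e by auto
    then show ?thesis using l(1) by blast
  qed
  then have "\<forall>t\<in>set (entries ?e). \<exists>e. t = enc_edge e \<and> valid_label zs (fst (snd e)) \<and> (fst e, None, snd (snd e)) \<in> set es0"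
    by fastforce
  then obtain f where f: "\<And>t. t \<in> set (entries ?e) \<Longrightarrow> t = enc_edge (f t) \<and> valid_label zs (fst (snd (f t))) \<and> (fst (f t), None, snd (snd (f t))) \<in> set es0"
    by metis
  define es where "es = map f (entries ?e)"
  have "map enc_edge es = entries ?e" unfolding es_def map_map by (rule map_idI) (use f in auto)
  then have enc: "enc_list enc_edge es = ?e"
    using enc_list_entries_eq[of ?e] by (metis enc_list_map)
  have edges: "\<forall>e \<in> set es. valid_label zs (fst (snd e)) \<and> (fst e, None, snd (snd e)) \<in> set es0"
    using f by (auto simp: es_def)
  have "adjacency es \<subseteq> adjacency es0" using edges by (force simp: adjacency_def)
  then have ac: "acyclic (adjacency es)" using acyclic_subset[OF es0(2)] by blast
  have val: "\<forall>(u, l, v) \<in> set es. u < n \<and> v < n \<and> valid_label zs l" using edges es0(1) by fastforce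
  have "x = Node (enc_nat n) (Node ?e (Node (enc_nat a) (enc_nat b)))" using L n b by metis
  with enc val ac es0(3) b(2) show ?R by metis
next
  let ?strip = "\<lambda>t. Node (left t) (Node Leaf (right (right t)))"
  assume ?R
  then obtain n es a b where x: "x = Node (enc_nat n) (Node (enc_list enc_edge es) (Node (enc_nat a) (enc_nat b)))"
    and es: "\<forall>(u, l, v) \<in> set es. u < n \<and> v < n \<and> valid_label zs l" "acyclic (adjacency es)" and ab: "a < n" "b < n" by blast
  define es0 where "es0 = rev (map (\<lambda>(u, l, v). (u, None :: letter option, v)) es)"
  have "entries (tree_map ?strip (enc_list enc_edge es)) = map enc_edge es0"
    by (auto simp: tree_map_def entries_fold_Node entries_enc_list es0_def rev_map)
  then have m: "tree_map ?strip (enc_list enc_edge es) = enc_list enc_edge es0"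
    using enc_list_entries_eq by (metis enc_list_map)
  have "adjacency es0 = adjacency es" by (force simp: adjacency_def es0_def image_image)
  then have ac: "acyclic (adjacency es0)" using es(2) by simp
  have val: "\<forall>(u, l, v) \<in> set es0. u < n \<and> v < n \<and> valid_label xs l" using es(1) by (auto simp: es0_def)
  have blank: "blank_query x (enc_nat c) \<noteq> Leaf" if c: "c < n" for c
  proof -
    let ?y = "Node (enc_nat n) (Node (enc_list enc_edge es0) (Node (enc_nat c) (enc_nat c)))"
    have "reaches G (relabel (label_value G xs) (set es0)) c \<one>\<^bsub>G\<^esub> c" by (rule reaches.refl)
    with c ac val have "?y \<in> AGWP G xs"
      unfolding AGWP_iff[OF G.group_axioms xs_carrier]
      by (intro exI[of _ n] exI[of _ es0] exI[of _ c] conjI) simp_all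
    moreover have "blank_query x (enc_nat c) = tree_of_bool (?y \<in> AGWP G xs)"
      by (simp add: blank_query_def x m)
    ultimately show ?thesis by simp
  qed
  have "bad_edges x = Leaf"
    unfolding bad_edges_Leaf using es(1) by (fastforce simp: x entries_enc_list)
  then show ?L using blank ab by (simp add: x)
qed

theorem solve_correct: "solve x \<noteq> Leaf \<longleftrightarrow> x \<in> AGWP P zs"
proof -
  let ?I = "\<lambda>n es a b. x = Node (enc_nat n) (Node (enc_list enc_edge es) (Node (enc_nat a) (enc_nat b))) \<and>
     (\<forall>(u, l, v) \<in> set es. u < n \<and> v < n \<and> valid_label zs l) \<and> acyclic (adjacency es) \<and> a < n \<and> b < n"
  have decide: "decide_tree x \<noteq> Leaf \<longleftrightarrow> reaches P (relabel (label_value P zs) (set es)) a \<one>\<^bsub>P\<^esub> b"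
    if I: "?I n es a b" for n es a b
  proof -
    have "finite (adjacency es)" by (simp add: adjacency_def)
    with I obtain rk where rk: "\<And>u v. (u, v) \<in> adjacency es \<Longrightarrow> rk u < (rk v :: nat)"
      using acyclic_rank by metis
    interpret reduction_input G H C \<phi> \<psi> xs ys zs n "set es" rk
    proof
      fix u l v assume e: "(u, l, v) \<in> set es"
      then have "(u, v) \<in> adjacency es" by (force simp: adjacency_def)
      with rk e I show "u < n \<and> v < n \<and> valid_label zs l \<and> rk u < rk v" by blast
    qed
    from I have "x = Node (enc_nat n) (Node (enc_list enc_edge es) (Node (enc_nat a) (enc_nat b)))" "a < n" "b < n"
      by blast+
    then show ?thesis by (intro decide_tree_correct[where es=es]) simp_all
  qed
  have "solve x \<noteq> Leaf \<longleftrightarrow> (\<exists>n es a b. ?I n es a b) \<and> decide_tree x \<noteq> Leaf"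
    unfolding instance_check[symmetric] solve_def by auto
  also have "\<dots> \<longleftrightarrow> (\<exists>n es a b. ?I n es a b \<and> reaches P (relabel (label_value P zs) (set es)) a \<one>\<^bsub>P\<^esub> b)"
    using decide by blast
  also have "\<dots> \<longleftrightarrow> x \<in> AGWP P zs"
    unfolding AGWP_iff[OF group_P zs_carrier] by blast
  finally show ?thesis .
qed

end

theorem theorem4p1:
  fixes G :: "('a, 'm) monoid_scheme" and H :: "('b, 'n) monoid_scheme"
    and C :: "('c, 'k) monoid_scheme" and \<phi> :: "'c \<Rightarrow> 'a" and \<psi> :: "'c \<Rightarrow> 'b"
    and xs :: "'a list" and ys :: "'b list" and zs :: "('a + 'b) list set list"
  assumes "group G" and "group H" and "group C" and "finite (carrier C)"
    and "\<phi> \<in> hom C G" and "inj_on \<phi> (carrier C)"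
    and "\<psi> \<in> hom C H" and "inj_on \<psi> (carrier C)"
    and "generating_list G xs" and "generating_list H ys"
    and "generating_list (amalgamated_product G H C \<phi> \<psi>) zs"
  shows "cook_reducible (AGWP (amalgamated_product G H C \<phi> \<psi>) zs) [AGWP G xs, AGWP H ys]"
proof -
  interpret G: group G by fact
  interpret H: group H by fact
  interpret C: group C by fact
  interpret amalgam_reduction G H C \<phi> \<psi> xs ys zs
    by unfold_locales (use assms in auto)
  show ?thesis by (rule cook_reducible_polytime[OF polytime_solve solve_correct])
qed

end
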